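(* Assume that $G(o,o|z)=\sum_{n\ge0}\mathbb{P}[X_n=o]z^n$ has radius of convergence strictly bigger than $1$. Let $\beta\in(0,1)$ and let $\bigl((X_n,\Phi_n)\bigr)_{n\in\mathbb{N}_0}$ be the lamplighter random walk over the free product $V$ with switching probability $\beta$. Then there exists a real number $\mathfrak{c}_{LL}\in(0,\infty)$ such that $$\mathfrak{c}_{LL}=\lim_{n\to\infty}\frac1n\,\ell_{\mathrm{LL}}\bigl([X_0,\ldots,X_n],\Phi_n\bigr)\quad\text{almost surely.}$$
   Context: Notation: $\mathbb{N}=\{1,2,\dots\}$, $\mathbb{N}_0=\mathbb{N}\cup\{0\}$. Free product. Let $V_1,V_2$ be disjoint finite or countable sets with $|V_i|\ge 2$, not both of cardinality $2$, with distinguished elements (roots) $o_i\in V_i$; put $V_i^\times=V_i\setminus\{o_i\}$. For $i\in\{1,2\}$ let $P_i=(p_i(x,y))_{x,y\in V_i}$ be a transition matrix on $V_i$ with $p_i(x,x)=0$ for all $x\in V_i$ and such that for every $x\in V_i$ there is $n_x\in\mathbb{N}$ with $p_i^{(n_x)}(o_i,x)>0$ ($p_i^{(n)}$ denotes $n$-step transition probabilities). The free product $V=V_1*V_2$ is the set of all finite words $v_1\dots v_n$, $n\in\mathbb{N}$, with letters in $V_1^\times\cup V_2^\times$ such that no two consecutive letters lie in the same $V_i^\times$, together with the empty word $o$; both $o_1,o_2$ are identified with $o$, so $V_i\subset V$. Type: $\delta(v_1\dots v_n)=i$ if $v_n\in V_i^\times$ ($o$ has no type). Words are concatenated whenever the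 result lies in $V$, with $uo=ou=u$. Random walk. Fix $\alpha\in(0,1)$. Put $\bar p_i(uv,uw)=p_i(v,w)$ for $u\in V$ with $\delta(u)\ne i$ ($u=o$ allowed) and $v,w\in V_i$, and $\bar p_i(x,y)=0$ otherwise. Let $P=\alpha\bar P_1+(1-\alpha)\bar P_2=(p(x,y))_{x,y\in V}$, the transition matrix of a random walk on $V$. A path is a finite sequence $[v_0,\dots,v_n]$, $n\in\mathbb{N}_0$, in $V$ with $p(v_{i-1},v_i)>0$ for each $i$; its length is $n$. $\Pi$ is the set of all finite paths. Lamplighter walk. Let $\mathrm{Conf}=\{\phi:V\to\{0,1\}: |\mathrm{supp}(\phi)|<\infty\}$. The lamplighter random walk is the Markov chain $((X_n,\Phi_n))_{n\in\mathbb{N}_0}$ on $V\times\mathrm{Conf}$ with $X_0=o$, $\Phi_0=\mathbf{0}$ (the zero function) and transition probabilities $p_{\mathrm{LL}}((x_1,\phi_1),(x_2,\phi_2))$ equal to $p(x_1,x_2)\beta$ if $\mathrm{supp}(\phi_2-\phi_1)=\{x_2\}$, equal to $p(x_1,x_2)(1-\beta)$ if $\phi_1=\phi_2$, and $0$ otherwise. Its first component $(X_n)$ is the Markov chain on $V$ with transition matrix $P$ started at $o$. For $\pi=[u_0,\dots,u_n]\in\Pi$ and $\phi:V\to\{0,1\}$ with $\mathrm{supp}(\phi)\subseteq\{u_0,\dots,u_n\}$, $\ell_{\mathrm{LL}}(\pi,\phi)$ is the minimal length of a path $\widetilde\pi\in\Pi$ from $u_0$ to $u_n$ which visits all elements of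 $\mathrm{supp}(\phi)$. *)

theory Defs
  imports "HOL-Probability.Probability"
begin

text \<open>
  The two factors are given as families \<^term>\<open>V\<close>, \<^term>\<open>rt\<close> (roots), \<^term>\<open>p\<close> (transition
  matrices) indexed by \<^term>\<open>i \<in> {1, 2::nat}\<close>; only these two indices are ever used, and only
  the values of \<^term>\<open>p i\<close> on \<^term>\<open>V i \<times> V i\<close> matter.
\<close>

definition transition_matrix_on :: "'s set \<Rightarrow> ('s \<Rightarrow> 's \<Rightarrow> real) \<Rightarrow> bool" where
  "transition_matrix_on S q \<longleftrightarrow>
     (\<forall>x\<in>S. (\<forall>y\<in>S. 0 \<le> q x y) \<and> (q x has_sum 1) S)"

primrec nstep :: "'s set \<Rightarrow> ('s \<Rightarrow> 's \<Rightarrow> real) \<Rightarrow> nat \<Rightarrow> 's \<Rightarrow> 's \<Rightarrow> real" where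
  "nstep S q 0 x y = (if x = y then 1 else 0)"
| "nstep S q (Suc n) x y = (\<Sum>\<^sub>\<infinity>w\<in>S. q x w * nstep S q n w y)"

definition nonroot :: "(nat \<Rightarrow> 'a set) \<Rightarrow> (nat \<Rightarrow> 'a) \<Rightarrow> nat \<Rightarrow> 'a set" where
  "nonroot V rt i = V i - {rt i}"

text \<open>Words are lists of letters; the empty word \<^term>\<open>[]\<close> is the root of the free product.\<close>

definition free_product :: "(nat \<Rightarrow> 'a set) \<Rightarrow> (nat \<Rightarrow> 'a) \<Rightarrow> 'a list set" where
  "free_product V rt =
     {w. set w \<subseteq> nonroot V rt 1 \<union> nonroot V rt 2 \<and>
         successively (\<lambda>a b. \<not> (\<exists>i\<in>{1, 2}. a \<in> nonroot V rt i \<and> b \<in> nonroot V rt i)) w}"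

definition has_type :: "(nat \<Rightarrow> 'a set) \<Rightarrow> (nat \<Rightarrow> 'a) \<Rightarrow> 'a list \<Rightarrow> nat \<Rightarrow> bool" where
  "has_type V rt w i \<longleftrightarrow> w \<noteq> [] \<and> last w \<in> nonroot V rt i"

text \<open>The embedding of \<^term>\<open>V i\<close> into the free product, sending the root to the empty word.\<close>

definition embed :: "(nat \<Rightarrow> 'a) \<Rightarrow> nat \<Rightarrow> 'a \<Rightarrow> 'a list" where
  "embed rt i v = (if v = rt i then [] else [v])"

definition lift_decomp ::
  "(nat \<Rightarrow> 'a set) \<Rightarrow> (nat \<Rightarrow> 'a) \<Rightarrow> nat \<Rightarrow> 'a list \<Rightarrow> 'a list \<Rightarrow> 'a list \<Rightarrow> 'a \<Rightarrow> 'a \<Rightarrow> bool" where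
  "lift_decomp V rt i x y u v w \<longleftrightarrow>
     u \<in> free_product V rt \<and> \<not> has_type V rt u i \<and> v \<in> V i \<and> w \<in> V i \<and>
     x = u @ embed rt i v \<and> y = u @ embed rt i w"

text \<open>
  The lift of \<^term>\<open>p i\<close> to the free product. The decomposition of a pair \<^term>\<open>(x, y)\<close> is unique
  if it exists, so the description below is meaningful; see \<open>lift_matrix_eq\<close>.
\<close>

definition lift_matrix ::
  "(nat \<Rightarrow> 'a set) \<Rightarrow> (nat \<Rightarrow> 'a) \<Rightarrow> (nat \<Rightarrow> 'a \<Rightarrow> 'a \<Rightarrow> real) \<Rightarrow> nat \<Rightarrow> 'a list \<Rightarrow> 'a list \<Rightarrow> real" where
  "lift_matrix V rt p i x y =
     (if \<exists>u v w. lift_decomp V rt i x y u v w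
      then THE r. \<exists>u v w. lift_decomp V rt i x y u v w \<and> r = p i v w
      else 0)"

lemma lift_decomp_unique:
  assumes "lift_decomp V rt i x y u v w" "lift_decomp V rt i x y u' v' w'"
  shows "u = u' \<and> v = v' \<and> w = w'"
  using assms
  by (auto simp: lift_decomp_def embed_def has_type_def nonroot_def split: if_splits)

lemma lift_matrix_eq:
  assumes "u \<in> free_product V rt" "\<not> has_type V rt u i" "v \<in> V i" "w \<in> V i"
  shows "lift_matrix V rt p i (u @ embed rt i v) (u @ embed rt i w) = p i v w"
proof -
  have D: "lift_decomp V rt i (u @ embed rt i v) (u @ embed rt i w) u v w"
    using assms by (simp add: lift_decomp_def)
  have "(THE r. \<exists>u' v' w'. lift_decomp V rt i (u @ embed rt i v) (u @ embed rt i w) u' v' w'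
           \<and> r = p i v' w') = p i v w"
    using D lift_decomp_unique[OF D] by (intro the_equality) blast+
  then show ?thesis
    using D by (auto simp: lift_matrix_def)
qed

definition walk_matrix ::
  "(nat \<Rightarrow> 'a set) \<Rightarrow> (nat \<Rightarrow> 'a) \<Rightarrow> (nat \<Rightarrow> 'a \<Rightarrow> 'a \<Rightarrow> real) \<Rightarrow> real \<Rightarrow> 'a list \<Rightarrow> 'a list \<Rightarrow> real" where
  "walk_matrix V rt p \<alpha> x y =
     \<alpha> * lift_matrix V rt p 1 x y + (1 - \<alpha>) * lift_matrix V rt p 2 x y"

text \<open>
  A path \<open>[v\<^sub>0, \<dots>, v\<^sub>n]\<close> is a non-empty list; its length \<open>n\<close> is one less than the length of the list.
\<close>

definition is_path :: "'s set \<Rightarrow> ('s \<Rightarrow> 's \<Rightarrow> real) \<Rightarrow> 's list \<Rightarrow> bool" where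
  "is_path S q \<pi> \<longleftrightarrow> \<pi> \<noteq> [] \<and> set \<pi> \<subseteq> S \<and> successively (\<lambda>x y. q x y > 0) \<pi>"

definition path_length :: "'s list \<Rightarrow> nat" where
  "path_length \<pi> = length \<pi> - 1"

definition supp :: "('s \<Rightarrow> int) \<Rightarrow> 's set" where
  "supp \<phi> = {x. \<phi> x \<noteq> 0}"

text \<open>
  A function \<open>S \<rightarrow> {0, 1}\<close> is represented by its extension by zero to the whole type.
\<close>

definition Conf :: "'s set \<Rightarrow> ('s \<Rightarrow> int) set" where
  "Conf S = {\<phi>. range \<phi> \<subseteq> {0, 1} \<and> supp \<phi> \<subseteq> S \<and> finite (supp \<phi>)}"

definition lamplighter_matrix ::
  "('s \<Rightarrow> 's \<Rightarrow> real) \<Rightarrow> real \<Rightarrow> 's \<times> ('s \<Rightarrow> int) \<Rightarrow> 's \<times> ('s \<Rightarrow> int) \<Rightarrow> real" where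
  "lamplighter_matrix q \<beta> = (\<lambda>(x1, \<phi>1) (x2, \<phi>2).
     if supp (\<lambda>x. \<phi>2 x - \<phi>1 x) = {x2} then q x1 x2 * \<beta>
     else if \<phi>1 = \<phi>2 then q x1 x2 * (1 - \<beta>)
     else 0)"

text \<open>
  \<open>\<ell>\<^sub>L\<^sub>L(\<pi>, \<phi>)\<close>. For a path \<open>\<pi>\<close> with \<^term>\<open>supp \<phi> \<subseteq> set \<pi>\<close> the minimum exists, since \<open>\<pi>\<close>
  itself is a competitor.
\<close>

definition lamplighter_length ::
  "'s set \<Rightarrow> ('s \<Rightarrow> 's \<Rightarrow> real) \<Rightarrow> 's list \<Rightarrow> ('s \<Rightarrow> int) \<Rightarrow> nat" where
  "lamplighter_length S q \<pi> \<phi> =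
     (LEAST k. \<exists>\<pi>'. is_path S q \<pi>' \<and> hd \<pi>' = hd \<pi> \<and> last \<pi>' = last \<pi> \<and>
                    supp \<phi> \<subseteq> set \<pi>' \<and> k = path_length \<pi>')"

text \<open>
  A time-homogeneous Markov chain on a countable state space \<^term>\<open>S\<close>, started at \<^term>\<open>s\<close>. The
  Markov property is written multiplicatively to avoid conditioning on null events.
\<close>

definition markov_chain ::
  "'w measure \<Rightarrow> 's set \<Rightarrow> ('s \<Rightarrow> 's \<Rightarrow> real) \<Rightarrow> 's \<Rightarrow> (nat \<Rightarrow> 'w \<Rightarrow> 's) \<Rightarrow> bool" where
  "markov_chain M S q s Z \<longleftrightarrow>
     prob_space M \<and>
     (\<forall>n. Z n \<in> measurable M (count_space S)) \<and>
     (AE \<omega> in M. Z 0 \<omega> = s) \<and>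
     (\<forall>n. \<forall>a :: nat \<Rightarrow> 's. (\<forall>k\<le>Suc n. a k \<in> S) \<longrightarrow>
        measure M {\<omega> \<in> space M. \<forall>k\<le>Suc n. Z k \<omega> = a k} =
        measure M {\<omega> \<in> space M. \<forall>k\<le>n. Z k \<omega> = a k} * q (a n) (a (Suc n)))"

end

theory Submission
  imports Defs "HOL-Library.Sublist"
begin

text \<open>
  The proof is a regeneration argument. The cone of a word \<open>w\<close> is the set of words that begin with \<open>w\<close>; in the
  free product it can be entered and left only through \<open>w\<close>. Fix one of the two types, call it \<open>I\<close>, and the other
  one \<open>J\<close>. A time \<open>n\<close> is a regeneration time if the word \<open>w\<close> at time \<open>n\<close> ends in a letter of type \<open>I\<close>, its cone was
  never visited before, and the walk stays strictly inside the cone afterwards. From then on the walk and the lamps that it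
  switches form, up to translation by \<open>w\<close>, a copy of the process started at the root and conditioned to remain
  in the branch of words beginning in \<open>J\<close>. Hence the blocks between consecutive regeneration times are
  independent and identically distributed (\<open>prob_first_block\<close>, \<open>emeasure_chain\<close>).

  A tour through the lit lamps has to pass through the words at all regeneration times, because they are gates
  of cones. Its minimal length is therefore a sum over the blocks, up to a constant and up to the time
  elapsed since the last regeneration (\<open>tour_decomposition\<close>). By the strong law of large numbers the limit exists and
  equals the mean tour length of a block divided by the mean duration of a block. It is positive
  since every block moves the walk to a new word.

  What remains is that regenerations occur and that the mean duration is finite. The assumption on the radius of
  convergence gives \<open>\<Sum>n. P(X\<^sub>n = o) < \<infinity>\<close>, so the walk has positive probability never to return to the root, and
  it then remains in one of the two branches (\<open>prob_branch_pos\<close>). Choose \<open>J\<close> such that the walk remains in the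
  branch of \<open>J\<close> with a positive probability, called \<open>escape\<close>. A positive fraction of all times is spent at words that end in \<open>I\<close>;
  each such time is the final departure from its word with probability \<open>escape\<close>; different final departures
  belong to different words, so there are at least as many first visits; and a first visit is a regeneration with
  probability \<open>escape\<close>. So the expected number of regenerations up to time \<open>n\<close> grows linearly
  (\<open>sum_prob_regen_ge\<close>). On the other hand the events that \<open>n\<close> is the last regeneration time before \<open>N\<close> are
  disjoint, which bounds the convolution of the regeneration probabilities with the tails of the
  duration. The two facts together make the tails summable (\<open>sum_length_tail_le\<close>), which yields the finite mean.
\<close>

section \<open>The strong law of large numbers\<close>

text \<open>
  A start \<open>i\<close> is good if some stretch of at most \<open>M\<close> terms beginning at \<open>i\<close> has average at least \<open>c\<close>.
  Walking from left to right and jumping over such a stretch whenever the present index is good, one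
  covers all good starts by disjoint stretches, and each stretch pays for the starts in it. The last
  stretch may protrude by \<open>M\<close>. This is the covering argument behind the maximal ergodic inequality.
\<close>

lemma card_blocks_above_average_le:
  fixes y :: "nat \<Rightarrow> real"
  assumes nonneg: "\<And>i. 0 \<le> y i" and c: "0 \<le> c"
  shows "c * real (card {i \<in> {k..<L}. \<exists>n\<in>{1..M}. c * real n \<le> (\<Sum>j<n. y (i + j))})
           \<le> (\<Sum>i\<in>{k..<L + M}. y i)"
proof (induction "L - k" arbitrary: k rule: less_induct)
  case less
  let ?E = "\<lambda>i. \<exists>n\<in>{1..M}. c * real n \<le> (\<Sum>j<n. y (i + j))"
  show ?case
  proof (cases "k < L")
    case False
    then have "{i \<in> {k..<L}. ?E i} = {}" by auto
    then show ?thesis using nonneg by (simp only: card.empty) (simp add: sum_nonneg)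
  next
    case kL: True
    show ?thesis
    proof (cases "?E k")
      case False
      have "{i \<in> {k..<L}. ?E i} = {i \<in> {Suc k..<L}. ?E i}"
        using False by (auto simp: le_less Suc_le_eq)
      then have "c * real (card {i \<in> {k..<L}. ?E i}) \<le> (\<Sum>i\<in>{Suc k..<L + M}. y i)"
        using less[of "Suc k"] kL by simp
      also have "\<dots> \<le> (\<Sum>i\<in>{k..<L + M}. y i)"
        using nonneg by (intro sum_mono2) auto
      finally show ?thesis .
    next
      case True
      then obtain n where n: "1 \<le> n" "n \<le> M" "c * real n \<le> (\<Sum>j<n. y (k + j))"
        by auto
      have "{i \<in> {k..<L}. ?E i} \<subseteq> {k..<k + n} \<union> {i \<in> {k + n..<L}. ?E i}"
        by auto
      then have "card {i \<in> {k..<L}. ?E i} \<le> card ({k..<k + n} \<union> {i \<in> {k + n..<L}. ?E i})"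
        by (intro card_mono) auto
      also have "\<dots> \<le> n + card {i \<in> {k + n..<L}. ?E i}"
        using card_Un_le[of "{k..<k+n}" "{i \<in> {k + n..<L}. ?E i}"] by simp
      finally have "c * real (card {i \<in> {k..<L}. ?E i})
          \<le> c * real n + c * real (card {i \<in> {k + n..<L}. ?E i})"
        using c by (simp flip: distrib_left of_nat_add add: mult_left_mono)
      also have "\<dots> \<le> (\<Sum>j<n. y (k + j)) + (\<Sum>i\<in>{k + n..<L + M}. y i)"
        using n less[of "k + n"] kL by (intro add_mono) auto
      also have "(\<Sum>j<n. y (k + j)) = (\<Sum>i\<in>{k..<k + n}. y i)"
        using sum.shift_bounds_nat_ivl[of y 0 k n] by (simp add: lessThan_atLeast0 add.commute)
      also have "\<dots> + (\<Sum>i\<in>{k + n..<L + M}. y i) = (\<Sum>i\<in>{k..<L + M}. y i)"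
        using n kL by (intro sum.atLeastLessThan_concat) auto
      finally show ?thesis .
    qed
  qed
qed

context prob_space
begin

text \<open>
  Hoeffding's inequality makes the deviation probabilities summable, so Borel-Cantelli applies.
\<close>

lemma strong_law_bounded:
  fixes Y :: "nat \<Rightarrow> 'a \<Rightarrow> real"
  assumes ind: "indep_vars (\<lambda>_. borel) Y UNIV"
    and ident: "\<And>k. distr M borel (Y k) = distr M borel (Y 0)"
    and bd: "\<And>k \<omega>. Y k \<omega> \<in> {0..B}"
  shows "AE \<omega> in M. (\<lambda>n. (\<Sum>k<n. Y k \<omega>) / real n) \<longlonglongrightarrow> expectation (Y 0)"
proof -
  have rv [measurable]: "random_variable borel (Y k)" for k
    using ind unfolding indep_vars_def by auto
  \<comment> \<open>Hoeffding needs a nondegenerate interval, also if \<open>B = 0\<close>.\<close>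
  define C where "C = B + 1"
  have C: "C > 0" "\<And>k \<omega>. Y k \<omega> \<in> {0..C}"
  proof -
    have "0 \<le> B"
      using bd[of 0 undefined] unfolding atLeastAtMost_iff by linarith
    then show "C > 0" by (simp add: C_def)
    show "Y k \<omega> \<in> {0..C}" for k \<omega>
      using bd[of k \<omega>] by (simp add: C_def)
  qed
  define \<mu> where "\<mu> = expectation (Y 0)"
  define A where "A e n = {\<omega> \<in> space M. e * real n \<le> \<bar>(\<Sum>k<n. Y k \<omega>) - real n * \<mu>\<bar>}"
    for e :: real and n
  have A_meas [measurable]: "A e n \<in> sets M" for e n
    unfolding A_def by measurable
  have "AE \<omega> in M. eventually (\<lambda>n. \<omega> \<in> space M - A e n) sequentially" if e: "e > 0" for e
  proof (rule borel_cantelli_AE1)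
    have bound: "prob (A e n) \<le> 2 * exp (- (2 * e\<^sup>2 / C\<^sup>2)) ^ n" if "n \<noteq> 0" for n
    proof -
      interpret H: Hoeffding_ineq_iid M "{..<n}" Y "Y 0" 0 C \<mu>
        using C \<open>n \<noteq> 0\<close> ident by unfold_locales
          (auto simp: \<mu>_def intro: indep_vars_subset[OF ind])
      have "prob (A e n) \<le> 2 * exp (- 2 * (e * real n)\<^sup>2 / (real (card {..<n}) * (C - 0)\<^sup>2))"
        using H.Hoeffding_ineq_abs_ge[of "e * real n"] e C \<open>n \<noteq> 0\<close>
        unfolding A_def by (simp add: lessThan_empty_iff)
      also have "- 2 * (e * real n)\<^sup>2 / (real (card {..<n}) * (C - 0)\<^sup>2)
          = real n * (- (2 * e\<^sup>2 / C\<^sup>2))"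
        using \<open>n \<noteq> 0\<close> C by (simp add: field_simps power2_eq_square)
      finally show ?thesis by (simp only: exp_of_nat_mult)
    qed
    show "summable (\<lambda>n. prob (A e n))"
    proof (rule summable_comparison_test')
      show "summable (\<lambda>n. 2 * exp (- (2 * e\<^sup>2 / C\<^sup>2)) ^ n)"
        using e C by (intro summable_mult summable_geometric) simp
      show "norm (prob (A e n)) \<le> 2 * exp (- (2 * e\<^sup>2 / C\<^sup>2)) ^ n" if "n \<ge> 1" for n
        using bound[of n] that by simp
    qed
  qed (simp_all add: A_meas less_top[symmetric])
  then have "AE \<omega> in M. \<forall>m. eventually (\<lambda>n. \<omega> \<in> space M - A (inverse (real (Suc m))) n) sequentially"
    by (subst AE_all_countable) auto
  then show ?thesis
  proof (rule AE_mp, intro AE_I2 impI)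
    fix \<omega> assume \<omega>: "\<omega> \<in> space M"
      and *: "\<forall>m. eventually (\<lambda>n. \<omega> \<in> space M - A (inverse (real (Suc m))) n) sequentially"
    show "(\<lambda>n. (\<Sum>k<n. Y k \<omega>) / real n) \<longlonglongrightarrow> expectation (Y 0)"
    proof (rule tendstoI)
      fix e :: real assume "e > 0"
      then obtain m where m: "inverse (real (Suc m)) < e"
        using reals_Archimedean by blast
      show "eventually (\<lambda>n. dist ((\<Sum>k<n. Y k \<omega>) / real n) (expectation (Y 0)) < e) sequentially"
        using *[rule_format, of m] eventually_gt_at_top[of 0]
      proof eventually_elim
        case (elim n)
        then have "\<bar>(\<Sum>k<n. Y k \<omega>) - real n * \<mu>\<bar> < inverse (real (Suc m)) * real n"
          using \<omega> by (auto simp: A_def)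
        then have "\<bar>(\<Sum>k<n. Y k \<omega>) - real n * \<mu>\<bar> / real n < inverse (real (Suc m))"
          using elim by (simp add: pos_divide_less_eq)
        also have "\<bar>(\<Sum>k<n. Y k \<omega>) - real n * \<mu>\<bar> / real n = \<bar>(\<Sum>k<n. Y k \<omega>) / real n - \<mu>\<bar>"
        proof -
          have "(\<Sum>k<n. Y k \<omega>) / real n - \<mu> = ((\<Sum>k<n. Y k \<omega>) - real n * \<mu>) / real n"
            using elim by (simp add: field_simps)
          then show ?thesis by simp
        qed
        finally show ?case
          using m by (simp add: dist_real_def \<mu>_def)
      qed
    qed
  qed
qed

text \<open>
  Apply the covering lemma to \<open>L + M\<close> terms of the sequence and take expectations: by stationarity each of
  the \<open>L\<close> starts is good with the same probability. Then let \<open>L\<close> and afterwards \<open>M\<close> tend to infinity.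
\<close>

lemma prob_average_exceeds_le:
  fixes Y :: "nat \<Rightarrow> 'a \<Rightarrow> real"
  assumes ind: "indep_vars (\<lambda>_. borel) Y UNIV"
    and ident: "\<And>k. distr M borel (Y k) = distr M borel (Y 0)"
    and nonneg: "\<And>k \<omega>. 0 \<le> Y k \<omega>"
    and int: "integrable M (Y 0)" and c: "0 < c"
  shows "c * \<P>(\<omega> in M. \<exists>n\<ge>1. c * real n \<le> (\<Sum>j<n. Y j \<omega>)) \<le> expectation (Y 0)"
proof -
  have rv [measurable]: "random_variable borel (Y k)" for k
    using ind unfolding indep_vars_def by auto
  have int': "integrable M (Y k)" and exp_eq: "expectation (Y k) = expectation (Y 0)" for k
  proof -
    have "integrable (distr M borel (Y k)) (\<lambda>x. x)" "integral\<^sup>L (distr M borel (Y k)) (\<lambda>x. x) = expectation (Y 0)"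
      using int unfolding ident[of k] by (simp_all add: integrable_distr_eq integral_distr)
    then show "integrable M (Y k)" "expectation (Y k) = expectation (Y 0)"
      by (simp_all add: integrable_distr_eq integral_distr)
  qed
  define E where "E M' k = {\<omega> \<in> space M. \<exists>n\<in>{1..M'}. c * real n \<le> (\<Sum>j<n. Y (k + j) \<omega>)}" for M' k :: nat
  have E_meas [measurable]: "E M' k \<in> sets M" for M' k
    unfolding E_def by measurable
  \<comment> \<open>The sequence is stationary, so a starting point \<open>k\<close> is as good as \<open>0\<close>.\<close>
  have stat: "prob (E M' k) = prob (E M' 0)" for M' k
  proof -
    have ind_k: "indep_vars (\<lambda>_. borel) (\<lambda>j. Y (k + j)) UNIV" for k
      unfolding indep_vars_def2
    proof (intro conjI ballI indep_setsI)
      fix A J assume J: "J \<noteq> {}" "finite J"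
        and A: "\<forall>j\<in>J. A j \<in> {Y (k + j) -` A \<inter> space M |A. A \<in> sets borel}"
      have "prob (\<Inter>i\<in>(+) k ` J. A (i - k)) = (\<Prod>i\<in>(+) k ` J. prob (A (i - k)))"
        using ind J A unfolding indep_vars_def2 by (intro indep_setsD[of _ UNIV]) auto
      then show "prob (\<Inter>j\<in>J. A j) = (\<Prod>j\<in>J. prob (A j))"
        by (simp add: prod.reindex)
    qed auto
    define N where "N = PiM UNIV (\<lambda>_::nat. borel :: real measure)"
    define P where "P = (\<Union>n\<in>{1..M'}. {f \<in> space N. c * real n \<le> (\<Sum>j<n. f j)})"
    have [measurable]: "(\<lambda>f. \<Sum>j<n. f j) \<in> borel_measurable N" for n :: nat
      unfolding N_def by (intro borel_measurable_sum measurable_component_singleton) auto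
    have "P \<in> sets N"
      unfolding P_def by (intro sets.finite_UN) (auto, measurable)
    then have P[measurable]: "P \<in> sets (PiM UNIV (\<lambda>_. borel))" by (simp add: N_def)
    have *: "prob (E M' k) = measure (PiM UNIV (\<lambda>_::nat. distr M borel (Y 0))) P" for k
    proof -
      have "prob (E M' k) = measure (distr M (PiM UNIV (\<lambda>_. borel)) (\<lambda>\<omega>. \<lambda>j\<in>UNIV. Y (k + j) \<omega>)) P"
      proof (subst measure_distr[OF _ P])
        show "(\<lambda>\<omega>. \<lambda>j\<in>UNIV. Y (k + j) \<omega>) \<in> measurable M (PiM UNIV (\<lambda>_. borel))"
          by measurable
        have "(\<lambda>\<omega>. \<lambda>j\<in>UNIV. Y (k + j) \<omega>) -` P \<inter> space M = E M' k"
          by (auto simp: P_def N_def E_def space_PiM Bex_def)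
        then show "prob (E M' k) = prob ((\<lambda>\<omega>. \<lambda>j\<in>UNIV. Y (k + j) \<omega>) -` P \<inter> space M)"
          by simp
      qed
      also have "distr M (PiM UNIV (\<lambda>_. borel)) (\<lambda>\<omega>. \<lambda>j\<in>UNIV. Y (k + j) \<omega>)
          = PiM UNIV (\<lambda>j. distr M borel (Y (k + j)))"
        using indep_vars_iff_distr_eq_PiM[of UNIV "\<lambda>j. Y (k + j)" "\<lambda>_. borel"] ind_k by simp
      also have "(\<lambda>j. distr M borel (Y (k + j))) = (\<lambda>_. distr M borel (Y 0))"
        by (rule ext) (rule ident)
      finally show ?thesis .
    qed
    show ?thesis using * by simp
  qed
  have fin: "c * prob (E M' 0) \<le> expectation (Y 0)" for M'
  proof -
    have "(real L + real M') * expectation (Y 0) \<ge> c * real L * prob (E M' 0)" for L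
    proof -
      have "c * real L * prob (E M' 0) = c * (\<Sum>k<L. prob (E M' k))"
        by (subst sum.cong[OF refl stat]) simp
      also have "\<dots> = expectation (\<lambda>\<omega>. c * (\<Sum>k<L. indicator (E M' k) \<omega>))"
        by (subst Bochner_Integration.integral_mult_right_zero, subst Bochner_Integration.integral_sum)
           (auto simp: less_top[symmetric])
      also have "\<dots> \<le> expectation (\<lambda>\<omega>. \<Sum>i<L + M'. Y i \<omega>)"
      proof (rule integral_mono)
        fix \<omega> assume "\<omega> \<in> space M"
        then have "(\<Sum>k<L. indicator (E M' k) \<omega> :: real)
           = real (card {i \<in> {0..<L}. \<exists>n\<in>{1..M'}. c * real n \<le> (\<Sum>j<n. Y (i + j) \<omega>)})"
          by (subst card_eq_sum) (auto simp: E_def indicator_def sum.If_cases lessThan_atLeast0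
               intro!: arg_cong[of _ _ card])
        then show "c * (\<Sum>k<L. indicator (E M' k) \<omega>) \<le> (\<Sum>i<L + M'. Y i \<omega>)"
          using card_blocks_above_average_le[of "\<lambda>i. Y i \<omega>" c 0 L M'] nonneg c
          by (simp add: lessThan_atLeast0)
      qed (auto intro!: Bochner_Integration.integrable_mult_right Bochner_Integration.integrable_sum int' simp: less_top[symmetric])
      also have "\<dots> = (real L + real M') * expectation (Y 0)"
        by (subst Bochner_Integration.integral_sum, rule int', subst sum.cong[OF refl exp_eq]) simp
      finally show ?thesis .
    qed
    then have "c * prob (E M' 0) \<le> (1 + real M' / real L) * expectation (Y 0)" if "L > 0" for L
      using that by (simp add: field_simps)
    moreover have "(\<lambda>L. (1 + real M' / real L) * expectation (Y 0)) \<longlonglongrightarrow> (1 + 0) * expectation (Y 0)"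
      by (intro tendsto_intros tendsto_divide_0[OF tendsto_const] filterlim_at_top_imp_at_infinity filterlim_real_sequentially)
    ultimately show ?thesis
      by (intro LIMSEQ_le_const[of _ "expectation (Y 0)"]) (auto intro!: exI[of _ 1])
  qed
  have "(\<lambda>m. prob (E m 0)) \<longlonglongrightarrow> prob (\<Union>m. E m 0)"
    by (intro finite_Lim_measure_incseq) (auto simp: incseq_def E_def)
  then have "c * prob (\<Union>m. E m 0) \<le> expectation (Y 0)"
    by (intro LIMSEQ_le_const2[OF tendsto_mult_left]) (auto intro: fin)
  also have "(\<Union>m. E m 0) = {\<omega> \<in> space M. \<exists>n\<ge>1. c * real n \<le> (\<Sum>j<n. Y j \<omega>)}"
    by (auto simp: E_def) (meson atLeastAtMost_iff order_refl)
  finally show ?thesis .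
qed

text \<open>
  Cut each variable at height \<open>m\<close>. The truncated parts obey the bounded law, and the averages of the
  remainders ever exceed \<open>e\<close> with probability at most \<open>\<rho> m / e\<close>, which vanishes as \<open>m\<close> grows
  because the mean is finite.
\<close>

theorem strong_law_nonneg:
  fixes Y :: "nat \<Rightarrow> 'a \<Rightarrow> real"
  assumes ind: "indep_vars (\<lambda>_. borel) Y UNIV"
    and ident: "\<And>k. distr M borel (Y k) = distr M borel (Y 0)"
    and nonneg: "\<And>k \<omega>. 0 \<le> Y k \<omega>"
    and int: "integrable M (Y 0)"
  shows "AE \<omega> in M. (\<lambda>n. (\<Sum>k<n. Y k \<omega>) / real n) \<longlonglongrightarrow> expectation (Y 0)"
proof -
  have rv [measurable]: "random_variable borel (Y k)" for k
    using ind unfolding indep_vars_def by auto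
  define \<mu> where "\<mu> = expectation (Y 0)"
  define T where "T m = (\<lambda>y::real. min y (real m))" for m :: nat
  define R where "R m = (\<lambda>y. y - T m y)" for m
  have [measurable]: "T m \<in> borel_measurable borel" "R m \<in> borel_measurable borel" for m
    unfolding T_def R_def by measurable
  have ident': "distr M borel (\<lambda>\<omega>. f (Y k \<omega>)) = distr M borel (\<lambda>\<omega>. f (Y 0 \<omega>))"
    if [measurable]: "f \<in> borel_measurable borel" for f :: "real \<Rightarrow> real" and k
    using ident[of k] distr_distr[of f borel borel "Y k" M] distr_distr[of f borel borel "Y 0" M]
    by (simp add: comp_def)
  have ind': "indep_vars (\<lambda>_. borel) (\<lambda>k \<omega>. f (Y k \<omega>)) UNIV"
    if [measurable]: "f \<in> borel_measurable borel" for f :: "real \<Rightarrow> real"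
    using indep_vars_compose2[OF ind, of "\<lambda>_. f" "\<lambda>_. borel"] that by simp
  have T_int: "integrable M (\<lambda>\<omega>. T m (Y 0 \<omega>))" and R_int: "integrable M (\<lambda>\<omega>. R m (Y 0 \<omega>))" for m
  proof -
    show *: "integrable M (\<lambda>\<omega>. T m (Y 0 \<omega>))"
      using nonneg by (intro integrable_const_bound[of _ "real m"]) (auto simp: T_def)
    show "integrable M (\<lambda>\<omega>. R m (Y 0 \<omega>))"
      unfolding R_def by (intro Bochner_Integration.integrable_diff int *)
  qed
  define \<tau> where "\<tau> m = expectation (\<lambda>\<omega>. T m (Y 0 \<omega>))" for m
  define \<rho> where "\<rho> m = expectation (\<lambda>\<omega>. R m (Y 0 \<omega>))" for m
  have \<mu>_split: "\<mu> = \<tau> m + \<rho> m" for m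
    using T_int[of m] int unfolding \<mu>_def \<tau>_def \<rho>_def R_def by simp
  have \<tau>_lim: "\<tau> \<longlonglongrightarrow> \<mu>"
    unfolding \<tau>_def \<mu>_def
  proof (rule integral_dominated_convergence[where w = "Y 0"])
    show "AE \<omega> in M. (\<lambda>m. T m (Y 0 \<omega>)) \<longlonglongrightarrow> Y 0 \<omega>"
    proof (rule AE_I2)
      fix \<omega>
      have "eventually (\<lambda>m. T m (Y 0 \<omega>) = Y 0 \<omega>) sequentially"
        using eventually_ge_at_top[of "nat \<lceil>Y 0 \<omega>\<rceil>"]
        by eventually_elim (auto simp: T_def min_def intro!: antisym; linarith)
      then show "(\<lambda>m. T m (Y 0 \<omega>)) \<longlonglongrightarrow> Y 0 \<omega>"
        by (rule tendsto_eventually)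
    qed
  qed (use nonneg int in \<open>auto simp: T_def\<close>)
  have \<rho>_lim: "\<rho> \<longlonglongrightarrow> 0"
  proof -
    have "\<rho> = (\<lambda>m. \<mu> - \<tau> m)" using \<mu>_split by (metis add_diff_cancel_left')
    then show ?thesis using tendsto_diff[OF tendsto_const[of \<mu>] \<tau>_lim] by simp
  qed
  define B where "B e m = {\<omega> \<in> space M. \<exists>n\<ge>1. e * real n \<le> (\<Sum>j<n. R m (Y j \<omega>))}" for e m
  have B_meas[measurable]: "B e m \<in> sets M" for e m
    unfolding B_def by measurable
  have B_le: "e * prob (B e m) \<le> \<rho> m" if "e > 0" for e m
    unfolding B_def \<rho>_def
  proof (rule prob_average_exceeds_le[where Y = "\<lambda>k \<omega>. R m (Y k \<omega>)"])
    show "indep_vars (\<lambda>_. borel) (\<lambda>k \<omega>. R m (Y k \<omega>)) UNIV"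
      by (rule ind') simp
    show "distr M borel (\<lambda>\<omega>. R m (Y k \<omega>)) = distr M borel (\<lambda>\<omega>. R m (Y 0 \<omega>))" for k
      by (rule ident') simp
  qed (use R_int that in \<open>simp_all add: R_def T_def\<close>)
  have null: "AE \<omega> in M. \<exists>m. \<tau> m > \<mu> - e \<and> \<omega> \<notin> B e m" if e: "e > 0" for e
  proof -
    define N where "N = {\<omega> \<in> space M. \<forall>m. \<tau> m > \<mu> - e \<longrightarrow> \<omega> \<in> B e m}"
    have N_meas[measurable]: "N \<in> sets M" unfolding N_def by measurable
    have "eventually (\<lambda>m. \<mu> - e < \<tau> m) sequentially"
      using order_tendstoD(1)[OF \<tau>_lim, of "\<mu> - e"] e by simp
    then have "eventually (\<lambda>m. prob N \<le> \<rho> m / e) sequentially"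
    proof eventually_elim
      case (elim m)
      then have "e * prob N \<le> e * prob (B e m)"
        using e by (intro mult_left_mono finite_measure_mono) (auto simp: N_def)
      also have "\<dots> \<le> \<rho> m" by (rule B_le[OF e])
      finally show ?case using e by (simp add: field_simps)
    qed
    then have "prob N \<le> 0"
      using tendsto_lowerbound[of "\<lambda>m. \<rho> m / e" 0 sequentially] tendsto_divide[OF \<rho>_lim tendsto_const[of e]] e by simp
    then have "AE \<omega> in M. \<omega> \<notin> N"
      by (intro AE_not_in) (auto simp: null_sets_def emeasure_eq_measure measure_le_0_iff)
    then show ?thesis
      by (rule AE_mp) (auto simp: N_def)
  qed
  have "AE \<omega> in M. \<forall>k. \<exists>m. \<tau> m > \<mu> - inverse (real (Suc k)) \<and> \<omega> \<notin> B (inverse (real (Suc k))) m"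
    using null by (subst AE_all_countable) auto
  moreover have "AE \<omega> in M. \<forall>m. (\<lambda>n. (\<Sum>k<n. T m (Y k \<omega>)) / real n) \<longlonglongrightarrow> \<tau> m"
    unfolding AE_all_countable
  proof
    fix m
    show "AE \<omega> in M. (\<lambda>n. (\<Sum>k<n. T m (Y k \<omega>)) / real n) \<longlonglongrightarrow> \<tau> m"
      unfolding \<tau>_def
    proof (rule strong_law_bounded[where Y = "\<lambda>k \<omega>. T m (Y k \<omega>)" and B = "real m"])
      show "indep_vars (\<lambda>_. borel) (\<lambda>k \<omega>. T m (Y k \<omega>)) UNIV"
        by (rule ind') simp
      show "distr M borel (\<lambda>\<omega>. T m (Y k \<omega>)) = distr M borel (\<lambda>\<omega>. T m (Y 0 \<omega>))" for k
        by (rule ident') simp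
      show "T m (Y k \<omega>) \<in> {0..real m}" for k \<omega>
        using nonneg[of k \<omega>] by (simp add: T_def)
    qed
  qed
  ultimately show ?thesis
    using AE_space
  proof eventually_elim
    case (elim \<omega>)
    show ?case
    proof (rule tendstoI)
      fix e :: real assume "e > 0"
      then obtain k where k: "inverse (real (Suc k)) < e / 2"
        using reals_Archimedean[of "e / 2"] by auto
      define d where "d = inverse (real (Suc k))"
      have d: "d > 0" "d < e / 2" using k by (auto simp: d_def)
      obtain m where m: "\<tau> m > \<mu> - d" "\<omega> \<notin> B d m"
        using elim(1) unfolding d_def by blast
      have "0 \<le> \<rho> m"
        unfolding \<rho>_def by (intro Bochner_Integration.integral_nonneg) (simp add: R_def T_def)
      then have "\<tau> m \<le> \<mu>" using \<mu>_split[of m] by simp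
      have "eventually (\<lambda>n. dist ((\<Sum>k<n. T m (Y k \<omega>)) / real n) (\<tau> m) < d) sequentially"
        using elim(2) d by (intro tendstoD) auto
      then show "eventually (\<lambda>n. dist ((\<Sum>k<n. Y k \<omega>) / real n) (expectation (Y 0)) < e) sequentially"
        using eventually_ge_at_top[of 1]
      proof eventually_elim
        case (elim n)
        have "(\<Sum>k<n. Y k \<omega>) / real n = (\<Sum>k<n. T m (Y k \<omega>)) / real n + (\<Sum>k<n. R m (Y k \<omega>)) / real n"
          by (simp add: R_def sum_subtractf diff_divide_distrib)
        moreover have "(\<Sum>k<n. R m (Y k \<omega>)) / real n < d"
          using m(2) elim(2) \<open>\<omega> \<in> space M\<close> by (auto simp: B_def pos_divide_less_eq)
        moreover have "0 \<le> (\<Sum>k<n. R m (Y k \<omega>)) / real n"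
          by (intro divide_nonneg_nonneg sum_nonneg) (auto simp: R_def T_def)
        ultimately show ?case
          using elim(1) m(1) \<open>\<tau> m \<le> \<mu>\<close> d
          unfolding dist_real_def \<mu>_def[symmetric] abs_less_iff by linarith
      qed
    qed
  qed
qed

end

section \<open>Walks on words and their cones\<close>

text \<open>
  The features of the free product that the geometric part uses. Words alternate between letters of
  type \<open>I\<close> and of type \<open>J\<close>, one step changes at most the last letter, and the subtree hanging off a word
  that ends in \<open>I\<close> is a copy of the subtree of words that begin in \<open>J\<close>. The types are kept as parameters since
  either of them may serve as the type of regeneration.
\<close>

locale cone_graph =
  fixes W :: "'a list set" and q :: "'a list \<Rightarrow> 'a list \<Rightarrow> real" and I J :: "'a set"
  assumes Nil_W: "[] \<in> W"
    and append_W_iff: "\<lbrakk>w \<in> W; w \<noteq> []; last w \<in> I; x \<noteq> []\<rbrakk> \<Longrightarrow> w @ x \<in> W \<longleftrightarrow> x \<in> W \<and> hd x \<in> J"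
    and prefix_W: "u @ v \<in> W \<Longrightarrow> u \<in> W"
    and letters_W: "x \<in> W \<Longrightarrow> set x \<subseteq> I \<union> J"
    and types_disjoint: "I \<inter> J = {}"
    and q_nonneg: "0 \<le> q x y"
    and edge: "0 < q x y \<Longrightarrow> x \<in> W \<and> y \<in> W \<and>
      (\<exists>u s t. x = u @ s \<and> y = u @ t \<and> length s \<le> 1 \<and> length t \<le> 1 \<and>
               (set s \<union> set t \<subseteq> I \<or> set s \<union> set t \<subseteq> J))"
    and q_translate: "\<lbrakk>w \<in> W; w \<noteq> []; last w \<in> I; x = [] \<or> x \<in> W \<and> hd x \<in> J; y = [] \<or> y \<in> W \<and> hd y \<in> J\<rbrakk>
      \<Longrightarrow> q (w @ x) (w @ y) = q x y"
begin

definition ends_I :: "'a list \<Rightarrow> bool" where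
  "ends_I w \<longleftrightarrow> w \<in> W \<and> w \<noteq> [] \<and> last w \<in> I"

definition starts_J :: "'a list set" where
  "starts_J = {x \<in> W. x \<noteq> [] \<and> hd x \<in> J}"

lemma Nil_notin_starts_J [simp]: "[] \<notin> starts_J"
  by (simp add: starts_J_def)

lemma append_in_W_iff: "ends_I w \<Longrightarrow> w @ x \<in> W \<longleftrightarrow> x = [] \<or> x \<in> starts_J"
  using append_W_iff[of w x] by (auto simp: ends_I_def starts_J_def)

lemma q_append: "ends_I w \<Longrightarrow> x = [] \<or> x \<in> starts_J \<Longrightarrow> y = [] \<or> y \<in> starts_J \<Longrightarrow> q (w @ x) (w @ y) = q x y"
  using q_translate[of w x y] by (auto simp: ends_I_def starts_J_def)

lemma ends_I_append_iff: "ends_I w \<Longrightarrow> x \<in> starts_J \<Longrightarrow> ends_I (w @ x) \<longleftrightarrow> ends_I x"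
  using append_in_W_iff[of w x] by (auto simp: ends_I_def starts_J_def)

text \<open>
  A step keeps a common prefix and changes at most one letter after it, so the cone of \<open>w\<close>, that is the
  set of words beginning with \<open>w\<close>, has the single gate \<open>w\<close>.
\<close>

lemma enter_cone:
  assumes "0 < q x y" "prefix w y" "\<not> prefix w x"
  shows "y = w"
proof -
  obtain u s t where *: "x = u @ s" "y = u @ t" "length t \<le> 1"
    using edge[OF assms(1)] by blast
  then have "t = [] \<or> (\<exists>b. t = [b])" by (cases t) auto
  then show ?thesis using assms(2,3) * by auto
qed

lemma exit_cone:
  assumes "0 < q x y" "prefix w x" "\<not> prefix w y"
  shows "x = w"
proof -
  obtain u s t where *: "x = u @ s" "y = u @ t" "length s \<le> 1"
    using edge[OF assms(1)] by blast
  then have "s = [] \<or> (\<exists>b. s = [b])" by (cases s) auto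
  then show ?thesis using assms(2,3) * by auto
qed

lemma enter_cone_path:
  assumes "\<And>k. a \<le> k \<Longrightarrow> k < b \<Longrightarrow> 0 < q (x k) (x (Suc k))"
    and "a \<le> b" "\<not> prefix w (x a)" "prefix w (x b)"
  shows "\<exists>k. a < k \<and> k \<le> b \<and> x k = w"
  using assms(2,1,3,4)
proof (induction b rule: dec_induct)
  case base then show ?case by simp
next
  case (step n)
  show ?case
  proof (cases "prefix w (x n)")
    case True
    then have "\<exists>k>a. k \<le> n \<and> x k = w"
      using step.prems by (intro step.IH) auto
    then show ?thesis using le_Suc_eq by blast
  next
    case False
    then have "x (Suc n) = w"
      using enter_cone[of "x n" "x (Suc n)" w] step by auto
    then show ?thesis using step.hyps by (intro exI[of _ "Suc n"]) auto
  qed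
qed

subsection \<open>Regeneration times\<close>

text \<open>
  With \<open>stays\<close> the walk moves strictly inside the cone of its present word for ever; with \<open>fresh\<close> it sees
  this cone for the first time since \<open>m\<close>. Both together make a regeneration: what happens in the cone was not
  influenced by the past, and the rest of the tree is never seen again.
\<close>

definition stays :: "(nat \<Rightarrow> 'a list) \<Rightarrow> nat \<Rightarrow> bool" where
  "stays x m \<longleftrightarrow> ends_I (x m) \<and> (\<forall>k>m. strict_prefix (x m) (x k))"

definition fresh :: "(nat \<Rightarrow> 'a list) \<Rightarrow> nat \<Rightarrow> nat \<Rightarrow> bool" where
  "fresh x m n \<longleftrightarrow> (\<forall>k. m \<le> k \<and> k < n \<longrightarrow> \<not> prefix (x n) (x k))"

definition regen :: "(nat \<Rightarrow> 'a list) \<Rightarrow> nat \<Rightarrow> nat \<Rightarrow> bool" where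
  "regen x m n \<longleftrightarrow> m < n \<and> fresh x m n \<and> stays x n"

text \<open>
  A block lists the words of a piece of the walk relative to its starting word, with the flags of the
  lamps. Its entry number \<open>k - 1\<close> belongs to time \<open>k\<close>; time \<open>0\<close> is the starting word itself.
\<close>

definition word_at :: "('a list \<times> bool) list \<Rightarrow> nat \<Rightarrow> 'a list" where
  "word_at b k = (if k = 0 then [] else fst (b ! (k - 1)))"

text \<open>
  Regeneration judged from the times up to \<open>l\<close> only. If the walk stays in the cone of its word at time \<open>l\<close>,
  this is the same as regeneration, so whether a piece of the walk is a block between consecutive
  regenerations can be read off the piece alone.
\<close>

definition pre_regen :: "(nat \<Rightarrow> 'a list) \<Rightarrow> nat \<Rightarrow> nat \<Rightarrow> nat \<Rightarrow> bool" where
  "pre_regen x m l n \<longleftrightarrow> ends_I (x n) \<and> fresh x m n \<and> (\<forall>k. n < k \<and> k \<le> l \<longrightarrow> strict_prefix (x n) (x k))"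

text \<open>
  A piece whose end is a regeneration but no earlier positive time is, provided that the walk stays at the end.
\<close>

definition irreducible_block :: "('a list \<times> bool) list \<Rightarrow> bool" where
  "irreducible_block b \<longleftrightarrow> b \<noteq> [] \<and> (\<forall>s\<in>set b. fst s \<in> starts_J) \<and> pre_regen (word_at b) 0 (length b) (length b) \<and>
     (\<forall>n. 0 < n \<and> n < length b \<longrightarrow> \<not> pre_regen (word_at b) 0 (length b) n)"

definition follow :: "(nat \<Rightarrow> 'a list) \<Rightarrow> (nat \<Rightarrow> bool) \<Rightarrow> nat \<Rightarrow> ('a list \<times> bool) list \<Rightarrow> bool" where
  "follow x e m b \<longleftrightarrow>
     (\<forall>k<length b. x (m + Suc k) = x m @ fst (b ! k) \<and> e (m + Suc k) = snd (b ! k))"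

definition first_block :: "(nat \<Rightarrow> 'a list) \<Rightarrow> (nat \<Rightarrow> bool) \<Rightarrow> nat \<Rightarrow> ('a list \<times> bool) list \<Rightarrow> bool" where
  "first_block x e m b \<longleftrightarrow> ends_I (x m) \<and> irreducible_block b \<and> follow x e m b \<and> stays x (m + length b)"

lemma word_at_0 [simp]: "word_at b 0 = []" by (simp add: word_at_def)
lemma word_at_Suc [simp]: "word_at b (Suc k) = fst (b ! k)" by (simp add: word_at_def)

lemma follow_word_at: "follow x e m b \<Longrightarrow> k \<le> length b \<Longrightarrow> x (m + k) = x m @ word_at b k"
  by (cases k) (auto simp: follow_def)

lemma word_at_in_starts_J: "irreducible_block b \<Longrightarrow> 0 < k \<Longrightarrow> k \<le> length b \<Longrightarrow> word_at b k \<in> starts_J"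
  by (cases k) (auto simp: irreducible_block_def)

lemma same_strict_prefix: "strict_prefix (w @ u) (w @ v) \<longleftrightarrow> strict_prefix u v"
  by (auto simp: strict_prefix_def)

lemma all_ge_shift: "(\<forall>k\<ge>m::nat. P k) \<longleftrightarrow> (\<forall>k. P (m + k))"
  by (metis le_add1 le_Suc_ex)

lemma pre_regen_shift:
  assumes "ends_I w" and x: "\<And>k. k \<le> l \<Longrightarrow> x (m + k) = w @ y k" and y: "\<And>k. 0 < k \<Longrightarrow> k \<le> l \<Longrightarrow> y k \<in> starts_J"
    and n: "0 < n" "n \<le> l"
  shows "pre_regen x m (m + l) (m + n) \<longleftrightarrow> pre_regen y 0 l n"
proof -
  have "ends_I (x (m + n)) \<longleftrightarrow> ends_I (y n)"
    using ends_I_append_iff[OF assms(1) y[OF n]] x n by simp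
  moreover have "fresh x m (m + n) \<longleftrightarrow> fresh y 0 n"
  proof -
    have "fresh x m (m + n) \<longleftrightarrow> (\<forall>k<n. \<not> prefix (x (m + n)) (x (m + k)))"
      unfolding fresh_def imp_conjL all_ge_shift[of m] by simp
    also have "\<dots> \<longleftrightarrow> fresh y 0 n" unfolding fresh_def using x n by auto
    finally show ?thesis .
  qed
  moreover have "(\<forall>k. m + n < k \<and> k \<le> m + l \<longrightarrow> strict_prefix (x (m + n)) (x k)) \<longleftrightarrow>
      (\<forall>k. n < k \<and> k \<le> l \<longrightarrow> strict_prefix (y n) (y k))"
  proof -
    have "(\<forall>k. m + n < k \<and> k \<le> m + l \<longrightarrow> strict_prefix (x (m + n)) (x k)) \<longleftrightarrow>
      (\<forall>k. n < k \<and> k \<le> l \<longrightarrow> strict_prefix (x (m + n)) (x (m + k)))"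
    proof -
      have "(\<forall>k. m + n < k \<and> k \<le> m + l \<longrightarrow> strict_prefix (x (m + n)) (x k))
        \<longleftrightarrow> (\<forall>k\<ge>m. m + n < k \<longrightarrow> k \<le> m + l \<longrightarrow> strict_prefix (x (m + n)) (x k))"
        by auto
      then show ?thesis unfolding all_ge_shift[of m] by auto
    qed
    also have "\<dots> \<longleftrightarrow> (\<forall>k. n < k \<and> k \<le> l \<longrightarrow> strict_prefix (y n) (y k))"
      using x n by (auto simp: same_strict_prefix)
    finally show ?thesis .
  qed
  ultimately show ?thesis unfolding pre_regen_def by blast
qed

lemma regen_iff_pre_regen:
  assumes "stays x l" "n \<le> l"
  shows "regen x m n \<longleftrightarrow> m < n \<and> pre_regen x m l n"
proof -
  have "(\<forall>k>n. strict_prefix (x n) (x k)) \<longleftrightarrow> (\<forall>k. n < k \<and> k \<le> l \<longrightarrow> strict_prefix (x n) (x k))"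
  proof (intro iffI allI impI)
    fix k assume *: "\<forall>k. n < k \<and> k \<le> l \<longrightarrow> strict_prefix (x n) (x k)" and k: "n < k"
    show "strict_prefix (x n) (x k)"
    proof (cases "k \<le> l")
      case False
      then have "strict_prefix (x l) (x k)" using assms by (auto simp: stays_def)
      moreover have "prefix (x n) (x l)" using *[rule_format, of l] assms(2) by (cases "n = l") (auto simp: strict_prefix_def)
      ultimately show ?thesis by (rule prefix_order.le_less_trans[rotated])
    qed (use * k in auto)
  qed auto
  then show ?thesis unfolding regen_def pre_regen_def stays_def by blast
qed

lemma first_block_imp_stays:
  assumes "first_block x e m b" shows "stays x m"
proof -
  have l: "stays x (m + length b)" "ends_I (x m)" and f: "follow x e m b" and v: "irreducible_block b"
    using assms by (auto simp: first_block_def)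
  have *: "strict_prefix (x m) (x (m + k))" if "0 < k" "k \<le> length b" for k
    using follow_word_at[OF f that(2)] word_at_in_starts_J[OF v that] by (auto simp: strict_prefix_def starts_J_def)
  have "strict_prefix (x m) (x k)" if "m < k" for k
  proof (cases "k \<le> m + length b")
    case True then show ?thesis using *[of "k - m"] that by auto
  next
    case False
    then have "strict_prefix (x (m + length b)) (x k)" using l by (auto simp: stays_def)
    moreover have "strict_prefix (x m) (x (m + length b))"
      using * v by (auto simp: irreducible_block_def)
    ultimately show ?thesis by (rule prefix_order.less_trans[rotated])
  qed
  then show ?thesis using l by (simp add: stays_def)
qed

lemma first_block_pre_regen:
  assumes "ends_I (x m)" "follow x e m b" "\<And>k. 0 < k \<Longrightarrow> k \<le> length b \<Longrightarrow> word_at b k \<in> starts_J" "0 < n" "n \<le> length b"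
  shows "pre_regen x m (m + length b) (m + n) \<longleftrightarrow> pre_regen (word_at b) 0 (length b) n"
  using assms follow_word_at by (intro pre_regen_shift) auto

lemma first_block_imp_regen:
  assumes "first_block x e m b"
  shows "regen x m (m + length b)" and "m < n \<Longrightarrow> n < m + length b \<Longrightarrow> \<not> regen x m n"
proof -
  have l: "stays x (m + length b)" "ends_I (x m)" and f: "follow x e m b" and v: "irreducible_block b"
    using assms by (auto simp: first_block_def)
  have len: "0 < length b" using v by (auto simp: irreducible_block_def)
  note * = first_block_pre_regen[OF l(2) f word_at_in_starts_J[OF v]]
  show "regen x m (m + length b)"
    using regen_iff_pre_regen[OF l(1) order_refl, of m] *[of "length b"] len v by (auto simp: irreducible_block_def)
  assume n: "m < n" "n < m + length b"
  then have "\<not> pre_regen (word_at b) 0 (length b) (n - m)" using v by (auto simp: irreducible_block_def)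
  then show "\<not> regen x m n"
    using regen_iff_pre_regen[OF l(1), of n m] *[of "n - m"] n by auto
qed

lemma first_block_unique:
  assumes "first_block x e m b" "first_block x e m b'" shows "b = b'"
proof -
  have "m < m + length b" "m < m + length b'"
    using assms by (auto simp: first_block_def irreducible_block_def)
  then have len: "length b = length b'"
    using first_block_imp_regen[OF assms(1)] first_block_imp_regen[OF assms(2)] by (metis nat_neq_iff add_left_cancel)
  have "follow x e m b" "follow x e m b'" using assms by (auto simp: first_block_def)
  then show ?thesis using len by (auto simp: follow_def intro!: nth_equalityI prod_eqI)
qed

text \<open>
  Cut the walk at the least regeneration time after \<open>m\<close>. Since the walk stays in the cone of \<open>x m\<close>, all
  words in between are extensions of \<open>x m\<close>.
\<close>

lemma ex_first_block:
  assumes W: "\<And>k. x k \<in> W" and m: "stays x m" and n: "regen x m n"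
  shows "\<exists>b. first_block x e m b \<and> m + length b \<le> n"
proof -
  define n0 where "n0 = (LEAST n. regen x m n)"
  have n0: "regen x m n0" "n0 \<le> n" and least: "\<And>k. k < n0 \<Longrightarrow> \<not> regen x m k"
    unfolding n0_def using n by (auto intro: LeastI Least_le dest: not_less_Least)
  have "m < n0" using n0 by (simp add: regen_def)
  define b where "b = map (\<lambda>k. (drop (length (x m)) (x (m + Suc k)), e (m + Suc k))) [0..<n0 - m]"
  have len: "length b = n0 - m" "m + length b = n0" using \<open>m < n0\<close> by (auto simp: b_def)
  have ends_I: "ends_I (x m)" using m by (simp add: stays_def)
  have x: "x k = x m @ drop (length (x m)) (x k) \<and> drop (length (x m)) (x k) \<in> starts_J" if "m < k" for k
  proof -
    have "strict_prefix (x m) (x k)" using m that by (simp add: stays_def)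
    then obtain z where z: "x k = x m @ z" "z \<noteq> []" by (auto simp: strict_prefix_def prefix_def)
    then show ?thesis using W[of k] append_in_W_iff[OF ends_I, of z] by auto
  qed
  have f: "follow x e m b"
    unfolding follow_def using x len by (auto simp: b_def)
  have starts_J: "\<forall>s\<in>set b. fst s \<in> starts_J" using x by (auto simp: b_def)
  then have word_at: "word_at b k \<in> starts_J" if "0 < k" "k \<le> length b" for k
    using that by (cases k) auto
  have st: "stays x n0" using n0 by (simp add: regen_def)
  note * = first_block_pre_regen[OF ends_I f word_at, unfolded len(2)]
  have "pre_regen (word_at b) 0 (length b) (length b)"
    using *[of "length b"] regen_iff_pre_regen[OF st order_refl, of m] n0 len \<open>m < n0\<close> by auto
  moreover have "\<not> pre_regen (word_at b) 0 (length b) k" if "0 < k" "k < length b" for k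
    using *[of k] that regen_iff_pre_regen[OF st, of "m + k" m] least[of "m + k"] len by auto
  ultimately have "irreducible_block b"
    unfolding irreducible_block_def using starts_J len \<open>m < n0\<close> by auto
  then have "first_block x e m b" using ends_I f st len by (simp add: first_block_def)
  then show ?thesis using len n0 by auto
qed

text \<open>
  After a regeneration at \<open>n\<close> the walk stays in a cone that was not visited in the time from \<open>m\<close> to \<open>n\<close>, so a later vertex is new
  since \<open>n\<close> if and only if it is new since \<open>m\<close>.
\<close>

lemma regen_trans_iff:
  assumes "regen x m n" "n < n'"
  shows "regen x m n' \<longleftrightarrow> regen x n n'"
proof -
  have "fresh x m n'" if f: "fresh x n n'" and n': "stays x n'"
    unfolding fresh_def
  proof (intro allI impI notI)
    fix k assume k: "m \<le> k \<and> k < n'" and p: "prefix (x n') (x k)"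
    show False
    proof (cases "n \<le> k")
      case True then show False using f k p by (auto simp: fresh_def)
    next
      case False
      have "prefix (x n) (x n')" using assms by (auto simp: regen_def stays_def strict_prefix_def)
      then have "prefix (x n) (x k)" using p by (rule prefix_order.trans)
      then show False using assms k False by (auto simp: regen_def fresh_def)
    qed
  qed
  moreover have "fresh x n n'" if "fresh x m n'"
    using that assms by (auto simp: fresh_def regen_def)
  ultimately show ?thesis using assms unfolding regen_def by auto
qed

end

context cone_graph begin

subsection \<open>Shortest tours\<close>

abbreviation walk :: "'a list list \<Rightarrow> bool" where
  "walk \<pi> \<equiv> is_path W q \<pi>"

text \<open>
  Lengths of the walks from \<open>a\<close> to \<open>c\<close> that visit \<open>U\<close> and keep to the cone of \<open>w\<close>. The cone of the
  empty word is everything.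
\<close>

definition tour_lengths :: "'a list \<Rightarrow> 'a list \<Rightarrow> 'a list \<Rightarrow> 'a list set \<Rightarrow> nat set" where
  "tour_lengths w a c U = {path_length \<pi> | \<pi>. walk \<pi> \<and> hd \<pi> = a \<and> last \<pi> = c \<and> U \<subseteq> set \<pi> \<and>
     (\<forall>v\<in>set \<pi>. prefix w v)}"

definition tour :: "'a list \<Rightarrow> 'a list \<Rightarrow> 'a list \<Rightarrow> 'a list set \<Rightarrow> nat" where
  "tour w a c U = Inf (tour_lengths w a c U)"

lemma walk_Cons: "walk (a # \<pi>) \<longleftrightarrow> a \<in> W \<and> (\<pi> = [] \<or> walk \<pi> \<and> 0 < q a (hd \<pi>))"
  by (cases \<pi>) (auto simp: is_path_def)

text \<open>
  Sort the edges of the walk into those inside the cone of \<open>w\<close> and the others. As the cone can be entered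
  and left only through \<open>w\<close>, each class forms a walk after its pieces are joined at \<open>w\<close>, and no edge is lost.
  The two cases for the starting point are what the induction over the walk needs.
\<close>

lemma split_walk:
  assumes "walk \<pi>" "prefix w (last \<pi>)"
  shows "\<exists>\<pi>1 \<pi>2. walk \<pi>1 \<and> walk \<pi>2 \<and>
    hd \<pi>1 = (if prefix w (hd \<pi>) then w else hd \<pi>) \<and> last \<pi>1 = w \<and>
    hd \<pi>2 = (if prefix w (hd \<pi>) then hd \<pi> else w) \<and> last \<pi>2 = last \<pi> \<and>
    {v \<in> set \<pi>. \<not> prefix w v} \<subseteq> set \<pi>1 \<and> set \<pi>1 \<subseteq> insert w (set \<pi>) \<and>
    {v \<in> set \<pi>. prefix w v} \<subseteq> set \<pi>2 \<and> set \<pi>2 \<subseteq> insert w (set \<pi>) \<and> (\<forall>v\<in>set \<pi>2. prefix w v) \<and>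
    path_length \<pi>1 + path_length \<pi>2 = path_length \<pi>"
  using assms
proof (induction \<pi>)
  case Nil then show ?case by (simp add: is_path_def)
next
  case (Cons a \<pi>)
  show ?case
  proof (cases "\<pi> = []")
    case True
    then have a: "a \<in> W" "prefix w a" using Cons.prems by (auto simp: walk_Cons)
    then have "w \<in> W" using prefix_W by (auto simp: prefix_def)
    then show ?thesis using a True
      by (intro exI[of _ "[w]"] exI[of _ "[a]"]) (auto simp: walk_Cons path_length_def)
  next
    case ne: False
    define b where "b = hd \<pi>"
    have \<pi>: "walk \<pi>" "prefix w (last \<pi>)" "0 < q a b" "a \<in> W"
      using Cons.prems ne by (auto simp: walk_Cons b_def)
    obtain \<pi>1 \<pi>2 where IH: "walk \<pi>1" "walk \<pi>2"
      "hd \<pi>1 = (if prefix w b then w else b)" "last \<pi>1 = w"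
      "hd \<pi>2 = (if prefix w b then b else w)" "last \<pi>2 = last \<pi>"
      "{v \<in> set \<pi>. \<not> prefix w v} \<subseteq> set \<pi>1" "set \<pi>1 \<subseteq> insert w (set \<pi>)"
      "{v \<in> set \<pi>. prefix w v} \<subseteq> set \<pi>2" "set \<pi>2 \<subseteq> insert w (set \<pi>)" "\<forall>v\<in>set \<pi>2. prefix w v"
      "path_length \<pi>1 + path_length \<pi>2 = path_length \<pi>"
      using Cons.IH[OF \<pi>(1,2)] unfolding b_def by blast
    have ne1: "\<pi>1 \<noteq> []" "\<pi>2 \<noteq> []" using IH(1,2) by (auto simp: is_path_def)
    have len: "path_length (c # \<rho>) = Suc (path_length \<rho>)" if "\<rho> \<noteq> []" for c and \<rho> :: "'a list list"
      using that by (cases \<rho>) (auto simp: path_length_def)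
    show ?thesis
    proof (cases "prefix w a \<and> prefix w b")
      case True
      then show ?thesis using IH ne ne1 \<pi>
        by (intro exI[of _ \<pi>1] exI[of _ "a # \<pi>2"]) (auto simp: walk_Cons len)
    next
      case False
      \<comment> \<open>An edge with an endpoint outside the cone belongs to the outer part; if it leaves the cone,
        it starts in \<open>w\<close>, and if it enters the cone, it ends in \<open>w\<close>.\<close>
      define a' where "a' = (if prefix w a then w else a)"
      have a': "a' = a" using exit_cone[OF \<pi>(3), of w] False by (auto simp: a'_def)
      have b': "\<not> prefix w a \<Longrightarrow> prefix w b \<Longrightarrow> b = w" using enter_cone[OF \<pi>(3), of w] by blast
      have h1: "hd \<pi>1 = b" using IH(3) b' False by auto
      have h2: "hd \<pi>2 = w" using IH(5) b' False by auto
      have aw: "prefix w a \<Longrightarrow> a = w" using a' by (auto simp: a'_def split: if_splits)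
      have "w \<in> set \<pi>2" using h2 ne1 hd_in_set by metis
      then show ?thesis using IH(1,2,4,6-12) ne ne1 \<pi> a' h1 h2 aw
        by (intro exI[of _ "a # \<pi>1"] exI[of _ \<pi>2]) (auto simp: walk_Cons len a'_def)
    qed
  qed
qed

lemma join_walks:
  assumes "walk \<pi>1" "walk \<pi>2" "last \<pi>1 = hd \<pi>2"
  shows "walk (\<pi>1 @ tl \<pi>2)" "hd (\<pi>1 @ tl \<pi>2) = hd \<pi>1" "last (\<pi>1 @ tl \<pi>2) = last \<pi>2"
    "set (\<pi>1 @ tl \<pi>2) = set \<pi>1 \<union> set \<pi>2"
    "path_length (\<pi>1 @ tl \<pi>2) = path_length \<pi>1 + path_length \<pi>2"
proof -
  obtain a \<rho> where \<pi>2: "\<pi>2 = a # \<rho>" using assms(2) by (cases \<pi>2) (auto simp: is_path_def)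
  have ne: "\<pi>1 \<noteq> []" using assms by (auto simp: is_path_def)
  have l: "last \<pi>1 = a" using assms \<pi>2 by simp
  then have "a \<in> set \<pi>1" using ne last_in_set by metis
  then show "set (\<pi>1 @ tl \<pi>2) = set \<pi>1 \<union> set \<pi>2" using \<pi>2 by auto
  show "walk (\<pi>1 @ tl \<pi>2)"
    using assms l ne \<pi>2 by (cases \<rho>) (auto simp: is_path_def successively_append_iff)
  show "hd (\<pi>1 @ tl \<pi>2) = hd \<pi>1" "last (\<pi>1 @ tl \<pi>2) = last \<pi>2"
    using ne l \<pi>2 by auto
  show "path_length (\<pi>1 @ tl \<pi>2) = path_length \<pi>1 + path_length \<pi>2"
    using ne \<pi>2 by (cases \<pi>1) (auto simp: path_length_def)
qed

text \<open>
  Splitting at the gate of the cone and joining there are inverse to each other as far as lengths are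
  concerned, so the shortest lengths add up.
\<close>

lemma tour_split:
  assumes "tour_lengths w0 a c U \<noteq> {}" and w: "prefix w0 w1" "\<not> prefix w1 a \<or> a = w1" "prefix w1 c"
  shows "tour w0 a c U = tour w0 a w1 {v\<in>U. \<not> prefix w1 v} + tour w1 w1 c {v\<in>U. prefix w1 v}"
    and "tour_lengths w0 a w1 {v\<in>U. \<not> prefix w1 v} \<noteq> {}"
proof -
  let ?A = "tour_lengths w0 a w1 {v\<in>U. \<not> prefix w1 v}" and ?B = "tour_lengths w1 w1 c {v\<in>U. prefix w1 v}"
  have down: "\<exists>i\<in>?A. \<exists>j\<in>?B. n = i + j" if n: "n \<in> tour_lengths w0 a c U" for n
  proof -
    obtain \<pi> where \<pi>: "walk \<pi>" "hd \<pi> = a" "last \<pi> = c" "U \<subseteq> set \<pi>" "\<forall>v\<in>set \<pi>. prefix w0 v" "n = path_length \<pi>"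
      using n by (auto simp: tour_lengths_def)
    obtain \<pi>1 \<pi>2 where s: "walk \<pi>1" "walk \<pi>2"
      "hd \<pi>1 = (if prefix w1 a then w1 else a)" "last \<pi>1 = w1"
      "hd \<pi>2 = (if prefix w1 a then a else w1)" "last \<pi>2 = last \<pi>"
      "{v \<in> set \<pi>. \<not> prefix w1 v} \<subseteq> set \<pi>1" "set \<pi>1 \<subseteq> insert w1 (set \<pi>)"
      "{v \<in> set \<pi>. prefix w1 v} \<subseteq> set \<pi>2" "\<forall>v\<in>set \<pi>2. prefix w1 v"
      "path_length \<pi>1 + path_length \<pi>2 = path_length \<pi>"
      using split_walk[OF \<pi>(1), of w1] \<pi>(2,3) w(3) by auto
    have "path_length \<pi>1 \<in> ?A"
      unfolding tour_lengths_def using s w \<pi> by (intro CollectI exI[of _ \<pi>1]) auto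
    moreover have "path_length \<pi>2 \<in> ?B"
      unfolding tour_lengths_def using s w \<pi> by (intro CollectI exI[of _ \<pi>2]) auto
    moreover have "n = path_length \<pi>1 + path_length \<pi>2" using s(11) \<pi>(6) by simp
    ultimately show ?thesis by blast
  qed
  have up: "i + j \<in> tour_lengths w0 a c U" if i: "i \<in> ?A" and j: "j \<in> ?B" for i j
  proof -
    obtain \<pi>1 \<pi>2 where s: "walk \<pi>1" "hd \<pi>1 = a" "last \<pi>1 = w1" "{v\<in>U. \<not> prefix w1 v} \<subseteq> set \<pi>1"
      "\<forall>v\<in>set \<pi>1. prefix w0 v" "i = path_length \<pi>1"
      "walk \<pi>2" "hd \<pi>2 = w1" "last \<pi>2 = c" "{v\<in>U. prefix w1 v} \<subseteq> set \<pi>2" "\<forall>v\<in>set \<pi>2. prefix w1 v" "j = path_length \<pi>2"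
      using i j unfolding tour_lengths_def by blast
    have eq: "last \<pi>1 = hd \<pi>2" using s by simp
    show ?thesis
      unfolding tour_lengths_def using s w(1) join_walks[OF s(1,7) eq]
      by (intro CollectI exI[of _ "\<pi>1 @ tl \<pi>2"]) (auto dest: prefix_order.trans)
  qed
  have ne: "?B \<noteq> {}" using down assms(1) by blast
  show neA: "?A \<noteq> {}" using down assms(1) by blast
  show "tour w0 a c U = tour w0 a w1 {v\<in>U. \<not> prefix w1 v} + tour w1 w1 c {v\<in>U. prefix w1 v}"
  proof (rule antisym)
    show "tour w0 a c U \<le> tour w0 a w1 {v\<in>U. \<not> prefix w1 v} + tour w1 w1 c {v\<in>U. prefix w1 v}"
      unfolding tour_def using Inf_nat_def1[OF ne] Inf_nat_def1[OF neA] up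
      by (intro cInf_lower) auto
    obtain i j where "i \<in> ?A" "j \<in> ?B" "tour w0 a c U = i + j"
      using down[OF Inf_nat_def1[OF assms(1)]] unfolding tour_def by blast
    then show "tour w0 a w1 {v\<in>U. \<not> prefix w1 v} + tour w1 w1 c {v\<in>U. prefix w1 v} \<le> tour w0 a c U"
      unfolding tour_def by (auto intro!: add_mono cInf_lower)
  qed
qed

lemma tour_pos:
  assumes "tour_lengths w a c U \<noteq> {}" "a \<noteq> c"
  shows "1 \<le> tour w a c U"
proof -
  obtain \<pi> where \<pi>: "walk \<pi>" "hd \<pi> = a" "last \<pi> = c" "tour w a c U = path_length \<pi>"
    using Inf_nat_def1[OF assms(1)] unfolding tour_def tour_lengths_def by blast
  then have "2 \<le> length \<pi>"
    using assms(2) by (cases \<pi>; cases "tl \<pi>") (auto simp: is_path_def)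
  then show ?thesis using \<pi>(4) by (simp add: path_length_def)
qed

lemma tour_ignore_start: "tour w a c (U - {a}) = tour w a c U"
proof -
  have "tour_lengths w a c (U - {a}) = tour_lengths w a c U"
    unfolding tour_lengths_def
    by (rule Collect_cong) (metis Diff_subset_conv hd_in_set insert_absorb is_path_def insert_is_Un)
  then show ?thesis by (simp add: tour_def)
qed

text \<open>
  Shortest tours in the cone of a word that ends in \<open>I\<close>, seen from that word; by translation invariance
  they do not depend on the word.
\<close>

definition rel_tour :: "'a list \<Rightarrow> 'a list set \<Rightarrow> nat" where
  "rel_tour c U = Inf {path_length \<pi> | \<pi>. walk \<pi> \<and> hd \<pi> = [] \<and> last \<pi> = c \<and> U \<subseteq> set \<pi> \<and>
     set \<pi> \<subseteq> insert [] starts_J}"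

lemma walk_translate:
  assumes "ends_I w" "set \<pi> \<subseteq> insert [] starts_J"
  shows "walk (map ((@) w) \<pi>) \<longleftrightarrow> walk \<pi>"
  using assms(2)
proof (induction \<pi>)
  case Nil then show ?case by (simp add: is_path_def)
next
  case (Cons a \<pi>)
  have "w @ a \<in> W" "a \<in> W" using append_in_W_iff[OF assms(1), of a] Cons.prems Nil_W by (auto simp: starts_J_def)
  moreover have "\<pi> \<noteq> [] \<Longrightarrow> q (w @ a) (w @ hd \<pi>) = q a (hd \<pi>)"
    using Cons.prems q_append[OF assms(1), of a "hd \<pi>"] by (cases \<pi>) auto
  ultimately show ?case using Cons by (cases \<pi>) (auto simp: walk_Cons)
qed

lemma tour_translate:
  assumes w: "ends_I w"
  shows "tour w w (w @ c) ((@) w ` U) = rel_tour c U"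
proof -
  have "tour_lengths w w (w @ c) ((@) w ` U) = {path_length \<pi> | \<pi>. walk \<pi> \<and> hd \<pi> = [] \<and> last \<pi> = c \<and> U \<subseteq> set \<pi> \<and>
     set \<pi> \<subseteq> insert [] starts_J}" (is "?L = ?R")
  proof (intro equalityI subsetI)
    fix n assume "n \<in> ?L"
    then obtain \<pi> where \<pi>: "walk \<pi>" "hd \<pi> = w" "last \<pi> = w @ c" "(@) w ` U \<subseteq> set \<pi>" "\<forall>v\<in>set \<pi>. prefix w v"
      "n = path_length \<pi>" by (auto simp: tour_lengths_def)
    define \<rho> where "\<rho> = map (drop (length w)) \<pi>"
    have \<pi>\<rho>: "\<pi> = map ((@) w) \<rho>" unfolding \<rho>_def map_map comp_def
      using \<pi>(5) by (intro map_idI[symmetric]) (auto simp: prefix_def)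
    have ne: "\<rho> \<noteq> []" using \<pi>(1) \<pi>\<rho> by (auto simp: is_path_def)
    have sub: "set \<rho> \<subseteq> insert [] starts_J"
    proof
      fix v assume "v \<in> set \<rho>"
      then have "w @ v \<in> W" using \<pi>(1) \<pi>\<rho> by (auto simp: is_path_def)
      then show "v \<in> insert [] starts_J" using append_in_W_iff[OF w] by auto
    qed
    have "walk \<rho>" using walk_translate[OF w sub] \<pi>(1) \<pi>\<rho> by simp
    moreover have "hd \<rho> = []" "last \<rho> = c" using \<pi>(2,3) ne unfolding \<pi>\<rho> by (auto simp: hd_map last_map)
    moreover have "U \<subseteq> set \<rho>" using \<pi>(4) unfolding \<pi>\<rho> by auto
    moreover have "n = path_length \<rho>" using \<pi>(6) \<pi>\<rho> by (simp add: path_length_def)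
    ultimately show "n \<in> ?R" using sub by blast
  next
    fix n assume "n \<in> ?R"
    then obtain \<rho> where \<rho>: "walk \<rho>" "hd \<rho> = []" "last \<rho> = c" "U \<subseteq> set \<rho>" "set \<rho> \<subseteq> insert [] starts_J"
      "n = path_length \<rho>" by blast
    have ne: "\<rho> \<noteq> []" using \<rho>(1) by (auto simp: is_path_def)
    then show "n \<in> ?L" unfolding tour_lengths_def using \<rho> walk_translate[OF w \<rho>(5)]
      by (intro CollectI exI[of _ "map ((@) w) \<rho>"]) (auto simp: hd_map last_map path_length_def)
  qed
  then show ?thesis by (simp add: tour_def rel_tour_def)
qed

subsection \<open>Lamps\<close>

text \<open>
  A lamp is on after \<open>n\<close> steps if it was switched an odd number of times. Time \<open>0\<close> is left out: the walk
  does not switch before its first step.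
\<close>

definition lit :: "(nat \<Rightarrow> 'a list) \<Rightarrow> (nat \<Rightarrow> bool) \<Rightarrow> nat \<Rightarrow> 'a list set" where
  "lit x e n = {v. odd (card {k \<in> {1..n}. x k = v \<and> e k})}"

text \<open>
  The contribution of a block to the length of the tour. Every tour visits the starting word,
  so its lamp is left out; the lamps in the cone of the final word are counted with later blocks.
\<close>

definition block_tour :: "('a list \<times> bool) list \<Rightarrow> nat" where
  "block_tour b = rel_tour (fst (last b))
     {u. u \<noteq> [] \<and> \<not> prefix (fst (last b)) u \<and> odd (card {k. k < length b \<and> b ! k = (u, True)})}"

lemma lit_visited: "v \<in> lit x e n \<Longrightarrow> \<exists>k\<in>{1..n}. x k = v"
proof (rule ccontr)
  assume v: "v \<in> lit x e n" and "\<not> (\<exists>k\<in>{1..n}. x k = v)"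
  then have "{k \<in> {1..n}. x k = v \<and> e k} = {}" by auto
  then show False using v unfolding lit_def mem_Collect_eq by (metis card.empty even_zero)
qed

lemma walk_trajectory:
  assumes "\<And>k. m \<le> k \<Longrightarrow> k < n \<Longrightarrow> 0 < q (x k) (x (Suc k))" "m \<le> n" "x m \<in> W"
  shows "walk (map x [m..<Suc n])"
  unfolding is_path_def
proof (intro conjI)
  have "x k \<in> W" if "m \<le> k" "k \<le> n" for k
  proof (cases "k = m")
    case False
    then show ?thesis using edge[OF assms(1)[of "k - 1"]] that by simp
  qed (use assms in simp)
  then show "set (map x [m..<Suc n]) \<subseteq> W" by auto
  show "successively (\<lambda>x y. 0 < q x y) (map x [m..<Suc n])"
    unfolding successively_conv_nth using assms by (auto simp: nth_append simp del: upt_Suc)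
qed (use assms in auto)

lemma first_block_end: "first_block x e m b \<Longrightarrow> x (m + length b) = x m @ fst (last b)"
  using follow_word_at[of x e m b "length b"] by (auto simp: first_block_def irreducible_block_def word_at_def last_conv_nth)

text \<open>
  At the regeneration times \<open>r k\<close> the words \<open>x (r k)\<close> are gates through which every tour has to pass,
  so \<open>tour_split\<close> can be applied at each of them. The lamps between two consecutive gates are switched only
  in the block between them, which makes this part of the tour a function of the block. Before the first
  gate there is a constant \<open>A\<close>, and after the last gate the trajectory itself is a tour, whence the error term.
\<close>

lemma tour_decomposition:
  assumes x0: "x 0 = []" and pos: "\<And>k. 0 < q (x k) (x (Suc k))"
    and regen: "\<And>k. regen x 0 (r k)" and first_block: "\<And>k. first_block x e (r k) (b k)" and r: "\<And>k. r (Suc k) = r k + length (b k)"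
  shows "\<exists>A. \<forall>K n. r K \<le> n \<longrightarrow>
    A + (\<Sum>k<K. block_tour (b k)) \<le> tour [] [] (x n) (lit x e n) \<and>
    tour [] [] (x n) (lit x e n) \<le> A + (\<Sum>k<K. block_tour (b k)) + (n - r K)"
    and "1 \<le> block_tour (b k)" and "block_tour (b k) \<le> length (b k)"
proof -
  have W: "x k \<in> W" for k using edge[OF pos[of k]] by blast
  define w where "w k = x (r k)" for k
  have st: "stays x (r k)" and fr: "fresh x 0 (r k)" and tIw: "ends_I (w k)" for k
    using regen by (auto simp: regen_def stays_def w_def)
  have out: "\<not> prefix (w k) (x j)" if "j < r k" for j k
    using fr[of k] that by (auto simp: fresh_def w_def)
  have ins: "prefix (w k) (x j)" if "r k \<le> j" for j k
    using st[of k] that by (cases "j = r k") (auto simp: stays_def w_def strict_prefix_def)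
  have ins_strict: "x j \<noteq> w k" if "r k < j" for j k
    using st[of k] that by (auto simp: stays_def w_def strict_prefix_def)
  have rmono: "r k \<le> r (Suc k)" for k by (simp add: r)
  define D where "D K n = tour (w K) (w K) (x n) {v \<in> lit x e n. prefix (w K) v}" for K n
  have ne: "n - r K \<in> tour_lengths (w K) (w K) (x n) {v \<in> lit x e n. prefix (w K) v}" if "r K \<le> n" for K n
  proof -
    have "{v \<in> lit x e n. prefix (w K) v} \<subseteq> set (map x [r K..<Suc n])"
    proof
      fix v assume v: "v \<in> {v \<in> lit x e n. prefix (w K) v}"
      then obtain k where k: "k \<in> {1..n}" "x k = v" using lit_visited by blast
      then have "r K \<le> k" using out[of k K] v by (cases "k < r K") auto
      then have "k \<in> {r K..<Suc n}" using k by simp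
      then show "v \<in> set (map x [r K..<Suc n])" using k(2) unfolding set_map set_upt by blast
    qed
    then show ?thesis unfolding tour_lengths_def using walk_trajectory[of "r K" n x] pos W that ins
      by (intro CollectI exI[of _ "map x [r K..<Suc n]"])
         (auto simp: path_length_def w_def hd_map simp del: upt_Suc, simp_all)
  qed
  have D_le: "D K n \<le> n - r K" if "r K \<le> n" for K n
    unfolding D_def tour_def by (rule cInf_lower[OF ne[OF that]]) simp
  \<comment> \<open>From time \<open>r K\<close> on, no lamp outside the cone of \<open>w K\<close> is switched.\<close>
  have lit_out: "{v \<in> lit x e n. \<not> prefix (w K) v} = {v \<in> lit x e (r K). \<not> prefix (w K) v}" if "r K \<le> n" for K n
  proof -
    have "{k \<in> {1..n}. x k = v \<and> e k} = {k \<in> {1..r K}. x k = v \<and> e k}" if v: "\<not> prefix (w K) v" for v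
      using v ins[of K] \<open>r K \<le> n\<close> by (auto simp: not_le[symmetric]) (meson nat_le_linear)
    then show ?thesis by (auto simp: lit_def)
  qed
  define A where "A = tour [] [] (w 0) {v \<in> lit x e (r 0). \<not> prefix (w 0) v}"
  have first: "tour [] [] (x n) (lit x e n) = A + D 0 n" if n: "r 0 \<le> n" for n
  proof -
    have "tour_lengths [] [] (x n) (lit x e n) \<noteq> {}"
    proof -
      have "lit x e n \<subseteq> x ` {0..<Suc n}" using lit_visited by fastforce
      then have "lit x e n \<subseteq> set (map x [0..<Suc n])" unfolding set_map set_upt .
      then have "path_length (map x [0..<Suc n]) \<in> tour_lengths [] [] (x n) (lit x e n)"
        unfolding tour_lengths_def using walk_trajectory[of 0 n x] pos W x0 Nil_W
        by (intro CollectI exI[of _ "map x [0..<Suc n]"]) (auto simp: hd_map simp del: upt_Suc, simp_all)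
      then show ?thesis by blast
    qed
    moreover have "w 0 \<noteq> []" using tIw by (auto simp: ends_I_def)
    ultimately show ?thesis
      using tour_split(1)[of "[]" "[]" "x n" "lit x e n" "w 0"] ins[OF n] lit_out[OF n] unfolding A_def D_def by simp
  qed
  \<comment> \<open>The lamps between the gates \<open>w K\<close> and \<open>w (Suc K)\<close> are switched during the block \<open>b K\<close> only.\<close>
  have blk: "tour (w K) (w K) (w (Suc K)) {v \<in> {v \<in> lit x e n. prefix (w K) v}. \<not> prefix (w (Suc K)) v} = block_tour (b K)"
    if n: "r (Suc K) \<le> n" for K n
  proof -
    define U where "U = {u. u \<noteq> [] \<and> \<not> prefix (fst (last (b K))) u \<and> odd (card {k. k < length (b K) \<and> b K ! k = (u, True)})}"
    have wS: "w (Suc K) = w K @ fst (last (b K))"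
      using first_block_end[OF first_block[of K]] by (simp add: w_def r)
    have flw: "x (r K + Suc k) = w K @ fst (b K ! k)" "e (r K + Suc k) = snd (b K ! k)" if "k < length (b K)" for k
      using first_block[of K] that by (auto simp: first_block_def follow_def w_def)
    have card: "card {k \<in> {1..n}. x k = w K @ u \<and> e k} = card {k. k < length (b K) \<and> b K ! k = (u, True)}"
      if u: "u \<noteq> []" "\<not> prefix (fst (last (b K))) u" for u
    proof (rule sym, rule bij_betw_same_card[of "\<lambda>k. r K + Suc k"], rule bij_betw_imageI)
      show "(\<lambda>k. r K + Suc k) ` {k. k < length (b K) \<and> b K ! k = (u, True)} = {k \<in> {1..n}. x k = w K @ u \<and> e k}"
      proof (intro equalityI subsetI)
        fix j assume "j \<in> (\<lambda>k. r K + Suc k) ` {k. k < length (b K) \<and> b K ! k = (u, True)}"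
        then show "j \<in> {k \<in> {1..n}. x k = w K @ u \<and> e k}" using flw n by (auto simp: r simp del: add_Suc_right)
      next
        fix j assume j: "j \<in> {k \<in> {1..n}. x k = w K @ u \<and> e k}"
        have "\<not> j < r K" using out[of j K] j by auto
        moreover have "j \<noteq> r K" using j u by (auto simp: w_def)
        moreover have "j < r (Suc K)"
        proof (rule ccontr)
          assume "\<not> j < r (Suc K)"
          then have "prefix (w K @ fst (last (b K))) (w K @ u)" using ins[of "Suc K" j] j wS by simp
          then show False using u(2) by simp
        qed
        ultimately have "\<exists>k<length (b K). j = r K + Suc k"
          by (intro exI[of _ "j - r K - 1"]) (auto simp: r)
        then show "j \<in> (\<lambda>k. r K + Suc k) ` {k. k < length (b K) \<and> b K ! k = (u, True)}"
          using j flw by (auto simp: prod_eq_iff simp del: add_Suc_right)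
      qed
    qed (auto simp: inj_on_def)
    have "{v \<in> {v \<in> lit x e n. prefix (w K) v}. \<not> prefix (w (Suc K)) v} - {w K} = (@) (w K) ` U"
    proof (intro equalityI subsetI)
      fix v assume v: "v \<in> {v \<in> {v \<in> lit x e n. prefix (w K) v}. \<not> prefix (w (Suc K)) v} - {w K}"
      then obtain u where u: "v = w K @ u" "u \<noteq> []" by (auto simp: prefix_def)
      then have "u \<in> U" unfolding U_def using v wS card[of u] by (auto simp: lit_def)
      then show "v \<in> (@) (w K) ` U" using u by auto
    next
      fix v assume "v \<in> (@) (w K) ` U"
      then show "v \<in> {v \<in> {v \<in> lit x e n. prefix (w K) v}. \<not> prefix (w (Suc K)) v} - {w K}"
        unfolding U_def using card wS by (auto simp: lit_def)
    qed
    then show ?thesis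
      using tour_translate[OF tIw[of K], of "fst (last (b K))" U]
        tour_ignore_start[of "w K" "w K" "w (Suc K)" "{v \<in> {v \<in> lit x e n. prefix (w K) v}. \<not> prefix (w (Suc K)) v}"]
      by (simp add: wS block_tour_def U_def)
  qed
  have step: "D K n = block_tour (b K) + D (Suc K) n" if n: "r (Suc K) \<le> n" for K n
  proof -
    have rK: "r K \<le> n" using n rmono[of K] by simp
    have len: "0 < length (b K)" using first_block[of K] by (auto simp: first_block_def irreducible_block_def)
    have "prefix (w K) (w (Suc K))" using ins[OF rmono[of K]] by (simp add: w_def)
    moreover have "\<not> prefix (w (Suc K)) (w K)" using out[of "r K" "Suc K"] len by (simp add: w_def r)
    ultimately have "D K n = tour (w K) (w K) (w (Suc K)) {v \<in> {v \<in> lit x e n. prefix (w K) v}. \<not> prefix (w (Suc K)) v}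
        + tour (w (Suc K)) (w (Suc K)) (x n) {v \<in> {v \<in> lit x e n. prefix (w K) v}. prefix (w (Suc K)) v}"
      unfolding D_def using ne[OF rK] ins[OF n] by (intro tour_split(1)) auto
    also have "{v \<in> {v \<in> lit x e n. prefix (w K) v}. prefix (w (Suc K)) v} = {v \<in> lit x e n. prefix (w (Suc K)) v}"
      using \<open>prefix (w K) (w (Suc K))\<close> by (auto dest: prefix_order.trans)
    finally show ?thesis using blk[OF n] by (simp add: D_def)
  qed
  have total: "tour [] [] (x n) (lit x e n) = A + (\<Sum>k<K. block_tour (b k)) + D K n" if "r K \<le> n" for K n
    using that
  proof (induction K)
    case 0 then show ?case using first by simp
  next
    case (Suc K)
    then show ?case using step[OF Suc.prems] rmono[of K] by simp
  qed
  show "\<exists>A. \<forall>K n. r K \<le> n \<longrightarrow>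
    A + (\<Sum>k<K. block_tour (b k)) \<le> tour [] [] (x n) (lit x e n) \<and>
    tour [] [] (x n) (lit x e n) \<le> A + (\<Sum>k<K. block_tour (b k)) + (n - r K)"
  proof (intro exI[of _ A] allI impI)
    fix K n assume n: "r K \<le> n"
    show "A + (\<Sum>k<K. block_tour (b k)) \<le> tour [] [] (x n) (lit x e n) \<and>
      tour [] [] (x n) (lit x e n) \<le> A + (\<Sum>k<K. block_tour (b k)) + (n - r K)"
      using total[OF n] D_le[OF n] by linarith
  qed
  show "block_tour (b k) \<le> length (b k)"
    using step[of k "r (Suc k)"] D_le[OF rmono, of k] by (simp add: r)
  have len: "0 < length (b k)" using first_block[of k] by (auto simp: first_block_def irreducible_block_def)
  have "1 \<le> tour (w k) (w k) (w (Suc k)) {v \<in> {v \<in> lit x e (r (Suc k)). prefix (w k) v}. \<not> prefix (w (Suc k)) v}"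
  proof (intro tour_pos tour_split(2)[where c = "x (r (Suc k))"])
    show "prefix (w k) (w (Suc k))" using ins[OF rmono[of k]] by (simp add: w_def)
    show "\<not> prefix (w (Suc k)) (w k) \<or> w k = w (Suc k)" using out[of "r k" "Suc k"] len by (simp add: w_def r)
    show "w k \<noteq> w (Suc k)" using ins_strict[of k "r (Suc k)"] len by (auto simp: w_def r)
  qed (use ne[OF rmono, of k] ins[of "Suc k" "r (Suc k)"] in auto)
  then show "1 \<le> block_tour (b k)" using blk[OF order_refl, of k] by simp
qed

end

section \<open>The random walk with its lamp flips\<close>

text \<open>
  The walk on the words together with the flags \<open>E\<close>, which tell whether the lamp at the new position is
  switched. Flags and words form a Markov chain whose law at a step depends on the present word only, and the
  law of the flags does not depend on the position; hence the pair is invariant under translation of words.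
  The number \<open>a\<close> is the probability to append a letter of type \<open>I\<close> to a word that does not end in \<open>I\<close>.
\<close>

locale flagged_walk = cone_graph W q I J + prob_space M
  for W :: "'a list set" and q I J and M :: "'w measure" +
  fixes X :: "nat \<Rightarrow> 'w \<Rightarrow> 'a list" and E :: "nat \<Rightarrow> 'w \<Rightarrow> bool" and \<beta> a :: real
  assumes W_countable: "countable W"
    and X_measurable [measurable]: "X n \<in> measurable M (count_space UNIV)"
    and E_measurable [measurable]: "E n \<in> measurable M (count_space UNIV)"
    and X_in_W: "\<omega> \<in> space M \<Longrightarrow> X n \<omega> \<in> W"
    and X_0: "AE \<omega> in M. X 0 \<omega> = []"
    and \<beta>: "0 \<le> \<beta>" "\<beta> \<le> 1"
    and trajectory_step:
      "\<P>(\<omega> in M. (\<forall>k\<le>n. (X k \<omega>, E k \<omega>) = s k) \<and> (X (Suc n) \<omega>, E (Suc n) \<omega>) = (y, f))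
       = \<P>(\<omega> in M. \<forall>k\<le>n. (X k \<omega>, E k \<omega>) = s k) * (q (fst (s n)) y * (if f then \<beta> else 1 - \<beta>))"
    and a: "0 < a" "a \<le> 1"
    and I_step: "x \<in> W \<Longrightarrow> x = [] \<or> last x \<notin> I \<Longrightarrow> ((\<lambda>v. q x (x @ [v])) has_sum a) I"
begin

definition step_weight :: "'a list \<Rightarrow> 'a list \<times> bool \<Rightarrow> real" where
  "step_weight x s = q x (fst s) * (if snd s then \<beta> else 1 - \<beta>)"

lemma step_weight_nonneg: "0 \<le> step_weight x s"
  using q_nonneg \<beta> by (simp add: step_weight_def)

definition traj :: "nat \<Rightarrow> 'w \<Rightarrow> ('a list \<times> bool) list" where
  "traj n \<omega> = map (\<lambda>k. (X k \<omega>, E k \<omega>)) [0..<Suc n]"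

text \<open>
  The words range over a countable set even if the alphabet type is uncountable; finite trajectories
  therefore take countably many values, and every event that they determine is measurable.
\<close>

definition states :: "('a list \<times> bool) list set" where
  "states = lists (W \<times> UNIV)"

lemma states_countable [simp]: "countable states"
  unfolding states_def by (intro countable_lists countable_SIGMA W_countable) auto

lemma traj_in_states: "\<omega> \<in> space M \<Longrightarrow> traj n \<omega> \<in> states"
  using X_in_W by (auto simp: traj_def states_def)

lemma length_traj [simp]: "length (traj n \<omega>) = Suc n"
  by (simp add: traj_def)

lemma nth_traj: "k \<le> n \<Longrightarrow> traj n \<omega> ! k = (X k \<omega>, E k \<omega>)"
  unfolding traj_def by (subst nth_map) (auto simp del: upt_Suc)

lemma traj_eq_iff: "length l = Suc n \<Longrightarrow> traj n \<omega> = l \<longleftrightarrow> (\<forall>k\<le>n. (X k \<omega>, E k \<omega>) = l ! k)"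
  by (auto simp: list_eq_iff_nth_eq nth_traj less_Suc_eq_le)

lemma last_traj: "last (traj n \<omega>) = (X n \<omega>, E n \<omega>)"
  by (simp add: traj_def)

lemma traj_measurable [measurable]: "traj n \<in> measurable M (count_space UNIV)"
proof -
  have "traj n \<in> measurable M (count_space states)"
    unfolding measurable_count_space_eq_countable[OF states_countable]
  proof (intro conjI ballI)
    show "traj n \<in> space M \<rightarrow> states" using traj_in_states by auto
    fix l :: "('a list \<times> bool) list"
    have "traj n -` {l} \<inter> space M
      = (if length l = Suc n then {\<omega> \<in> space M. \<forall>k\<le>n. X k \<omega> = fst (l ! k) \<and> E k \<omega> = snd (l ! k)} else {})"
    proof (cases "length l = Suc n")
      case True
      then show ?thesis by (simp add: vimage_def Int_def traj_eq_iff[OF True] prod_eq_iff conj_commute)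
    qed auto
    also have "\<dots> \<in> sets M" by (auto; measurable)
    finally show "traj n -` {l} \<inter> space M \<in> sets M" .
  qed
  then show ?thesis by (rule measurable_compose) simp
qed

lemma pred_traj [measurable]: "Measurable.pred M (\<lambda>\<omega>. h (traj n \<omega>))"
  by (rule measurable_compose[OF traj_measurable]) simp

lemma pred_pair [measurable]: "Measurable.pred M (\<lambda>\<omega>. R (X m \<omega>) (X n \<omega>))"
proof -
  have "Measurable.pred M (\<lambda>\<omega>. R (fst (traj (max m n) \<omega> ! m)) (fst (traj (max m n) \<omega> ! n)))"
    by (rule pred_traj)
  then show ?thesis by (simp add: nth_traj)
qed

lemma traj_Suc_eq: "traj (Suc n) \<omega> = traj n \<omega> @ [(X (Suc n) \<omega>, E (Suc n) \<omega>)]"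
  by (simp add: traj_def)

lemma traj_add: "traj (n + t) \<omega> = traj n \<omega> @ map (\<lambda>k. (X (n + Suc k) \<omega>, E (n + Suc k) \<omega>)) [0..<t]"
  by (induction t) (auto simp: traj_Suc_eq)

lemma prob_traj_snoc:
  assumes "length l = Suc n"
  shows "\<P>(\<omega> in M. traj (Suc n) \<omega> = l @ [s]) = \<P>(\<omega> in M. traj n \<omega> = l) * step_weight (fst (last l)) s"
proof -
  have "last l = l ! n" using assms by (cases l rule: rev_cases) auto
  then show ?thesis
    using trajectory_step[of n "\<lambda>k. l ! k" "fst s" "snd s"]
    unfolding step_weight_def traj_Suc_eq using assms by (simp add: traj_eq_iff)
qed

primrec path_weight :: "'a list \<Rightarrow> ('a list \<times> bool) list \<Rightarrow> real" where
  "path_weight x [] = 1"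
| "path_weight x (s # b) = step_weight x s * path_weight (fst s) b"

lemma path_weight_nonneg: "0 \<le> path_weight x b"
  by (induction b arbitrary: x) (auto simp: step_weight_nonneg)

lemma prob_traj_append:
  assumes "length l = Suc n"
  shows "\<P>(\<omega> in M. traj (n + length b) \<omega> = l @ b)
    = \<P>(\<omega> in M. traj n \<omega> = l) * path_weight (fst (last l)) b"
  using assms
proof (induction b arbitrary: l n)
  case Nil then show ?case by simp
next
  case (Cons s b)
  have "\<P>(\<omega> in M. traj (Suc n + length b) \<omega> = (l @ [s]) @ b)
      = \<P>(\<omega> in M. traj (Suc n) \<omega> = l @ [s]) * path_weight (fst (last (l @ [s]))) b"
    using Cons.prems by (intro Cons.IH) simp
  then show ?case using prob_traj_snoc[OF Cons.prems, of s] by simp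
qed

lemma emeasure_by_traj:
  assumes [measurable]: "Measurable.pred M F"
  shows "emeasure M {\<omega> \<in> space M. h (traj n \<omega>) \<and> F \<omega>}
    = (\<integral>\<^sup>+ l. emeasure M {\<omega> \<in> space M. traj n \<omega> = l \<and> F \<omega>} \<partial>count_space {l \<in> states. h l \<and> length l = Suc n})"
proof -
  let ?S = "{l \<in> states. h l \<and> length l = Suc n}"
  have "{\<omega> \<in> space M. h (traj n \<omega>) \<and> F \<omega>} = (\<Union>l\<in>?S. {\<omega> \<in> space M. traj n \<omega> = l \<and> F \<omega>})"
    using traj_in_states by auto
  also have "emeasure M \<dots> = (\<integral>\<^sup>+ l. emeasure M {\<omega> \<in> space M. traj n \<omega> = l \<and> F \<omega>} \<partial>count_space ?S)"
    by (rule emeasure_UN_countable)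
       (auto simp: disjoint_family_on_def intro: countable_subset[OF _ states_countable])
  finally show ?thesis .
qed

text \<open>
  The Markov property in the form used below: a formula for the conditional probability of \<open>F\<close> that
  holds for every single trajectory up to time \<open>n\<close> holds for every event \<open>h\<close> of the past.
\<close>

lemma prob_by_traj:
  assumes [measurable]: "Measurable.pred M F" and c: "0 \<le> c"
    and eq: "\<And>l. length l = Suc n \<Longrightarrow> h l \<Longrightarrow> l \<in> states \<Longrightarrow>
      \<P>(\<omega> in M. traj n \<omega> = l \<and> F \<omega>) = \<P>(\<omega> in M. traj n \<omega> = l) * c"
  shows "\<P>(\<omega> in M. h (traj n \<omega>) \<and> F \<omega>) = \<P>(\<omega> in M. h (traj n \<omega>)) * c"
proof -
  let ?S = "{l \<in> states. h l \<and> length l = Suc n}"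
  have "emeasure M {\<omega> \<in> space M. h (traj n \<omega>) \<and> F \<omega>}
    = (\<integral>\<^sup>+ l. emeasure M {\<omega> \<in> space M. traj n \<omega> = l \<and> True} * ennreal c \<partial>count_space ?S)"
    unfolding emeasure_by_traj[OF assms(1)]
    by (intro nn_integral_cong) (simp add: emeasure_eq_measure eq c flip: ennreal_mult)
  also have "\<dots> = emeasure M {\<omega> \<in> space M. h (traj n \<omega>) \<and> True} * ennreal c"
    by (subst emeasure_by_traj) (auto intro: nn_integral_multc)
  finally show ?thesis
    by (simp add: emeasure_eq_measure c flip: ennreal_mult)
qed

lemma prob_by_traj_ge:
  assumes [measurable]: "Measurable.pred M F" and c: "0 \<le> c"
    and ge: "\<And>l. length l = Suc n \<Longrightarrow> h l \<Longrightarrow> l \<in> states \<Longrightarrow>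
      \<P>(\<omega> in M. traj n \<omega> = l) * c \<le> \<P>(\<omega> in M. traj n \<omega> = l \<and> F \<omega>)"
  shows "\<P>(\<omega> in M. h (traj n \<omega>)) * c \<le> \<P>(\<omega> in M. h (traj n \<omega>) \<and> F \<omega>)"
proof -
  let ?S = "{l \<in> states. h l \<and> length l = Suc n}"
  have "emeasure M {\<omega> \<in> space M. h (traj n \<omega>) \<and> True} * ennreal c
    = (\<integral>\<^sup>+ l. emeasure M {\<omega> \<in> space M. traj n \<omega> = l \<and> True} * ennreal c \<partial>count_space ?S)"
    by (subst emeasure_by_traj) (auto intro: nn_integral_multc[symmetric])
  also have "\<dots> \<le> (\<integral>\<^sup>+ l. emeasure M {\<omega> \<in> space M. traj n \<omega> = l \<and> F \<omega>} \<partial>count_space ?S)"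
    by (intro nn_integral_mono) (simp add: emeasure_eq_measure ge c flip: ennreal_mult)
  also have "\<dots> = emeasure M {\<omega> \<in> space M. h (traj n \<omega>) \<and> F \<omega>}"
    by (rule emeasure_by_traj[symmetric]) simp
  finally show ?thesis
    by (simp add: emeasure_eq_measure c flip: ennreal_mult)
qed

subsection \<open>The future relative to the present word\<close>

abbreviation xs :: "'w \<Rightarrow> nat \<Rightarrow> 'a list" where "xs \<omega> \<equiv> (\<lambda>k. X k \<omega>)"
abbreviation es :: "'w \<Rightarrow> nat \<Rightarrow> bool" where "es \<omega> \<equiv> (\<lambda>k. E k \<omega>)"

text \<open>
  Walks in \<open>A\<close> started at the root have the same weight after translation by \<open>w\<close>. There are two uses: \<open>A\<close> is the
  set of all nonempty words and \<open>w\<close> is the root, or \<open>A\<close> consists of the words that begin in \<open>J\<close> and \<open>w\<close> ends in \<open>I\<close>.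
\<close>

definition translates :: "'a list set \<Rightarrow> 'a list \<Rightarrow> bool" where
  "translates A w \<longleftrightarrow> w \<in> W \<and> (\<forall>x\<in>insert [] A. \<forall>y\<in>insert [] A. q (w @ x) (w @ y) = q x y)"

lemma translates_Nil: "translates A []"
  using Nil_W by (simp add: translates_def)

lemma translates_starts_J: "ends_I w \<Longrightarrow> translates starts_J w"
  using q_append[of w] by (auto simp: translates_def ends_I_def)

lemma path_weight_translate:
  assumes "translates A w" "fst ` set b \<subseteq> A" "x \<in> insert [] A"
  shows "path_weight (w @ x) (map (apfst ((@) w)) b) = path_weight x b"
  using assms(2,3)
proof (induction b arbitrary: x)
  case (Cons s b)
  have "step_weight (w @ x) (apfst ((@) w) s) = step_weight x s"
    using assms(1) Cons.prems by (auto simp: step_weight_def translates_def)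
  then show ?case using Cons by auto
qed simp

lemma follow_iff_traj:
  assumes "length l = Suc n"
  shows "traj n \<omega> = l \<and> follow (xs \<omega>) (es \<omega>) n b
    \<longleftrightarrow> traj (n + length b) \<omega> = l @ map (apfst ((@) (fst (last l)))) b"
proof -
  have "traj (n + length b) \<omega> = l @ map (apfst ((@) (fst (last l)))) b \<longleftrightarrow> traj n \<omega> = l \<and>
    map (\<lambda>k. (X (n + Suc k) \<omega>, E (n + Suc k) \<omega>)) [0..<length b] = map (apfst ((@) (fst (last l)))) b"
    using assms by (simp add: traj_add)
  also have "\<dots> \<longleftrightarrow> traj n \<omega> = l \<and> follow (xs \<omega>) (es \<omega>) n b"
  proof (rule conj_cong[OF refl])
    assume "traj n \<omega> = l"
    then have "fst (last l) = X n \<omega>" using last_traj[of n \<omega>] by simp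
    then show "map (\<lambda>k. (X (n + Suc k) \<omega>, E (n + Suc k) \<omega>)) [0..<length b] = map (apfst ((@) (fst (last l)))) b
      \<longleftrightarrow> follow (xs \<omega>) (es \<omega>) n b"
      by (subst list_eq_iff_nth_eq) (simp add: follow_def prod_eq_iff del: add_Suc_right)
  qed
  finally show ?thesis by simp
qed

lemma pred_follow [measurable]: "Measurable.pred M (\<lambda>\<omega>. follow (xs \<omega>) (es \<omega>) n b)"
  unfolding follow_def by measurable

lemma prob_follow:
  assumes G: "\<And>w. G w \<Longrightarrow> translates A w" and b: "fst ` set b \<subseteq> A"
  shows "\<P>(\<omega> in M. (h (traj n \<omega>) \<and> G (X n \<omega>)) \<and> follow (xs \<omega>) (es \<omega>) n b)
    = \<P>(\<omega> in M. h (traj n \<omega>) \<and> G (X n \<omega>)) * path_weight [] b"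
proof -
  have "\<P>(\<omega> in M. (h (traj n \<omega>) \<and> G (fst (last (traj n \<omega>)))) \<and> follow (xs \<omega>) (es \<omega>) n b)
    = \<P>(\<omega> in M. h (traj n \<omega>) \<and> G (fst (last (traj n \<omega>)))) * path_weight [] b"
  proof (rule prob_by_traj[OF pred_follow path_weight_nonneg])
    fix l assume l: "length l = Suc n" "h l \<and> G (fst (last l))" "l \<in> states"
    have "\<P>(\<omega> in M. traj n \<omega> = l \<and> follow (xs \<omega>) (es \<omega>) n b)
      = \<P>(\<omega> in M. traj n \<omega> = l) * path_weight (fst (last l) @ []) (map (apfst ((@) (fst (last l)))) b)"
      unfolding follow_iff_traj[OF l(1)]
      using prob_traj_append[OF l(1), of "map (apfst ((@) (fst (last l)))) b"] by simp
    then show "\<P>(\<omega> in M. traj n \<omega> = l \<and> follow (xs \<omega>) (es \<omega>) n b)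
      = \<P>(\<omega> in M. traj n \<omega> = l) * path_weight [] b"
      using path_weight_translate[OF G b, of "fst (last l)" "[]"] l by simp
  qed
  then show ?thesis by (simp add: last_traj)
qed

definition rel_stay :: "'a list set \<Rightarrow> nat \<Rightarrow> nat \<Rightarrow> 'w \<Rightarrow> bool" where
  "rel_stay A n t \<omega> \<longleftrightarrow> (\<forall>k\<in>{1..t}. \<exists>u\<in>A. X (n + k) \<omega> = X n \<omega> @ u)"

lemma pred_rel_stay [measurable]: "Measurable.pred M (rel_stay A n t)"
  unfolding rel_stay_def by measurable

lemma rel_stay_iff_follow:
  "rel_stay A n t \<omega> \<longleftrightarrow> (\<exists>b. length b = t \<and> fst ` set b \<subseteq> A \<and> follow (xs \<omega>) (es \<omega>) n b)"
proof
  assume "rel_stay A n t \<omega>"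
  then have "\<exists>u. k < t \<longrightarrow> u \<in> A \<and> X (n + Suc k) \<omega> = X n \<omega> @ u" for k
    unfolding rel_stay_def Bex_def by (cases "k < t") (auto dest!: bspec[of _ _ "Suc k"])
  then obtain u where u: "\<And>k. k < t \<Longrightarrow> u k \<in> A \<and> X (n + Suc k) \<omega> = X n \<omega> @ u k" by metis
  then show "\<exists>b. length b = t \<and> fst ` set b \<subseteq> A \<and> follow (xs \<omega>) (es \<omega>) n b"
    by (intro exI[of _ "map (\<lambda>k. (u k, E (n + Suc k) \<omega>)) [0..<t]"]) (auto simp: follow_def)
next
  assume "\<exists>b. length b = t \<and> fst ` set b \<subseteq> A \<and> follow (xs \<omega>) (es \<omega>) n b"
  then obtain b where b: "length b = t" "fst ` set b \<subseteq> A" "follow (xs \<omega>) (es \<omega>) n b" by blast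
  show "rel_stay A n t \<omega>" unfolding rel_stay_def
  proof
    fix k assume k: "k \<in> {1..t}"
    then have "fst (b ! (k - 1)) \<in> A" "X (n + k) \<omega> = X n \<omega> @ fst (b ! (k - 1))"
      using b by (auto simp: follow_def dest!: spec[of _ "k - 1"])
    then show "\<exists>u\<in>A. X (n + k) \<omega> = X n \<omega> @ u" by blast
  qed
qed

lemma follow_unique: "follow x e m b \<Longrightarrow> follow x e m b' \<Longrightarrow> length b = length b' \<Longrightarrow> b = b'"
  by (auto simp: follow_def intro!: nth_equalityI prod_eqI)

text \<open>
  Sum \<open>prob_follow\<close> over all pieces of length \<open>t\<close> in \<open>A\<close>. The total weight of these pieces is identified by
  taking \<open>n = 0\<close>, where the walk is at the root.
\<close>

lemma prob_rel_stay_finite: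
  assumes G: "\<And>w. G w \<Longrightarrow> translates A w" "G []" and A: "A \<subseteq> W"
  shows "\<P>(\<omega> in M. (h (traj n \<omega>) \<and> G (X n \<omega>)) \<and> rel_stay A n t \<omega>)
    = \<P>(\<omega> in M. h (traj n \<omega>) \<and> G (X n \<omega>)) * \<P>(\<omega> in M. \<forall>k\<in>{1..t}. X k \<omega> \<in> A)"
proof -
  let ?B = "{b \<in> states. length b = t \<and> fst ` set b \<subseteq> A}"
  define c where "c = (\<integral>\<^sup>+ b. ennreal (path_weight [] b) \<partial>count_space ?B)"
  have B: "b \<in> ?B" if "length b = t" "fst ` set b \<subseteq> A" for b
    using that A by (force simp: states_def)
  have main: "emeasure M {\<omega> \<in> space M. (h (traj n \<omega>) \<and> G (X n \<omega>)) \<and> rel_stay A n t \<omega>}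
    = emeasure M {\<omega> \<in> space M. h (traj n \<omega>) \<and> G (X n \<omega>)} * c" for h n
  proof -
    let ?H = "\<lambda>\<omega>. h (traj n \<omega>) \<and> G (X n \<omega>)"
    have [measurable]: "Measurable.pred M (\<lambda>\<omega>. G (X n \<omega>))" by measurable
    have 1: "{\<omega> \<in> space M. ?H \<omega> \<and> rel_stay A n t \<omega>}
      = (\<Union>b\<in>?B. {\<omega> \<in> space M. ?H \<omega> \<and> follow (xs \<omega>) (es \<omega>) n b})"
      unfolding rel_stay_iff_follow using B by blast
    have 2: "emeasure M (\<Union>b\<in>?B. {\<omega> \<in> space M. ?H \<omega> \<and> follow (xs \<omega>) (es \<omega>) n b})
      = (\<integral>\<^sup>+ b. emeasure M {\<omega> \<in> space M. ?H \<omega> \<and> follow (xs \<omega>) (es \<omega>) n b} \<partial>count_space ?B)"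
      using follow_unique
      by (intro emeasure_UN_countable)
         (auto simp: disjoint_family_on_def intro: countable_subset[OF _ states_countable])
    have 3: "(\<integral>\<^sup>+ b. emeasure M {\<omega> \<in> space M. ?H \<omega> \<and> follow (xs \<omega>) (es \<omega>) n b} \<partial>count_space ?B)
      = (\<integral>\<^sup>+ b. emeasure M {\<omega> \<in> space M. ?H \<omega>} * ennreal (path_weight [] b) \<partial>count_space ?B)"
    proof (intro nn_integral_cong)
      fix b assume "b \<in> space (count_space ?B)"
      then have b: "fst ` set b \<subseteq> A" by simp
      show "emeasure M {\<omega> \<in> space M. ?H \<omega> \<and> follow (xs \<omega>) (es \<omega>) n b}
          = emeasure M {\<omega> \<in> space M. ?H \<omega>} * ennreal (path_weight [] b)"
        using prob_follow[OF G(1) b, where h = h and n = n]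
        by (simp add: emeasure_eq_measure path_weight_nonneg flip: ennreal_mult)
    qed
    have "(\<integral>\<^sup>+ b. emeasure M {\<omega> \<in> space M. ?H \<omega>} * ennreal (path_weight [] b) \<partial>count_space ?B)
      = emeasure M {\<omega> \<in> space M. ?H \<omega>} * c"
      unfolding c_def by (rule nn_integral_cmult) simp
    then show ?thesis by (simp only: 1 2 3)
  qed
  have "emeasure M {\<omega> \<in> space M. \<forall>k\<in>{1..t}. X k \<omega> \<in> A} = emeasure M {\<omega> \<in> space M. (True \<and> G (X 0 \<omega>)) \<and> rel_stay A 0 t \<omega>}"
    using X_0 by (intro emeasure_eq_AE) (auto simp: rel_stay_def G(2))
  also have "\<dots> = emeasure M {\<omega> \<in> space M. True \<and> G (X 0 \<omega>)} * c"
    using main[of "\<lambda>_. True" 0] by simp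
  also have "emeasure M {\<omega> \<in> space M. True \<and> G (X 0 \<omega>)} = 1"
    using X_0 G(2) by (intro emeasure_eq_1_AE) auto
  finally have "c = ennreal (\<P>(\<omega> in M. \<forall>k\<in>{1..t}. X k \<omega> \<in> A))"
    by (simp add: emeasure_eq_measure)
  then show ?thesis using main[of h n]
    by (simp add: emeasure_eq_measure flip: ennreal_mult)
qed

lemma prob_rel_stay:
  assumes G: "\<And>w. G w \<Longrightarrow> translates A w" "G []" and A: "A \<subseteq> W"
  shows "\<P>(\<omega> in M. (h (traj n \<omega>) \<and> G (X n \<omega>)) \<and> (\<forall>t. rel_stay A n t \<omega>))
    = \<P>(\<omega> in M. h (traj n \<omega>) \<and> G (X n \<omega>)) * \<P>(\<omega> in M. \<forall>k\<ge>1. X k \<omega> \<in> A)"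
proof -
  let ?H = "\<lambda>\<omega>. h (traj n \<omega>) \<and> G (X n \<omega>)"
  have 1: "(\<lambda>t. \<P>(\<omega> in M. ?H \<omega> \<and> rel_stay A n t \<omega>)) \<longlonglongrightarrow> prob (\<Inter>t. {\<omega> \<in> space M. ?H \<omega> \<and> rel_stay A n t \<omega>})"
    by (intro finite_Lim_measure_decseq) (auto simp: decseq_def rel_stay_def)
  have 2: "(\<lambda>t. \<P>(\<omega> in M. \<forall>k\<in>{1..t}. X k \<omega> \<in> A)) \<longlonglongrightarrow> prob (\<Inter>t. {\<omega> \<in> space M. \<forall>k\<in>{1..t}. X k \<omega> \<in> A})"
    by (intro finite_Lim_measure_decseq) (auto simp: decseq_def)
  have "(\<Inter>t. {\<omega> \<in> space M. ?H \<omega> \<and> rel_stay A n t \<omega>}) = {\<omega> \<in> space M. ?H \<omega> \<and> (\<forall>t. rel_stay A n t \<omega>)}"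
    "(\<Inter>t. {\<omega> \<in> space M. \<forall>k\<in>{1..t}. X k \<omega> \<in> A}) = {\<omega> \<in> space M. \<forall>k\<ge>1. X k \<omega> \<in> A}"
    by auto (meson One_nat_def atLeastAtMost_iff order_refl)
  moreover have "prob (\<Inter>t. {\<omega> \<in> space M. ?H \<omega> \<and> rel_stay A n t \<omega>})
      = \<P>(\<omega> in M. ?H \<omega>) * prob (\<Inter>t. {\<omega> \<in> space M. \<forall>k\<in>{1..t}. X k \<omega> \<in> A})"
  proof (rule LIMSEQ_unique[OF 1])
    have "(\<lambda>t. \<P>(\<omega> in M. ?H \<omega> \<and> rel_stay A n t \<omega>))
        = (\<lambda>t. \<P>(\<omega> in M. ?H \<omega>) * \<P>(\<omega> in M. \<forall>k\<in>{1..t}. X k \<omega> \<in> A))"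
      by (rule ext) (rule prob_rel_stay_finite[where G = G and A = A, OF assms])
    then show "(\<lambda>t. \<P>(\<omega> in M. ?H \<omega> \<and> rel_stay A n t \<omega>))
        \<longlonglongrightarrow> \<P>(\<omega> in M. ?H \<omega>) * prob (\<Inter>t. {\<omega> \<in> space M. \<forall>k\<in>{1..t}. X k \<omega> \<in> A})"
      using tendsto_mult_left[OF 2] by simp
  qed
  ultimately show ?thesis by simp
qed

text \<open>
  Escape probability into the branch \<open>J\<close> at the root; by translation it is also the probability that
  the walk, being at a word that ends in \<open>I\<close>, stays strictly inside its cone from now on.
\<close>

definition escape :: real where
  "escape = \<P>(\<omega> in M. \<forall>k\<ge>1. X k \<omega> \<in> starts_J)"

lemma escape_nonneg: "0 \<le> escape" and escape_le_1: "escape \<le> 1"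
  by (simp_all add: escape_def)

lemma pred_stays [measurable]: "Measurable.pred M (\<lambda>\<omega>. stays (xs \<omega>) n)"
  unfolding stays_def by measurable

lemma stays_iff_rel_stay:
  assumes "\<omega> \<in> space M"
  shows "stays (xs \<omega>) n \<longleftrightarrow> ends_I (X n \<omega>) \<and> (\<forall>t. rel_stay starts_J n t \<omega>)"
proof -
  have "strict_prefix (X n \<omega>) (X k \<omega>) \<longleftrightarrow> (\<exists>u\<in>starts_J. X k \<omega> = X n \<omega> @ u)" if "ends_I (X n \<omega>)" for k
  proof
    assume "strict_prefix (X n \<omega>) (X k \<omega>)"
    then obtain z where z: "X k \<omega> = X n \<omega> @ z" "z \<noteq> []" by (auto simp: strict_prefix_def prefix_def)
    have "X n \<omega> @ z \<in> W" using X_in_W[OF assms, of k] unfolding z(1) .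
    then have "z \<in> starts_J" using append_in_W_iff[OF that] z(2) by simp
    then show "\<exists>u\<in>starts_J. X k \<omega> = X n \<omega> @ u" using z(1) by blast
  next
    assume "\<exists>u\<in>starts_J. X k \<omega> = X n \<omega> @ u"
    then obtain u where "X k \<omega> = X n \<omega> @ u" "u \<noteq> []" using Nil_notin_starts_J by metis
    then show "strict_prefix (X n \<omega>) (X k \<omega>)" by (simp add: strict_prefix_def)
  qed
  moreover have "(\<forall>t. rel_stay starts_J n t \<omega>) \<longleftrightarrow> (\<forall>k>n. \<exists>u\<in>starts_J. X k \<omega> = X n \<omega> @ u)"
  proof
    assume *: "\<forall>t. rel_stay starts_J n t \<omega>"
    show "\<forall>k>n. \<exists>u\<in>starts_J. X k \<omega> = X n \<omega> @ u"
    proof (intro allI impI)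
      fix k assume "n < k"
      then show "\<exists>u\<in>starts_J. X k \<omega> = X n \<omega> @ u"
        using *[rule_format, of "k - n", unfolded rel_stay_def, rule_format, of "k - n"] by simp
    qed
  next
    assume *: "\<forall>k>n. \<exists>u\<in>starts_J. X k \<omega> = X n \<omega> @ u"
    show "\<forall>t. rel_stay starts_J n t \<omega>"
      unfolding rel_stay_def using * by simp
  qed
  ultimately show ?thesis unfolding stays_def by blast
qed

lemma prob_stays:
  "\<P>(\<omega> in M. h (traj n \<omega>) \<and> stays (xs \<omega>) n)
    = \<P>(\<omega> in M. h (traj n \<omega>) \<and> ends_I (X n \<omega>)) * escape"
proof -
  have "\<P>(\<omega> in M. ((h (traj n \<omega>) \<and> ends_I (fst (last (traj n \<omega>)))) \<and> (ends_I (X n \<omega>) \<or> X n \<omega> = [])) \<and> (\<forall>t. rel_stay starts_J n t \<omega>))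
    = \<P>(\<omega> in M. (h (traj n \<omega>) \<and> ends_I (fst (last (traj n \<omega>)))) \<and> (ends_I (X n \<omega>) \<or> X n \<omega> = [])) * escape"
    unfolding escape_def using translates_starts_J translates_Nil by (intro prob_rel_stay) (auto simp: starts_J_def)
  also have "{\<omega> \<in> space M. ((h (traj n \<omega>) \<and> ends_I (fst (last (traj n \<omega>)))) \<and> (ends_I (X n \<omega>) \<or> X n \<omega> = [])) \<and> (\<forall>t. rel_stay starts_J n t \<omega>)}
    = {\<omega> \<in> space M. h (traj n \<omega>) \<and> stays (xs \<omega>) n}"
    using stays_iff_rel_stay by (auto simp: last_traj)
  also have "{\<omega> \<in> space M. (h (traj n \<omega>) \<and> ends_I (fst (last (traj n \<omega>)))) \<and> (ends_I (X n \<omega>) \<or> X n \<omega> = [])}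
    = {\<omega> \<in> space M. h (traj n \<omega>) \<and> ends_I (X n \<omega>)}"
    by (auto simp: last_traj)
  finally show ?thesis .
qed

lemma pred_first_block [measurable]: "Measurable.pred M (\<lambda>\<omega>. first_block (xs \<omega>) (es \<omega>) n b)"
  unfolding first_block_def by measurable

text \<open>
  The event that the next block is \<open>b\<close>, written in terms of the trajectory up to the end of \<open>b\<close>. Only the
  requirement that the walk stays from then on concerns the future.
\<close>

definition block_event :: "(('a list \<times> bool) list \<Rightarrow> bool) \<Rightarrow> nat \<Rightarrow> ('a list \<times> bool) list \<Rightarrow> ('a list \<times> bool) list \<Rightarrow> bool" where
  "block_event h n b l \<longleftrightarrow> h (take (Suc n) l) \<and> ends_I (fst (l ! n)) \<and> follow (\<lambda>k. fst (l ! k)) (\<lambda>k. snd (l ! k)) n b"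

lemma block_event_traj:
  "block_event h n b (traj (n + length b) \<omega>) \<longleftrightarrow> (h (traj n \<omega>) \<and> ends_I (X n \<omega>)) \<and> follow (xs \<omega>) (es \<omega>) n b"
  by (simp add: block_event_def traj_add[of n "length b"] follow_def nth_append nth_traj)

lemma first_block_as_block_event:
  assumes "irreducible_block b"
  shows "h (traj n \<omega>) \<and> first_block (xs \<omega>) (es \<omega>) n b
    \<longleftrightarrow> block_event h n b (traj (n + length b) \<omega>) \<and> stays (xs \<omega>) (n + length b)"
  using assms by (simp only: block_event_traj first_block_def simp_thms conj_assoc)

text \<open>
  Given the past, the walk follows \<open>b\<close> with probability \<open>path_weight [] b\<close> and then stays with probability
  \<open>escape\<close>. Neither factor depends on the past, which is the source of independence.
\<close>

lemma prob_first_block: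
  assumes b: "irreducible_block b"
  shows "\<P>(\<omega> in M. h (traj n \<omega>) \<and> first_block (xs \<omega>) (es \<omega>) n b)
    = \<P>(\<omega> in M. h (traj n \<omega>) \<and> ends_I (X n \<omega>)) * path_weight [] b * escape"
proof -
  let ?H = "block_event h n b" and ?m = "n + length b"
  have ends_I: "ends_I (X ?m \<omega>)" if "follow (xs \<omega>) (es \<omega>) n b" "ends_I (X n \<omega>)" for \<omega>
  proof -
    have "ends_I (word_at b (length b))" "0 < length b" using b by (auto simp: irreducible_block_def pre_regen_def)
    then show ?thesis
      using follow_word_at[OF that(1) order_refl] ends_I_append_iff[OF that(2) word_at_in_starts_J[OF b], of "length b"] by simp
  qed
  have "\<P>(\<omega> in M. h (traj n \<omega>) \<and> first_block (xs \<omega>) (es \<omega>) n b)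
      = \<P>(\<omega> in M. ?H (traj ?m \<omega>) \<and> ends_I (X ?m \<omega>)) * escape"
    unfolding first_block_as_block_event[OF b] by (rule prob_stays)
  also have "{\<omega> \<in> space M. ?H (traj ?m \<omega>) \<and> ends_I (X ?m \<omega>)}
      = {\<omega> \<in> space M. (h (traj n \<omega>) \<and> ends_I (X n \<omega>)) \<and> follow (xs \<omega>) (es \<omega>) n b}"
    unfolding block_event_traj using ends_I by auto
  also have "prob \<dots> = \<P>(\<omega> in M. h (traj n \<omega>) \<and> ends_I (X n \<omega>)) * path_weight [] b"
    using b translates_starts_J by (intro prob_follow) (auto simp: irreducible_block_def)
  finally show ?thesis .
qed

subsection \<open>Transience\<close>

lemma AE_step_pos:
  "AE \<omega> in M. 0 < q (X n \<omega>) (X (Suc n) \<omega>)"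
proof -
  have "AE \<omega> in M. \<forall>l\<in>states. length l = Suc n \<longrightarrow> (\<forall>s\<in>W \<times> UNIV. q (fst (last l)) (fst s) = 0 \<longrightarrow> traj (Suc n) \<omega> \<noteq> l @ [s])"
    unfolding AE_ball_countable[OF states_countable]
  proof (intro ballI)
    fix l assume "l \<in> states"
    have "AE \<omega> in M. \<forall>s\<in>W \<times> UNIV. length l = Suc n \<longrightarrow> q (fst (last l)) (fst s) = 0 \<longrightarrow> traj (Suc n) \<omega> \<noteq> l @ [s]"
    proof (subst AE_ball_countable)
      show "countable (W \<times> (UNIV :: bool set))" using W_countable by auto
      show "\<forall>s\<in>W \<times> UNIV. AE \<omega> in M. length l = Suc n \<longrightarrow> q (fst (last l)) (fst s) = 0 \<longrightarrow> traj (Suc n) \<omega> \<noteq> l @ [s]"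
      proof
        fix s :: "'a list \<times> bool"
        show "AE \<omega> in M. length l = Suc n \<longrightarrow> q (fst (last l)) (fst s) = 0 \<longrightarrow> traj (Suc n) \<omega> \<noteq> l @ [s]"
        proof (cases "length l = Suc n \<and> q (fst (last l)) (fst s) = 0")
          case True
          then have "\<P>(\<omega> in M. traj (Suc n) \<omega> = l @ [s]) = 0"
            using prob_traj_snoc[of l n s] by (simp add: step_weight_def)
          then show ?thesis
            using prob_eq_0[of "{\<omega> \<in> space M. traj (Suc n) \<omega> = l @ [s]}"] by auto
        qed auto
      qed
    qed
    then show "AE \<omega> in M. length l = Suc n \<longrightarrow> (\<forall>s\<in>W \<times> UNIV. q (fst (last l)) (fst s) = 0 \<longrightarrow> traj (Suc n) \<omega> \<noteq> l @ [s])"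
      by eventually_elim auto
  qed
  then show ?thesis
    using AE_space
  proof eventually_elim
    case (elim \<omega>)
    have "q (fst (last (traj n \<omega>))) (fst (X (Suc n) \<omega>, E (Suc n) \<omega>)) \<noteq> 0"
      using elim(1)[rule_format, of "traj n \<omega>" "(X (Suc n) \<omega>, E (Suc n) \<omega>)"] traj_in_states X_in_W elim(2)
      by (auto simp: traj_Suc_eq)
    then show ?case using q_nonneg[of "X n \<omega>" "X (Suc n) \<omega>"] by (simp add: last_traj less_le)
  qed
qed

lemma AE_admissible: "AE \<omega> in M. X 0 \<omega> = [] \<and> (\<forall>n. 0 < q (X n \<omega>) (X (Suc n) \<omega>))"
  using X_0 AE_step_pos by (auto simp: AE_all_countable)

text \<open>
  The expected number of visits to the root is finite, so there is almost surely a last visit, and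
  each visit is the last one with the conditional probability never to return.
\<close>

lemma prob_never_return_pos:
  assumes "summable (\<lambda>n. \<P>(\<omega> in M. X n \<omega> = []))"
  shows "0 < \<P>(\<omega> in M. \<forall>k\<ge>1. X k \<omega> \<noteq> [])"
proof (rule ccontr)
  assume "\<not> ?thesis"
  then have 0: "\<P>(\<omega> in M. \<forall>k\<ge>1. X k \<omega> \<noteq> []) = 0"
    using measure_nonneg[of M] by (simp add: not_less antisym)
  have last: "AE \<omega> in M. \<not> (X n \<omega> = [] \<and> (\<forall>k>n. X k \<omega> \<noteq> []))" for n
  proof -
    have "\<P>(\<omega> in M. (True \<and> X n \<omega> = []) \<and> (\<forall>t. rel_stay (W - {[]}) n t \<omega>))
      = \<P>(\<omega> in M. True \<and> X n \<omega> = []) * \<P>(\<omega> in M. \<forall>k\<ge>1. X k \<omega> \<in> W - {[]})"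
      using translates_Nil by (intro prob_rel_stay[where G = "\<lambda>w. w = []" and h = "\<lambda>_. True"]) auto
    also have "{\<omega> \<in> space M. \<forall>k\<ge>1. X k \<omega> \<in> W - {[]}} = {\<omega> \<in> space M. \<forall>k\<ge>1. X k \<omega> \<noteq> []}"
      using X_in_W by auto
    also have "{\<omega> \<in> space M. (True \<and> X n \<omega> = []) \<and> (\<forall>t. rel_stay (W - {[]}) n t \<omega>)}
      = {\<omega> \<in> space M. X n \<omega> = [] \<and> (\<forall>k>n. X k \<omega> \<noteq> [])}"
    proof -
      have "(\<forall>t. rel_stay (W - {[]}) n t \<omega>) \<longleftrightarrow> (\<forall>k>n. X k \<omega> \<noteq> [])"
        if \<omega>: "\<omega> \<in> space M" "X n \<omega> = []" for \<omega>
      proof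
        assume *: "\<forall>t. rel_stay (W - {[]}) n t \<omega>"
        show "\<forall>k>n. X k \<omega> \<noteq> []"
        proof (intro allI impI)
          fix k assume "n < k"
          then obtain d where "k = n + Suc d" using less_imp_Suc_add by auto
          then show "X k \<omega> \<noteq> []"
            using *[rule_format, of "Suc d", unfolded rel_stay_def, rule_format, of "Suc d"] by auto
        qed
      next
        assume "\<forall>k>n. X k \<omega> \<noteq> []"
        then show "\<forall>t. rel_stay (W - {[]}) n t \<omega>"
          unfolding rel_stay_def using X_in_W[OF \<omega>(1)] \<omega>(2) by auto
      qed
      then show ?thesis by auto
    qed
    finally have "\<P>(\<omega> in M. X n \<omega> = [] \<and> (\<forall>k>n. X k \<omega> \<noteq> [])) = 0"
      by (simp only: 0 mult_zero_right)
    then show ?thesis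
      using prob_eq_0[of "{\<omega> \<in> space M. X n \<omega> = [] \<and> (\<forall>k>n. X k \<omega> \<noteq> [])}"] by auto
  qed
  have "AE \<omega> in M. eventually (\<lambda>n. \<omega> \<in> space M - {\<omega> \<in> space M. X n \<omega> = []}) sequentially"
    using assms by (intro borel_cantelli_AE1) (auto simp: less_top[symmetric])
  moreover have "AE \<omega> in M. \<forall>n. \<not> (X n \<omega> = [] \<and> (\<forall>k>n. X k \<omega> \<noteq> []))"
    using last by (simp add: AE_all_countable)
  ultimately have "AE \<omega> in M. False"
    using X_0
  proof eventually_elim
    case (elim \<omega>)
    then obtain N where N: "\<And>n. n \<ge> N \<Longrightarrow> X n \<omega> \<noteq> []"
      by (auto simp: eventually_sequentially)
    have fin: "finite {n. X n \<omega> = []}"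
    proof (rule finite_subset)
      show "{n. X n \<omega> = []} \<subseteq> {..<N}" using N not_le by blast
    qed simp
    have ne: "{n. X n \<omega> = []} \<noteq> {}" using elim(3) by auto
    define m where "m = Max {n. X n \<omega> = []}"
    have "X m \<omega> = []" using Max_in[OF fin ne] by (simp add: m_def)
    then obtain k where "k > m" "X k \<omega> = []" using elim(2) by blast
    then show False using Max_ge[OF fin, of k] by (simp add: m_def)
  qed
  then show False by simp
qed

text \<open>
  The first letter can change its type only at the root.
\<close>

lemma never_return_imp_branch:
  assumes "\<And>n. 0 < q (x n) (x (Suc n))" "\<And>k. k \<ge> 1 \<Longrightarrow> x k \<noteq> []"
  shows "(\<forall>k\<ge>1. x k \<in> starts_J) \<or> (\<forall>k\<ge>1. x k \<in> {w \<in> W. w \<noteq> [] \<and> hd w \<in> I})"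
proof -
  have W: "x n \<in> W" for n using edge[OF assms(1)[of n]] by blast
  have same: "hd (x (Suc n)) \<in> I \<longleftrightarrow> hd (x n) \<in> I" if "n \<ge> 1" for n
  proof -
    obtain u s t where *: "x n = u @ s" "x (Suc n) = u @ t" "length s \<le> 1" "length t \<le> 1"
      "set s \<union> set t \<subseteq> I \<or> set s \<union> set t \<subseteq> J"
      using edge[OF assms(1)[of n]] by blast
    show ?thesis
    proof (cases "u = []")
      case True
      then have "s \<noteq> []" "t \<noteq> []" using * assms(2)[of n] assms(2)[of "Suc n"] that by auto
      then show ?thesis using True * types_disjoint by (cases s; cases t) auto
    qed (use * in simp)
  qed
  have "hd (x k) \<in> I \<longleftrightarrow> hd (x 1) \<in> I" if "k \<ge> 1" for k
    using that by (induction k rule: dec_induct) (auto simp: same)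
  moreover have "hd (x k) \<in> I \<union> J" if "k \<ge> 1" for k
    using letters_W[OF W[of k]] assms(2)[OF that] hd_in_set by blast
  ultimately show ?thesis
    using W assms(2) unfolding starts_J_def by blast
qed

lemma prob_branch_pos:
  assumes "summable (\<lambda>n. \<P>(\<omega> in M. X n \<omega> = []))"
  shows "0 < escape \<or> 0 < \<P>(\<omega> in M. \<forall>k\<ge>1. X k \<omega> \<in> {w \<in> W. w \<noteq> [] \<and> hd w \<in> I})"
proof -
  let ?I = "{\<omega> \<in> space M. \<forall>k\<ge>1. X k \<omega> \<in> {w \<in> W. w \<noteq> [] \<and> hd w \<in> I}}"
  let ?J = "{\<omega> \<in> space M. \<forall>k\<ge>1. X k \<omega> \<in> starts_J}"
  have [measurable]: "?I \<in> sets M" "?J \<in> sets M" by measurable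
  have "\<P>(\<omega> in M. \<forall>k\<ge>1. X k \<omega> \<noteq> []) \<le> prob (?J \<union> ?I)"
  proof (rule finite_measure_mono_AE)
    show "AE \<omega> in M. \<omega> \<in> {\<omega> \<in> space M. \<forall>k\<ge>1. X k \<omega> \<noteq> []} \<longrightarrow> \<omega> \<in> ?J \<union> ?I"
      using AE_admissible
    proof eventually_elim
      case (elim \<omega>)
      then show ?case using never_return_imp_branch[of "\<lambda>k. X k \<omega>"] by auto
    qed
  qed simp
  also have "\<dots> \<le> escape + prob ?I"
    unfolding escape_def by (intro measure_Un_le) auto
  finally show ?thesis
    using prob_never_return_pos[OF assms] by linarith
qed

subsection \<open>Frequency of regeneration times\<close>

lemma prob_append_I_ge:
  "\<P>(\<omega> in M. h (traj n \<omega>) \<and> \<not> ends_I (X n \<omega>)) * a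
    \<le> \<P>(\<omega> in M. (h (traj n \<omega>) \<and> \<not> ends_I (X n \<omega>)) \<and> (\<exists>v\<in>I. X (Suc n) \<omega> = X n \<omega> @ [v]))"
proof -
  have "\<P>(\<omega> in M. h (traj n \<omega>) \<and> \<not> ends_I (fst (last (traj n \<omega>)))) * a
    \<le> \<P>(\<omega> in M. (h (traj n \<omega>) \<and> \<not> ends_I (fst (last (traj n \<omega>)))) \<and> (\<exists>v\<in>I. X (Suc n) \<omega> = X n \<omega> @ [v]))"
  proof (rule prob_by_traj_ge)
    fix l assume l: "length l = Suc n" "h l \<and> \<not> ends_I (fst (last l))" "l \<in> states"
    define x where "x = fst (last l)"
    have "last l \<in> set l" using l(1) by (intro last_in_set) auto
    then have x: "x \<in> W" "x = [] \<or> last x \<notin> I" using l(2,3) by (auto simp: states_def x_def ends_I_def)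
    let ?c = "\<P>(\<omega> in M. traj n \<omega> = l)"
    let ?P = "\<P>(\<omega> in M. traj n \<omega> = l \<and> (\<exists>v\<in>I. X (Suc n) \<omega> = X n \<omega> @ [v]))"
    have step: "\<P>(\<omega> in M. traj n \<omega> = l \<and> X (Suc n) \<omega> = X n \<omega> @ [v]) = ?c * q x (x @ [v])" for v
    proof -
      have eq: "{\<omega> \<in> space M. traj n \<omega> = l \<and> X (Suc n) \<omega> = X n \<omega> @ [v]}
        = {\<omega> \<in> space M. traj (Suc n) \<omega> = l @ [(x @ [v], True)]} \<union> {\<omega> \<in> space M. traj (Suc n) \<omega> = l @ [(x @ [v], False)]}"
        using last_traj[of n] by (auto simp: traj_Suc_eq x_def)
      have "\<P>(\<omega> in M. traj n \<omega> = l \<and> X (Suc n) \<omega> = X n \<omega> @ [v])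
        = \<P>(\<omega> in M. traj (Suc n) \<omega> = l @ [(x @ [v], True)]) + \<P>(\<omega> in M. traj (Suc n) \<omega> = l @ [(x @ [v], False)])"
        unfolding eq by (intro finite_measure_Union) auto
      then show ?thesis
        unfolding prob_traj_snoc[OF l(1)] by (simp add: step_weight_def x_def algebra_simps)
    qed
    have fin: "sum (\<lambda>v. ?c * q x (x @ [v])) F \<le> ?P" if F: "finite F" "F \<subseteq> I" for F
    proof -
      have "sum (\<lambda>v. ?c * q x (x @ [v])) F = (\<Sum>v\<in>F. \<P>(\<omega> in M. traj n \<omega> = l \<and> X (Suc n) \<omega> = X n \<omega> @ [v]))"
        by (simp add: step)
      also have "\<dots> = prob (\<Union>v\<in>F. {\<omega> \<in> space M. traj n \<omega> = l \<and> X (Suc n) \<omega> = X n \<omega> @ [v]})"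
        using F by (intro finite_measure_finite_Union[symmetric]) (auto simp: disjoint_family_on_def)
      also have "\<dots> \<le> ?P"
        using F by (intro finite_measure_mono) auto
      finally show ?thesis .
    qed
    have "((\<lambda>v. ?c * q x (x @ [v])) has_sum (?c * a)) I"
      by (intro has_sum_cmult_right I_step x)
    then show "?c * a \<le> ?P"
      using fin by (rule has_sum_le_finite_sums)
  qed (use a in auto)
  then show ?thesis by (simp add: last_traj)
qed

lemma append_I_imp_ends_I:
  "\<omega> \<in> space M \<Longrightarrow> v \<in> I \<Longrightarrow> X (Suc n) \<omega> = X n \<omega> @ [v] \<Longrightarrow> ends_I (X (Suc n) \<omega>)"
  using X_in_W[of \<omega> "Suc n"] by (simp add: ends_I_def)

text \<open>
  If the walk is at a word that does not end in \<open>I\<close>, it appends a letter of type \<open>I\<close> with probability at least \<open>a\<close>.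
\<close>

lemma prob_ends_I_two_steps:
  "a \<le> \<P>(\<omega> in M. ends_I (X n \<omega>)) + \<P>(\<omega> in M. ends_I (X (Suc n) \<omega>))"
proof -
  let ?p = "\<P>(\<omega> in M. \<not> ends_I (X n \<omega>))"
  have 1: "\<P>(\<omega> in M. ends_I (X n \<omega>)) = 1 - ?p"
    by (subst prob_compl[symmetric]) (auto intro!: arg_cong[of _ _ prob])
  have "?p * a \<le> \<P>(\<omega> in M. \<not> ends_I (X n \<omega>) \<and> (\<exists>v\<in>I. X (Suc n) \<omega> = X n \<omega> @ [v]))"
    using prob_append_I_ge[of "\<lambda>_. True" n] by simp
  also have "\<dots> \<le> \<P>(\<omega> in M. ends_I (X (Suc n) \<omega>))"
    using append_I_imp_ends_I by (intro finite_measure_mono) auto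
  finally have "?p * a \<le> \<P>(\<omega> in M. ends_I (X (Suc n) \<omega>))" .
  moreover have "?p \<le> 1" "0 \<le> ?p" by auto
  then have "(1 - ?p) * a \<le> 1 - ?p" using a by (simp add: mult_left_le)
  ultimately show ?thesis using 1 by (simp add: algebra_simps)
qed

lemma sum_prob_ends_I_ge: "a / 2 * real N \<le> (\<Sum>n<2 * N. \<P>(\<omega> in M. ends_I (X n \<omega>)))"
proof (induction N)
  case (Suc N)
  then show ?case using prob_ends_I_two_steps[of "2 * N"] a by (simp add: algebra_simps)
qed simp

text \<open>
  A vertex has at most one final departure. Assign to it the first visit to the same vertex;
  at that time also its cone is new, since the vertex is the gate of the cone.
\<close>

lemma count_stays_le_fresh:
  assumes x0: "x 0 = []" and pos: "\<And>n. 0 < q (x n) (x (Suc n))"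
  shows "card {n. n < N \<and> stays x n} \<le> card {n. n < N \<and> ends_I (x n) \<and> fresh x 0 n}"
proof -
  \<comment> \<open>The time of the first visit to the vertex occupied at time \<open>n\<close>.\<close>
  define f where "f n = (LEAST k. x k = x n)" for n
  have f: "x (f n) = x n" "f n \<le> n" "\<And>k. k < f n \<Longrightarrow> x k \<noteq> x n" for n
    unfolding f_def by (auto intro: LeastI Least_le dest: not_less_Least)
  have "inj_on f {n. n < N \<and> stays x n}"
  proof (rule inj_onI)
    fix m n assume *: "m \<in> {n. n < N \<and> stays x n}" "n \<in> {n. n < N \<and> stays x n}" "f m = f n"
    then have "x m = x n" using f(1) by metis
    then show "m = n" using *(1,2) by (metis (no_types, lifting) mem_Collect_eq nat_neq_iff stays_def strict_prefix_def)
  qed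
  moreover have "f ` {n. n < N \<and> stays x n} \<subseteq> {n. n < N \<and> ends_I (x n) \<and> fresh x 0 n}"
  proof safe
    fix n assume n: "n < N" "stays x n"
    show "f n < N" using f(2)[of n] n by simp
    show ends_I: "ends_I (x (f n))" using n f(1) by (simp add: stays_def)
    show "fresh x 0 (f n)"
      unfolding fresh_def
    proof (intro allI impI notI)
      fix k assume k: "0 \<le> k \<and> k < f n" and p: "prefix (x (f n)) (x k)"
      have "\<not> prefix (x (f n)) (x 0)" using ends_I by (simp add: x0 ends_I_def)
      then obtain j where "0 < j" "j \<le> k" "x j = x (f n)"
        using enter_cone_path[of 0 k x "x (f n)"] pos p by auto
      then show False using f(1,3)[of n] f(3)[of j n] k by auto
    qed
  qed
  ultimately show ?thesis by (intro card_inj_on_le) auto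
qed

lemma pred_fresh [measurable]: "Measurable.pred M (\<lambda>\<omega>. fresh (xs \<omega>) m n)"
  unfolding fresh_def by measurable

lemma fresh_traj: "fresh (\<lambda>k. fst (traj n \<omega> ! k)) 0 n \<longleftrightarrow> fresh (xs \<omega>) 0 n"
  by (auto simp: fresh_def nth_traj)

lemma prob_regen:
  "\<P>(\<omega> in M. fresh (xs \<omega>) 0 n \<and> stays (xs \<omega>) n) = \<P>(\<omega> in M. fresh (xs \<omega>) 0 n \<and> ends_I (X n \<omega>)) * escape"
  using prob_stays[of "\<lambda>l. fresh (\<lambda>k. fst (l ! k)) 0 n" n] by (simp add: fresh_traj)

text \<open>
  Being at a word that ends in \<open>I\<close> has probability bounded below on average, each such time is a final
  departure with probability \<open>escape\<close>, there are at least as many first visits as final departures, and each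
  first visit is a regeneration with probability \<open>escape\<close>. Hence regenerations have positive density.
\<close>

lemma sum_prob_regen_ge:
  "escape\<^sup>2 * a / 2 * real N \<le> (\<Sum>n<2 * N. \<P>(\<omega> in M. fresh (xs \<omega>) 0 n \<and> stays (xs \<omega>) n))"
proof -
  have count: "real (card {n. n < N \<and> P n}) = (\<Sum>n<N. indicator {n. P n} n)" for N :: nat and P
    by (subst card_eq_sum) (auto simp: indicator_def sum.If_cases intro!: arg_cong[of _ _ card])
  have "(\<Sum>n<N. \<P>(\<omega> in M. stays (xs \<omega>) n)) \<le> (\<Sum>n<N. \<P>(\<omega> in M. fresh (xs \<omega>) 0 n \<and> ends_I (X n \<omega>)))" for N
  proof -
    have "(\<Sum>n<N. \<P>(\<omega> in M. stays (xs \<omega>) n))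
        = expectation (\<lambda>\<omega>. \<Sum>n<N. indicator {\<omega> \<in> space M. stays (xs \<omega>) n} \<omega>)"
      by (subst Bochner_Integration.integral_sum) (auto simp: less_top[symmetric])
    also have "\<dots> \<le> expectation (\<lambda>\<omega>. \<Sum>n<N. indicator {\<omega> \<in> space M. fresh (xs \<omega>) 0 n \<and> ends_I (X n \<omega>)} \<omega>)"
    proof (rule integral_mono_AE)
      show "AE \<omega> in M. (\<Sum>n<N. indicator {\<omega> \<in> space M. stays (xs \<omega>) n} \<omega> :: real)
          \<le> (\<Sum>n<N. indicator {\<omega> \<in> space M. fresh (xs \<omega>) 0 n \<and> ends_I (X n \<omega>)} \<omega>)"
        using AE_admissible AE_space
      proof eventually_elim
        case (elim \<omega>)
        have "real (card {n. n < N \<and> stays (xs \<omega>) n}) \<le> real (card {n. n < N \<and> (fresh (xs \<omega>) 0 n \<and> ends_I (X n \<omega>))})"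
          using count_stays_le_fresh[of "xs \<omega>" N] elim by (simp add: conj_commute)
        then show ?case unfolding count using elim by (simp add: indicator_def)
      qed
    qed (auto simp: less_top[symmetric])
    also have "\<dots> = (\<Sum>n<N. \<P>(\<omega> in M. fresh (xs \<omega>) 0 n \<and> ends_I (X n \<omega>)))"
      by (subst Bochner_Integration.integral_sum) (auto simp: less_top[symmetric])
    finally show ?thesis .
  qed
  note * = this[of "2 * N"]
  have st: "\<P>(\<omega> in M. stays (xs \<omega>) n) = \<P>(\<omega> in M. ends_I (X n \<omega>)) * escape" for n
    using prob_stays[of "\<lambda>_. True" n] by simp
  have "a / 2 * real N * escape * escape \<le> (\<Sum>n<2 * N. \<P>(\<omega> in M. ends_I (X n \<omega>))) * escape * escape"
    using sum_prob_ends_I_ge[of N] escape_nonneg by (intro mult_right_mono) auto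
  also have "\<dots> \<le> (\<Sum>n<2 * N. \<P>(\<omega> in M. fresh (xs \<omega>) 0 n \<and> ends_I (X n \<omega>))) * escape"
    using * escape_nonneg unfolding st sum_distrib_right[symmetric] by (rule mult_right_mono)
  also have "\<dots> = (\<Sum>n<2 * N. \<P>(\<omega> in M. fresh (xs \<omega>) 0 n \<and> stays (xs \<omega>) n))"
    by (simp add: prob_regen sum_distrib_right)
  finally show ?thesis by (simp add: power2_eq_square mult_ac)
qed

end

section \<open>Independent blocks\<close>

locale escaping_walk = flagged_walk W q I J M X E \<beta> a
  for W :: "'a list set" and q I J and M :: "'w measure" and X E \<beta> a +
  assumes escape_pos: "0 < escape"
begin

subsection \<open>The law of a block\<close>

text \<open>
  The weights of the irreducible blocks. That they sum to one is not obvious: it says that a walk which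
  stays in a cone regenerates there again, and it comes out of the same estimate as the finite mean length.
\<close>

definition block_law :: "('a list \<times> bool) list measure" where
  "block_law = density (count_space UNIV) (\<lambda>b. ennreal (path_weight [] b) * indicator {b. irreducible_block b} b)"

lemma space_block_law [simp]: "space block_law = UNIV" and sets_block_law [simp]: "sets block_law = UNIV"
  by (simp_all add: block_law_def)

lemma irreducible_block_in_states: "irreducible_block b \<Longrightarrow> b \<in> states"
  by (auto simp: irreducible_block_def states_def starts_J_def subset_eq)

lemma emeasure_block_law:
  "emeasure block_law S = (\<integral>\<^sup>+ b. ennreal (path_weight [] b) \<partial>count_space {b \<in> S. irreducible_block b})"
proof -
  have "emeasure block_law S = (\<integral>\<^sup>+ b. ennreal (path_weight [] b) * indicator {b. irreducible_block b} b * indicator S b \<partial>count_space UNIV)"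
    unfolding block_law_def by (rule emeasure_density) auto
  also have "\<dots> = (\<integral>\<^sup>+ b. ennreal (path_weight [] b) * indicator {b \<in> S. irreducible_block b} b \<partial>count_space UNIV)"
    by (intro nn_integral_cong) (simp split: split_indicator)
  finally show ?thesis by (simp add: nn_integral_count_space_indicator)
qed

lemma pred_bex_first_block [measurable]: "Measurable.pred M (\<lambda>\<omega>. \<exists>b\<in>S. first_block (xs \<omega>) (es \<omega>) n b)"
proof -
  have "(\<lambda>\<omega>. \<exists>b\<in>S. first_block (xs \<omega>) (es \<omega>) n b) = (\<lambda>\<omega>. \<exists>b\<in>S \<inter> states. first_block (xs \<omega>) (es \<omega>) n b)"
    using irreducible_block_in_states by (auto simp: first_block_def fun_eq_iff)
  moreover have "countable (S \<inter> states)" by simp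
  ultimately show ?thesis by simp
qed

lemma pred_ex_first_block [measurable]: "Measurable.pred M (\<lambda>\<omega>. \<exists>b. first_block (xs \<omega>) (es \<omega>) n b)"
  using pred_bex_first_block[of UNIV] by simp

lemma emeasure_ex_first_block:
  assumes F[measurable]: "\<And>b. Measurable.pred M (F b)"
    and eq: "\<And>b. irreducible_block b \<Longrightarrow> b \<in> S \<Longrightarrow> emeasure M {\<omega> \<in> space M. h (traj n \<omega>) \<and> first_block (xs \<omega>) (es \<omega>) n b \<and> F b \<omega>}
      = emeasure M {\<omega> \<in> space M. h (traj n \<omega>) \<and> first_block (xs \<omega>) (es \<omega>) n b} * c"
  shows "emeasure M {\<omega> \<in> space M. h (traj n \<omega>) \<and> (\<exists>b\<in>S. first_block (xs \<omega>) (es \<omega>) n b \<and> F b \<omega>)}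
    = emeasure M {\<omega> \<in> space M. h (traj n \<omega>) \<and> stays (xs \<omega>) n} * emeasure block_law S * c"
proof -
  let ?V = "{b \<in> S. irreducible_block b}"
  have 1: "{\<omega> \<in> space M. h (traj n \<omega>) \<and> (\<exists>b\<in>S. first_block (xs \<omega>) (es \<omega>) n b \<and> F b \<omega>)}
    = (\<Union>b\<in>?V. {\<omega> \<in> space M. h (traj n \<omega>) \<and> first_block (xs \<omega>) (es \<omega>) n b \<and> F b \<omega>})"
    by (auto simp: first_block_def)
  have 2: "emeasure M (\<Union>b\<in>?V. {\<omega> \<in> space M. h (traj n \<omega>) \<and> first_block (xs \<omega>) (es \<omega>) n b \<and> F b \<omega>})
    = (\<integral>\<^sup>+ b. emeasure M {\<omega> \<in> space M. h (traj n \<omega>) \<and> first_block (xs \<omega>) (es \<omega>) n b \<and> F b \<omega>} \<partial>count_space ?V)"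
  proof (rule emeasure_UN_countable)
    show "countable ?V" using irreducible_block_in_states by (intro countable_subset[OF _ states_countable]) auto
    show "disjoint_family_on (\<lambda>b. {\<omega> \<in> space M. h (traj n \<omega>) \<and> first_block (xs \<omega>) (es \<omega>) n b \<and> F b \<omega>}) ?V"
      using first_block_unique by (fastforce simp: disjoint_family_on_def)
  qed measurable
  have 3: "emeasure M {\<omega> \<in> space M. h (traj n \<omega>) \<and> first_block (xs \<omega>) (es \<omega>) n b}
    = emeasure M {\<omega> \<in> space M. h (traj n \<omega>) \<and> stays (xs \<omega>) n} * ennreal (path_weight [] b)" if "irreducible_block b" for b
  proof -
    have "\<P>(\<omega> in M. h (traj n \<omega>) \<and> first_block (xs \<omega>) (es \<omega>) n b)
      = \<P>(\<omega> in M. h (traj n \<omega>) \<and> stays (xs \<omega>) n) * path_weight [] b"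
      unfolding prob_first_block[OF that, of h n] prob_stays[of h n] by simp
    then show ?thesis
      by (simp add: emeasure_eq_measure path_weight_nonneg flip: ennreal_mult)
  qed
  have "(\<integral>\<^sup>+ b. emeasure M {\<omega> \<in> space M. h (traj n \<omega>) \<and> first_block (xs \<omega>) (es \<omega>) n b \<and> F b \<omega>} \<partial>count_space ?V)
    = (\<integral>\<^sup>+ b. (emeasure M {\<omega> \<in> space M. h (traj n \<omega>) \<and> stays (xs \<omega>) n} * c) * ennreal (path_weight [] b) \<partial>count_space ?V)"
    by (intro nn_integral_cong) (auto simp: eq 3 mult_ac)
  also have "\<dots> = emeasure M {\<omega> \<in> space M. h (traj n \<omega>) \<and> stays (xs \<omega>) n} * c * emeasure block_law S"
    unfolding emeasure_block_law by (rule nn_integral_cmult) simp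
  finally show ?thesis unfolding 1 2 by (simp only: mult_ac)
qed

lemma emeasure_ex_cyc':
  "emeasure M {\<omega> \<in> space M. h (traj n \<omega>) \<and> (\<exists>b\<in>S. first_block (xs \<omega>) (es \<omega>) n b)}
    = emeasure M {\<omega> \<in> space M. h (traj n \<omega>) \<and> stays (xs \<omega>) n} * emeasure block_law S"
  using emeasure_ex_first_block[where F = "\<lambda>_ _. True" and c = 1 and h = h and n = n and S = S] by simp

definition regen_prob :: "nat \<Rightarrow> real" where
  "regen_prob n = \<P>(\<omega> in M. fresh (xs \<omega>) 0 n \<and> stays (xs \<omega>) n)"

lemma ex_regen_prob_pos: "\<exists>n. 0 < regen_prob n"
proof (rule ccontr)
  assume "\<not> ?thesis"
  then have "regen_prob n = 0" for n
    by (auto simp: regen_prob_def not_less measure_le_0_iff)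
  then have "escape\<^sup>2 * a \<le> 0"
    using sum_prob_regen_ge[of 1] unfolding regen_prob_def by simp
  moreover have "0 < escape\<^sup>2 * a" using escape_pos a by simp
  ultimately show False by linarith
qed

text \<open>
  Conditionally on a regeneration at some time \<open>n\<close>, the weights are the probabilities of disjoint events.
\<close>

lemma emeasure_block_law_le_1: "emeasure block_law S \<le> 1"
proof -
  obtain n where n: "0 < regen_prob n" using ex_regen_prob_pos by blast
  let ?h = "\<lambda>l. fresh (\<lambda>k. fst (l ! k)) 0 n"
  let ?p = "emeasure M {\<omega> \<in> space M. ?h (traj n \<omega>) \<and> stays (xs \<omega>) n}"
  have p: "?p = ennreal (regen_prob n)"
    by (simp add: emeasure_eq_measure regen_prob_def fresh_traj)
  have "?p * emeasure block_law S = emeasure M {\<omega> \<in> space M. ?h (traj n \<omega>) \<and> (\<exists>b\<in>S. first_block (xs \<omega>) (es \<omega>) n b)}"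
    by (rule emeasure_ex_cyc'[symmetric])
  also have "\<dots> \<le> ?p"
    using first_block_imp_stays by (intro emeasure_mono) auto
  finally have "ennreal (regen_prob n) * emeasure block_law S \<le> ennreal (regen_prob n) * 1"
    by (simp add: p)
  then show ?thesis
    using n by (subst (asm) ennreal_mult_le_mult_iff) auto
qed

lemma finite_block_law: "finite_measure block_law"
  using emeasure_block_law_le_1[of UNIV] by (intro finite_measureI) (auto simp: top_unique)

lemma emeasure_block_law_eq: "emeasure block_law S = ennreal (measure block_law S)"
  using finite_measure.emeasure_eq_measure[OF finite_block_law] .

lemma prob_ex_first_block:
  "\<P>(\<omega> in M. h (traj n \<omega>) \<and> (\<exists>b\<in>S. first_block (xs \<omega>) (es \<omega>) n b))
    = \<P>(\<omega> in M. h (traj n \<omega>) \<and> stays (xs \<omega>) n) * measure block_law S"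
  using emeasure_ex_cyc'[of h n S]
  by (simp add: emeasure_eq_measure emeasure_block_law_eq flip: ennreal_mult)

definition length_tail :: "nat \<Rightarrow> real" where
  "length_tail t = 1 - measure block_law {b. length b \<le> t}"

lemma length_tail_nonneg: "0 \<le> length_tail t"
  using emeasure_block_law_le_1[of "{b. length b \<le> t}"] by (simp add: length_tail_def emeasure_block_law_eq)

text \<open>
  The \<open>n\<close>-th summand is the probability that \<open>n\<close> is the last regeneration time up to \<open>N\<close>; these events
  are disjoint.
\<close>

lemma sum_regen_length_tail_le: "(\<Sum>n\<le>N. regen_prob n * length_tail (N - n)) \<le> 1"
proof -
  define B where "B n = {\<omega> \<in> space M. fresh (xs \<omega>) 0 n \<and> stays (xs \<omega>) n \<and>
      \<not> (\<exists>b\<in>{b. length b \<le> N - n}. first_block (xs \<omega>) (es \<omega>) n b)}" for n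
  have B_meas [measurable]: "B n \<in> sets M" for n
    unfolding B_def by measurable
  have prob_B: "prob (B n) = regen_prob n * length_tail (N - n)" for n
  proof -
    let ?h = "\<lambda>l. fresh (\<lambda>k. fst (l ! k)) 0 n"
    let ?S = "{b. length b \<le> N - n}"
    have "B n = {\<omega> \<in> space M. fresh (xs \<omega>) 0 n \<and> stays (xs \<omega>) n}
        - {\<omega> \<in> space M. fresh (xs \<omega>) 0 n \<and> (\<exists>b\<in>?S. first_block (xs \<omega>) (es \<omega>) n b)}"
      by (auto simp: B_def)
    moreover have "{\<omega> \<in> space M. fresh (xs \<omega>) 0 n \<and> (\<exists>b\<in>?S. first_block (xs \<omega>) (es \<omega>) n b)}
        \<subseteq> {\<omega> \<in> space M. fresh (xs \<omega>) 0 n \<and> stays (xs \<omega>) n}"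
      using first_block_imp_stays by auto
    ultimately have "prob (B n) = regen_prob n - \<P>(\<omega> in M. fresh (xs \<omega>) 0 n \<and> (\<exists>b\<in>?S. first_block (xs \<omega>) (es \<omega>) n b))"
      unfolding regen_prob_def by (simp only:) (rule finite_measure_Diff, measurable)
    then show ?thesis
      using prob_ex_first_block[of ?h n ?S] by (simp add: fresh_traj length_tail_def regen_prob_def algebra_simps)
  qed
  have disj: "disjoint_family_on B {..N}"
  proof -
    have "False" if *: "\<omega> \<in> B m" "\<omega> \<in> B n" "m < n" "n \<le> N" for \<omega> m n
    proof -
      have "regen (xs \<omega>) m n" using * by (auto simp: B_def regen_def fresh_def)
      then obtain b where "first_block (xs \<omega>) (es \<omega>) m b" "m + length b \<le> n"
        using ex_first_block[of "xs \<omega>" m n "es \<omega>"] * X_in_W by (auto simp: B_def)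
      then show False using * by (auto simp: B_def)
    qed
    then show ?thesis
      unfolding disjoint_family_on_def by (metis atMost_iff disjoint_iff linorder_neqE_nat)
  qed
  have "(\<Sum>n\<le>N. regen_prob n * length_tail (N - n)) = prob (\<Union>n\<in>{..N}. B n)"
    unfolding prob_B[symmetric] using disj by (intro finite_measure_finite_Union[symmetric]) auto
  then show ?thesis by simp
qed

text \<open>
  Add up the renewal inequality \<open>sum_regen_length_tail_le\<close> over all horizons below \<open>4 * N\<close>. Every pair \<open>(n, t)\<close> with both entries
  below \<open>2 * N\<close> occurs in the result, so the product of the two partial sums is at most \<open>4 * N\<close>; as the
  regeneration probabilities sum to at least a multiple of \<open>N\<close>, the tails have a bounded sum.
\<close>

lemma sum_length_tail_le:
  assumes "N \<ge> 1"
  shows "(\<Sum>t<2 * N. length_tail t) \<le> 8 / (escape\<^sup>2 * a)"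
proof -
  define c where "c = escape\<^sup>2 * a / 2"
  have c: "c > 0" using escape_pos a by (simp add: c_def)
  have nn: "0 \<le> regen_prob n * length_tail t" for n t
    using length_tail_nonneg by (simp add: regen_prob_def)
  have "(c * real N) * (\<Sum>t<2 * N. length_tail t) \<le> (\<Sum>n<2 * N. regen_prob n) * (\<Sum>t<2 * N. length_tail t)"
    using sum_prob_regen_ge[of N] length_tail_nonneg
    by (intro mult_right_mono sum_nonneg) (auto simp: c_def regen_prob_def)
  also have "\<dots> = (\<Sum>(n, t)\<in>{..<2 * N} \<times> {..<2 * N}. regen_prob n * length_tail t)"
    by (simp add: sum_product sum.cartesian_product)
  also have "\<dots> \<le> (\<Sum>(n, t)\<in>{(n, t). n + t < 4 * N}. regen_prob n * length_tail t)"
  proof (rule sum_mono2)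
    show "finite {(n, t). n + t < 4 * N}"
      by (rule finite_subset[of _ "{..<4 * N} \<times> {..<4 * N}"]) auto
  qed (use nn in auto)
  also have "\<dots> = (\<Sum>m<4 * N. \<Sum>n\<le>m. regen_prob n * length_tail (m - n))"
    by (rule sum.triangle_reindex)
  also have "\<dots> \<le> (\<Sum>m<4 * N. 1)"
    by (intro sum_mono sum_regen_length_tail_le)
  finally have "c * (\<Sum>t<2 * N. length_tail t) * real N \<le> 4 * real N" by (simp add: mult_ac)
  then have "c * (\<Sum>t<2 * N. length_tail t) \<le> 4" using assms by simp
  then show ?thesis using c by (simp add: c_def field_simps)
qed

lemma summable_length_tail: "summable length_tail"
proof (rule bounded_imp_summable)
  show "(\<Sum>t\<le>n. length_tail t) \<le> 8 / (escape\<^sup>2 * a)" for n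
  proof -
    have "(\<Sum>t\<le>n. length_tail t) \<le> (\<Sum>t<2 * Suc n. length_tail t)"
      using length_tail_nonneg by (intro sum_mono2) auto
    then show ?thesis using sum_length_tail_le[of "Suc n"] by simp
  qed
qed (rule length_tail_nonneg)

lemma emeasure_block_law_UNIV: "emeasure block_law UNIV = 1"
proof (rule antisym[OF emeasure_block_law_le_1])
  have "measure block_law {b. length b \<le> t} \<le> measure block_law UNIV" for t
    by (intro finite_measure.finite_measure_mono finite_block_law) auto
  then have "1 - length_tail t \<le> measure block_law UNIV" for t by (simp add: length_tail_def)
  moreover have "(\<lambda>t. 1 - length_tail t) \<longlonglongrightarrow> 1 - 0"
    by (intro tendsto_intros summable_LIMSEQ_zero summable_length_tail)
  ultimately have "1 \<le> measure block_law UNIV"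
    by (intro LIMSEQ_le_const2[of "\<lambda>t. 1 - length_tail t"]) auto
  then show "1 \<le> emeasure block_law UNIV" by (simp add: emeasure_block_law_eq)
qed

sublocale block: prob_space block_law
  by (rule prob_spaceI) (simp add: emeasure_block_law_UNIV)

lemma integrable_length: "integrable block_law (\<lambda>b. real (length b))"
proof (rule integrableI_nonneg)
  have "(\<integral>\<^sup>+ b. ennreal (real (length b)) \<partial>block_law) = (\<Sum>t. emeasure block_law {b \<in> space block_law. t < length b})"
    by (subst nn_integral_nat_function[symmetric]) (auto simp: ennreal_of_nat_eq_real_of_nat measurable_def)
  also have "\<dots> = (\<Sum>t. ennreal (length_tail t))"
  proof (intro suminf_cong)
    fix t
    have "{b \<in> space block_law. t < length b} = space block_law - {b. length b \<le> t}" by auto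
    then show "emeasure block_law {b \<in> space block_law. t < length b} = ennreal (length_tail t)"
      by (simp add: emeasure_block_law_eq length_tail_def block.prob_compl flip: space_block_law)
  qed
  also have "\<dots> < \<infinity>"
    using suminf_ennreal2[OF length_tail_nonneg summable_length_tail] by simp
  finally show "(\<integral>\<^sup>+ b. ennreal (real (length b)) \<partial>block_law) < \<infinity>" .
qed (auto simp: measurable_def)

lemma AE_stays_imp_first_block: "AE \<omega> in M. \<forall>m. stays (xs \<omega>) m \<longrightarrow> (\<exists>b. first_block (xs \<omega>) (es \<omega>) m b)"
  unfolding AE_all_countable
proof
  fix m
  let ?C = "{\<omega> \<in> space M. \<exists>b. first_block (xs \<omega>) (es \<omega>) m b}"
  have "emeasure M ({\<omega> \<in> space M. stays (xs \<omega>) m} - ?C) = emeasure M {\<omega> \<in> space M. stays (xs \<omega>) m} - emeasure M ?C"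
    using first_block_imp_stays by (intro emeasure_Diff) auto
  also have "emeasure M ?C = emeasure M {\<omega> \<in> space M. stays (xs \<omega>) m}"
    using emeasure_ex_cyc'[of "\<lambda>_. True" m UNIV] by (simp add: emeasure_block_law_UNIV)
  finally have "emeasure M ({\<omega> \<in> space M. stays (xs \<omega>) m} - ?C) = 0" by (simp add: emeasure_eq_measure)
  then have "AE \<omega> in M. \<omega> \<notin> {\<omega> \<in> space M. stays (xs \<omega>) m} - ?C"
    by (intro AE_not_in) (auto simp: null_sets_def)
  then show "AE \<omega> in M. stays (xs \<omega>) m \<longrightarrow> (\<exists>b. first_block (xs \<omega>) (es \<omega>) m b)"
    using AE_space by eventually_elim auto
qed

end

text \<open>
  If \<open>N n\<close> is the number of the last regeneration up to time \<open>n\<close>, then both \<open>n\<close> and \<open>T n\<close> are sandwiched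
  between quantities at the regenerations \<open>N n\<close> and \<open>N n + 1\<close>; divide by \<open>N n\<close>.
\<close>

lemma regenerative_limit:
  fixes r S T :: "nat \<Rightarrow> nat" and A :: nat
  assumes r: "strict_mono r" and \<mu>: "0 < \<mu>"
    and r_lim: "(\<lambda>K. real (r K) / real K) \<longlonglongrightarrow> \<mu>"
    and S_lim: "(\<lambda>K. real (S K) / real K) \<longlonglongrightarrow> \<nu>"
    and T: "\<And>K n. r K \<le> n \<Longrightarrow> A + S K \<le> T n \<and> T n \<le> A + S K + (n - r K)"
  shows "(\<lambda>n. real (T n) / real n) \<longlonglongrightarrow> \<nu> / \<mu>"
proof -
  define N where "N n = (GREATEST K. r K \<le> n)" for n
  have bd: "K \<le> n" if "r K \<le> n" for K n
    using strict_mono_imp_increasing[OF r, of K] that by simp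
  have N: "r (N n) \<le> n \<and> n < r (Suc (N n))" if n: "r 0 \<le> n" for n
  proof
    show "r (N n) \<le> n" unfolding N_def using n bd by (rule GreatestI_nat)
    show "n < r (Suc (N n))"
      using Greatest_le_nat[of "\<lambda>K. r K \<le> n" "Suc (N n)" n] bd unfolding N_def by (meson Suc_n_not_le_n not_le)
  qed
  have N_top: "filterlim N at_top sequentially"
    unfolding filterlim_at_top
  proof
    fix Z
    show "eventually (\<lambda>n. Z \<le> N n) sequentially"
      using eventually_ge_at_top[of "r Z"]
    proof eventually_elim
      case (elim n)
      then show ?case unfolding N_def using bd by (intro Greatest_le_nat[of "\<lambda>K. r K \<le> n" Z n]) auto
    qed
  qed
  have Suc_lim: "(\<lambda>K. real (r (Suc K)) / real K) \<longlonglongrightarrow> \<mu>"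
  proof -
    have "(\<lambda>K. (real (r (Suc K)) / real (Suc K)) * (1 + 1 / real K)) \<longlonglongrightarrow> \<mu> * (1 + 0)"
      by (intro tendsto_intros LIMSEQ_Suc[OF r_lim] lim_1_over_n)
    moreover have "eventually (\<lambda>K. (real (r (Suc K)) / real (Suc K)) * (1 + 1 / real K) = real (r (Suc K)) / real K) sequentially"
      using eventually_gt_at_top[of 0]
    proof eventually_elim
      case (elim K)
      then have "1 + 1 / real K = real (Suc K) / real K" by (simp add: field_simps)
      then show ?case by simp
    qed
    ultimately show ?thesis by (simp add: Lim_transform_eventually)
  qed
  have large: "eventually (\<lambda>n. 0 < N n \<and> r 0 \<le> n) sequentially"
    using filterlim_at_top[THEN iffD1, OF N_top, rule_format, of 1] eventually_ge_at_top[of "r 0"]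
    by eventually_elim auto
  have n_lim: "(\<lambda>n. real n / real (N n)) \<longlonglongrightarrow> \<mu>"
  proof (rule tendsto_sandwich)
    show "(\<lambda>n. real (r (N n)) / real (N n)) \<longlonglongrightarrow> \<mu>"
      by (rule filterlim_compose[OF r_lim N_top])
    show "(\<lambda>n. real (r (Suc (N n))) / real (N n)) \<longlonglongrightarrow> \<mu>"
      by (rule filterlim_compose[OF Suc_lim N_top])
    show "eventually (\<lambda>n. real (r (N n)) / real (N n) \<le> real n / real (N n)) sequentially"
      using large by eventually_elim (use N in \<open>simp add: divide_right_mono\<close>)
    show "eventually (\<lambda>n. real n / real (N n) \<le> real (r (Suc (N n))) / real (N n)) sequentially"
      using large by eventually_elim (use N in \<open>simp add: divide_right_mono less_imp_le\<close>)
  qed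
  have low: "(\<lambda>K. (real A + real (S K)) / real K) \<longlonglongrightarrow> \<nu>"
    using tendsto_add[OF lim_const_over_n[of "real A"] S_lim] by (simp add: add_divide_distrib)
  have up: "(\<lambda>K. (real A + real (S K)) / real K + (real (r (Suc K)) / real K - real (r K) / real K)) \<longlonglongrightarrow> \<nu> + (\<mu> - \<mu>)"
    by (intro tendsto_add tendsto_diff low Suc_lim r_lim)
  have T_lim: "(\<lambda>n. real (T n) / real (N n)) \<longlonglongrightarrow> \<nu>"
  proof (rule tendsto_sandwich)
    show "(\<lambda>n. (real A + real (S (N n))) / real (N n)) \<longlonglongrightarrow> \<nu>"
      by (rule filterlim_compose[OF low N_top])
    show "(\<lambda>n. (real A + real (S (N n))) / real (N n) + (real (r (Suc (N n))) / real (N n) - real (r (N n)) / real (N n))) \<longlonglongrightarrow> \<nu>"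
      using filterlim_compose[OF up N_top] by simp
    show "eventually (\<lambda>n. (real A + real (S (N n))) / real (N n) \<le> real (T n) / real (N n)) sequentially"
      using large
    proof eventually_elim
      case (elim n)
      then have "A + S (N n) \<le> T n" using N T by blast
      then show ?case by (intro divide_right_mono) linarith+
    qed
    show "eventually (\<lambda>n. real (T n) / real (N n) \<le> (real A + real (S (N n))) / real (N n) +
        (real (r (Suc (N n))) / real (N n) - real (r (N n)) / real (N n))) sequentially"
      using large
    proof eventually_elim
      case (elim n)
      then have "T n \<le> A + S (N n) + (n - r (N n))" "r (N n) \<le> n" "n < r (Suc (N n))" using N T by blast+
      then have "real (T n) \<le> real A + real (S (N n)) + (real (r (Suc (N n))) - real (r (N n)))" by linarith
      then have "real (T n) / real (N n) \<le> (real A + real (S (N n)) + (real (r (Suc (N n))) - real (r (N n)))) / real (N n)"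
        by (rule divide_right_mono) simp
      then show ?case by (simp add: add_divide_distrib diff_divide_distrib)
    qed
  qed
  have "(\<lambda>n. (real (T n) / real (N n)) / (real n / real (N n))) \<longlonglongrightarrow> \<nu> / \<mu>"
    using \<mu> by (intro tendsto_divide T_lim n_lim) simp
  moreover have "eventually (\<lambda>n. (real (T n) / real (N n)) / (real n / real (N n)) = real (T n) / real n) sequentially"
    using large by eventually_elim simp
  ultimately show ?thesis by (rule Lim_transform_eventually)
qed

lemma average_shift:
  fixes f :: "nat \<Rightarrow> nat"
  assumes "(\<lambda>n. (\<Sum>k<n. real (f k)) / real n) \<longlonglongrightarrow> c"
  shows "(\<lambda>n. real (B + (\<Sum>k<n. f (j + k))) / real n) \<longlonglongrightarrow> c"
proof -
  have "(\<lambda>n. ((\<Sum>k<n + j. real (f k)) / real (n + j)) * (1 + real j / real n) + (real B - (\<Sum>k<j. real (f k))) / real n)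
      \<longlonglongrightarrow> c * (1 + 0) + 0"
    by (intro tendsto_intros LIMSEQ_ignore_initial_segment[OF assms] lim_const_over_n)
  moreover have "eventually (\<lambda>n. ((\<Sum>k<n + j. real (f k)) / real (n + j)) * (1 + real j / real n) + (real B - (\<Sum>k<j. real (f k))) / real n
      = real (B + (\<Sum>k<n. f (j + k))) / real n) sequentially"
    using eventually_gt_at_top[of 0]
  proof eventually_elim
    case (elim n)
    have "(\<Sum>k<n + j. real (f k)) = (\<Sum>k<j. real (f k)) + (\<Sum>k<n. real (f (j + k)))"
      by (induction n) (auto simp: add.commute)
    moreover have "(\<Sum>k<n + j. real (f k)) / real (n + j) * (1 + real j / real n) = (\<Sum>k<n + j. real (f k)) / real n"
    proof -
      have "1 + real j / real n = real (n + j) / real n" using elim by (simp add: field_simps)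
      then show ?thesis using elim by simp
    qed
    ultimately show ?case by (simp add: add_divide_distrib diff_divide_distrib)
  qed
  ultimately show ?thesis by (simp add: Lim_transform_eventually)
qed

context cone_graph begin

text \<open>
  The choice is meaningful at times at which the walk stays: there a next block exists almost surely
  and is unique.
\<close>

definition next_block :: "(nat \<Rightarrow> 'a list) \<Rightarrow> (nat \<Rightarrow> bool) \<Rightarrow> nat \<Rightarrow> ('a list \<times> bool) list" where
  "next_block x e m = (SOME b. first_block x e m b)"

primrec regen_time :: "(nat \<Rightarrow> 'a list) \<Rightarrow> (nat \<Rightarrow> bool) \<Rightarrow> nat \<Rightarrow> nat \<Rightarrow> nat" where
  "regen_time x e m 0 = m"
| "regen_time x e m (Suc k) = regen_time x e m k + length (next_block x e (regen_time x e m k))"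

abbreviation block_at :: "(nat \<Rightarrow> 'a list) \<Rightarrow> (nat \<Rightarrow> bool) \<Rightarrow> nat \<Rightarrow> nat \<Rightarrow> ('a list \<times> bool) list" where
  "block_at x e m k \<equiv> next_block x e (regen_time x e m k)"

lemma regen_time_shift: "regen_time x e m (Suc k) = regen_time x e (m + length (next_block x e m)) k"
  by (induction k) auto

lemma first_block_block_at:
  assumes m: "stays x m" and ex: "\<And>n. stays x n \<Longrightarrow> \<exists>b. first_block x e n b"
  shows "first_block x e (regen_time x e m k) (block_at x e m k)"
proof (induction k)
  case 0
  then show ?case using ex[OF m] by (simp add: next_block_def someI_ex)
next
  case (Suc k)
  then have "stays x (regen_time x e m (Suc k))" by (simp add: first_block_def)
  then show ?case unfolding next_block_def by (rule someI_ex[OF ex])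
qed

text \<open>
  The blocks starting at \<open>m\<close> are cut where the walk regenerates relative to \<open>m\<close>; before \<open>m\<close> it may have been in the
  same cones. But the words at the cuts grow in length, and only finitely many words are visited before \<open>m\<close>,
  so from some cut on the cones are new since time \<open>0\<close>.
\<close>

lemma eventually_regen_from_0:
  assumes m: "stays x m" and ex: "\<And>n. stays x n \<Longrightarrow> \<exists>b. first_block x e n b"
  shows "\<exists>j. \<forall>k\<ge>j. regen x 0 (regen_time x e m k)"
proof -
  let ?r = "regen_time x e m"
  note first_block = first_block_block_at[of x m e, OF m ex]
  have step: "regen x (?r k) (?r (Suc k))" for k
    using first_block_imp_regen(1)[OF first_block[of k]] by simp
  have regen: "regen x m (?r (Suc k))" for k
  proof (induction k)
    case 0 then show ?case using step[of 0] by simp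
  next
    case (Suc k)
    have "?r (Suc k) < ?r (Suc (Suc k))" using step[of "Suc k"] unfolding regen_def by blast
    then show ?case using regen_trans_iff[OF Suc.IH] step[of "Suc k"] by blast
  qed
  \<comment> \<open>Each block lengthens the word by at least one letter.\<close>
  have len: "k \<le> length (x (?r k))" for k
  proof (induction k)
    case (Suc k)
    have "?r k < ?r (Suc k)" using step[of k] unfolding regen_def by blast
    then have "strict_prefix (x (?r k)) (x (?r (Suc k)))"
      using first_block_imp_stays[OF first_block[of k]] unfolding stays_def by blast
    then have "length (x (?r k)) < length (x (?r (Suc k)))" by (rule prefix_length_less)
    then show ?case using Suc by simp
  qed simp
  define L where "L = Max (insert 0 ((\<lambda>k. length (x k)) ` {..<m}))"
  have L: "length (x k) \<le> L" if "k < m" for k unfolding L_def using that by (intro Max_ge) auto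
  have "regen x 0 (?r k)" if k: "k \<ge> Suc L" for k
  proof -
    obtain k' where k': "k = Suc k'" using k by (cases k) auto
    have "\<not> prefix (x (?r k)) (x i)" if "i < m" for i
      using L[OF that] len[of k] k by (auto dest: prefix_length_le)
    then show ?thesis
      using regen[of k'] unfolding k'[symmetric] regen_def fresh_def by (metis le_less_trans not_le zero_le)
  qed
  then show ?thesis by blast
qed

text \<open>
  The first \<open>k\<close> blocks after \<open>m\<close> lie in the prescribed sets. The recursion follows the block structure, so that
  the probability can be computed by splitting off the first block.
\<close>

primrec chain :: "(nat \<Rightarrow> 'a list) \<Rightarrow> (nat \<Rightarrow> bool) \<Rightarrow> nat \<Rightarrow> nat \<Rightarrow> (nat \<Rightarrow> ('a list \<times> bool) list set) \<Rightarrow> bool" where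
  "chain x e m 0 A \<longleftrightarrow> True"
| "chain x e m (Suc k) A \<longleftrightarrow> (\<exists>b\<in>A 0. first_block x e m b \<and> chain x e (m + length b) k (\<lambda>j. A (Suc j)))"

lemma chain_iff:
  assumes m: "stays x m" and ex: "\<And>n. stays x n \<Longrightarrow> \<exists>b. first_block x e n b"
  shows "chain x e m k A \<longleftrightarrow> (\<forall>j<k. block_at x e m j \<in> A j)"
  using m
proof (induction k arbitrary: m A)
  case (Suc k)
  let ?b = "next_block x e m"
  have b: "first_block x e m ?b" using first_block_block_at[OF Suc.prems ex, where k = 0] by simp
  then have st: "stays x (m + length ?b)" by (simp add: first_block_def)
  have "chain x e m (Suc k) A \<longleftrightarrow> ?b \<in> A 0 \<and> chain x e (m + length ?b) k (\<lambda>j. A (Suc j))"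
  proof
    assume "chain x e m (Suc k) A"
    then obtain b where "b \<in> A 0" "first_block x e m b" "chain x e (m + length b) k (\<lambda>j. A (Suc j))" by auto
    then show "?b \<in> A 0 \<and> chain x e (m + length ?b) k (\<lambda>j. A (Suc j))" using first_block_unique[OF b] by simp
  next
    assume "?b \<in> A 0 \<and> chain x e (m + length ?b) k (\<lambda>j. A (Suc j))"
    then show "chain x e m (Suc k) A" unfolding chain.simps using b by (intro bexI[of _ ?b]) auto
  qed
  also have "\<dots> \<longleftrightarrow> ?b \<in> A 0 \<and> (\<forall>j<k. block_at x e m (Suc j) \<in> A (Suc j))"
    using Suc.IH[OF st] unfolding regen_time_shift by simp
  also have "\<dots> \<longleftrightarrow> (\<forall>j<Suc k. block_at x e m j \<in> A j)"
    by (auto simp: less_Suc_eq_0_disj simp del: regen_time.simps(2))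
  finally show ?case .
qed simp

end

context escaping_walk begin

subsection \<open>The walk finally stays in some cone\<close>

text \<open>
  Try to find a time from which the walk stays: if the present word ends in \<open>I\<close>, the attempt succeeds at once with
  probability \<open>escape\<close>; otherwise the walk first appends a letter of type \<open>I\<close>, with probability at least
  \<open>a\<close>. A failure is noticed at a finite time, and the induction hypothesis applies from there.
\<close>

lemma prob_no_stays_le:
  "\<P>(\<omega> in M. h (traj n \<omega>) \<and> (\<forall>m\<ge>n. \<not> stays (xs \<omega>) m)) \<le> (1 - escape * a) ^ k * \<P>(\<omega> in M. h (traj n \<omega>))"
proof (induction k arbitrary: n h)
  case 0
  show ?case by (simp add: finite_measure_mono Collect_mono_iff)
next
  case (Suc k)
  define r where "r = (1 - escape * a) ^ k"
  have ka: "0 \<le> escape * a" "escape * a \<le> escape" "escape \<le> 1"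
    using escape_nonneg escape_le_1 a by (auto simp: mult_left_le)
  then have r: "0 \<le> r" by (simp add: r_def)
  define N where "N n \<omega> \<longleftrightarrow> (\<forall>m\<ge>n. \<not> stays (xs \<omega>) m)" for n \<omega>
  have N_meas [measurable]: "Measurable.pred M (N n)" for n unfolding N_def by measurable
  have IH: "\<P>(\<omega> in M. h (traj n \<omega>) \<and> N n \<omega>) \<le> r * \<P>(\<omega> in M. h (traj n \<omega>))" for h n
    using Suc.IH unfolding r_def N_def .
  have mono: "N n \<omega> \<Longrightarrow> n \<le> n' \<Longrightarrow> N n' \<omega>" for n n' \<omega> by (auto simp: N_def)
  define P where "P Q = \<P>(\<omega> in M. Q \<omega>)" for Q
  have A: "P (\<lambda>\<omega>. (h (traj n \<omega>) \<and> ends_I (X n \<omega>)) \<and> N n \<omega>) \<le> r * (1 - escape) * P (\<lambda>\<omega>. h (traj n \<omega>) \<and> ends_I (X n \<omega>))" for h n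
  proof -
    let ?H = "\<lambda>\<omega>. h (traj n \<omega>) \<and> ends_I (X n \<omega>)"
    \<comment> \<open>The attempt made at time \<open>n\<close> fails at time \<open>n + Suc t\<close>.\<close>
    define F where "F t \<omega> \<longleftrightarrow> (\<forall>k\<in>{1..t}. strict_prefix (X n \<omega>) (X (n + k) \<omega>)) \<and> \<not> strict_prefix (X n \<omega>) (X (n + Suc t) \<omega>)" for t \<omega>
    have F_meas [measurable]: "Measurable.pred M (F t)" for t unfolding F_def by measurable
    have Fdisj: "F s \<omega> \<Longrightarrow> F t \<omega> \<Longrightarrow> s = t" for s t \<omega>
      unfolding F_def by (metis Suc_leI atLeastAtMost_iff le_add1 linorder_neqE_nat plus_1_eq_Suc)
    have F_ex: "ends_I (X n \<omega>) \<Longrightarrow> \<not> stays (xs \<omega>) n \<longleftrightarrow> (\<exists>t. F t \<omega>)" for \<omega>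
    proof -
      assume ends_I: "ends_I (X n \<omega>)"
      show ?thesis
      proof
        assume "\<not> stays (xs \<omega>) n"
        then have "\<exists>t. \<not> strict_prefix (X n \<omega>) (X (n + Suc t) \<omega>)"
          using ends_I unfolding stays_def by (metis add_Suc_right less_imp_Suc_add)
        then obtain t where t: "\<not> strict_prefix (X n \<omega>) (X (n + Suc t) \<omega>)"
          "\<And>s. s < t \<Longrightarrow> strict_prefix (X n \<omega>) (X (n + Suc s) \<omega>)"
          using exists_least_iff[of "\<lambda>t. \<not> strict_prefix (X n \<omega>) (X (n + Suc t) \<omega>)"] by blast
        have "F t \<omega>"
          unfolding F_def
        proof (intro conjI ballI t(1))
          fix k assume "k \<in> {1..t}"
          then have "k - 1 < t" "Suc (k - 1) = k" by auto
          then show "strict_prefix (X n \<omega>) (X (n + k) \<omega>)" using t(2)[of "k - 1"] by simp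
        qed
        then show "\<exists>t. F t \<omega>" ..
      next
        assume "\<exists>t. F t \<omega>"
        then obtain t where t: "\<not> strict_prefix (X n \<omega>) (X (n + Suc t) \<omega>)" unfolding F_def by blast
        have "n < n + Suc t" by simp
        with t show "\<not> stays (xs \<omega>) n" unfolding stays_def by blast
      qed
    qed
    have s1: "(\<lambda>t. P (\<lambda>\<omega>. ?H \<omega> \<and> F t \<omega>)) sums P (\<lambda>\<omega>. ?H \<omega> \<and> \<not> stays (xs \<omega>) n)"
    proof -
      have "(\<lambda>t. \<P>(\<omega> in M. ?H \<omega> \<and> F t \<omega>)) sums prob (\<Union>t. {\<omega> \<in> space M. ?H \<omega> \<and> F t \<omega>})"
        using Fdisj by (intro finite_measure_UNION) (auto simp: disjoint_family_on_def)
      also have "(\<Union>t. {\<omega> \<in> space M. ?H \<omega> \<and> F t \<omega>}) = {\<omega> \<in> space M. ?H \<omega> \<and> \<not> stays (xs \<omega>) n}"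
        using F_ex by auto
      finally show ?thesis by (simp add: P_def)
    qed
    have s2: "(\<lambda>t. P (\<lambda>\<omega>. (?H \<omega> \<and> F t \<omega>) \<and> N n \<omega>)) sums P (\<lambda>\<omega>. ?H \<omega> \<and> N n \<omega>)"
    proof -
      have "(\<lambda>t. \<P>(\<omega> in M. (?H \<omega> \<and> F t \<omega>) \<and> N n \<omega>)) sums prob (\<Union>t. {\<omega> \<in> space M. (?H \<omega> \<and> F t \<omega>) \<and> N n \<omega>})"
        using Fdisj by (intro finite_measure_UNION) (auto simp: disjoint_family_on_def)
      also have "(\<Union>t. {\<omega> \<in> space M. (?H \<omega> \<and> F t \<omega>) \<and> N n \<omega>}) = {\<omega> \<in> space M. ?H \<omega> \<and> N n \<omega>}"
      proof -
        have "\<not> stays (xs \<omega>) n" if "N n \<omega>" for \<omega> using that by (simp add: N_def)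
        then show ?thesis using F_ex by blast
      qed
      finally show ?thesis by (simp add: P_def)
    qed
    have le: "P (\<lambda>\<omega>. (?H \<omega> \<and> F t \<omega>) \<and> N n \<omega>) \<le> r * P (\<lambda>\<omega>. ?H \<omega> \<and> F t \<omega>)" for t
    proof -
      let ?h = "\<lambda>l. h (take (Suc n) l) \<and> ends_I (fst (l ! n)) \<and>
        (\<forall>k\<in>{1..t}. strict_prefix (fst (l ! n)) (fst (l ! (n + k)))) \<and> \<not> strict_prefix (fst (l ! n)) (fst (l ! (n + Suc t)))"
      have h: "?h (traj (n + Suc t) \<omega>) \<longleftrightarrow> ?H \<omega> \<and> F t \<omega>" for \<omega>
      proof -
        have "take (Suc n) (traj (n + Suc t) \<omega>) = traj n \<omega>" unfolding traj_add[of n "Suc t"] by simp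
        then show ?thesis by (simp add: F_def nth_traj del: add_Suc_right)
      qed
      have "P (\<lambda>\<omega>. (?H \<omega> \<and> F t \<omega>) \<and> N n \<omega>) \<le> \<P>(\<omega> in M. ?h (traj (n + Suc t) \<omega>) \<and> N (n + Suc t) \<omega>)"
        unfolding h P_def using mono[of n] by (intro finite_measure_mono) auto
      also have "\<dots> \<le> r * \<P>(\<omega> in M. ?h (traj (n + Suc t) \<omega>))" by (rule IH)
      finally show ?thesis unfolding h P_def .
    qed
    have "P (\<lambda>\<omega>. ?H \<omega> \<and> N n \<omega>) \<le> r * P (\<lambda>\<omega>. ?H \<omega> \<and> \<not> stays (xs \<omega>) n)"
      using le s2 sums_mult[OF s1, of r] by (rule sums_le)
    also have "P (\<lambda>\<omega>. ?H \<omega> \<and> \<not> stays (xs \<omega>) n) = (1 - escape) * P ?H"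
    proof -
      have "{\<omega> \<in> space M. ?H \<omega> \<and> \<not> stays (xs \<omega>) n} = {\<omega> \<in> space M. ?H \<omega>} - {\<omega> \<in> space M. h (traj n \<omega>) \<and> stays (xs \<omega>) n}"
        by (auto simp: stays_def)
      moreover have "prob ({\<omega> \<in> space M. ?H \<omega>} - {\<omega> \<in> space M. h (traj n \<omega>) \<and> stays (xs \<omega>) n})
          = \<P>(\<omega> in M. ?H \<omega>) - \<P>(\<omega> in M. h (traj n \<omega>) \<and> stays (xs \<omega>) n)"
        by (intro finite_measure_Diff) (auto simp: stays_def)
      ultimately show ?thesis unfolding P_def prob_stays by (simp add: algebra_simps)
    qed
    finally show ?thesis by (simp add: mult.assoc)
  qed
  have B: "P (\<lambda>\<omega>. (h (traj n \<omega>) \<and> \<not> ends_I (X n \<omega>)) \<and> N n \<omega>) \<le> r * (1 - escape * a) * P (\<lambda>\<omega>. h (traj n \<omega>) \<and> \<not> ends_I (X n \<omega>))"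
  proof -
    let ?H = "\<lambda>\<omega>. h (traj n \<omega>) \<and> \<not> ends_I (X n \<omega>)"
    let ?T = "\<lambda>\<omega>. \<exists>v\<in>I. X (Suc n) \<omega> = X n \<omega> @ [v]"
    let ?h1 = "\<lambda>l. (h (take (Suc n) l) \<and> \<not> ends_I (fst (l ! n))) \<and> (\<exists>v\<in>I. fst (l ! Suc n) = fst (l ! n) @ [v])"
    let ?h2 = "\<lambda>l. (h (take (Suc n) l) \<and> \<not> ends_I (fst (l ! n))) \<and> \<not> (\<exists>v\<in>I. fst (l ! Suc n) = fst (l ! n) @ [v])"
    have tk: "take (Suc n) (traj (Suc n) \<omega>) = traj n \<omega>" for \<omega> by (simp add: traj_Suc_eq)
    have h1: "?h1 (traj (Suc n) \<omega>) \<longleftrightarrow> ?H \<omega> \<and> ?T \<omega>" and h2: "?h2 (traj (Suc n) \<omega>) \<longleftrightarrow> ?H \<omega> \<and> \<not> ?T \<omega>" for \<omega>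
      by (simp_all add: tk nth_traj)
    have split: "P Q = P (\<lambda>\<omega>. Q \<omega> \<and> R \<omega>) + P (\<lambda>\<omega>. Q \<omega> \<and> \<not> R \<omega>)"
      if [measurable]: "Measurable.pred M Q" "Measurable.pred M R" for Q R
    proof -
      have "{\<omega> \<in> space M. Q \<omega>} = {\<omega> \<in> space M. Q \<omega> \<and> R \<omega>} \<union> {\<omega> \<in> space M. Q \<omega> \<and> \<not> R \<omega>}" by auto
      then show ?thesis unfolding P_def by (simp only:) (rule finite_measure_Union; auto)
    qed
    have [measurable]: "Measurable.pred M ?T" by measurable
    have "P (\<lambda>\<omega>. (?H \<omega> \<and> ?T \<omega>) \<and> N n \<omega>) \<le> P (\<lambda>\<omega>. (?h1 (traj (Suc n) \<omega>) \<and> ends_I (X (Suc n) \<omega>)) \<and> N (Suc n) \<omega>)"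
      unfolding P_def h1 using mono[of n] append_I_imp_ends_I by (intro finite_measure_mono) auto
    also have "\<dots> \<le> r * (1 - escape) * P (\<lambda>\<omega>. ?H \<omega> \<and> ?T \<omega>)"
    proof -
      have "P (\<lambda>\<omega>. ?h1 (traj (Suc n) \<omega>) \<and> ends_I (X (Suc n) \<omega>)) \<le> P (\<lambda>\<omega>. ?H \<omega> \<and> ?T \<omega>)"
        unfolding P_def h1 by (intro finite_measure_mono) auto
      then have "r * (1 - escape) * P (\<lambda>\<omega>. ?h1 (traj (Suc n) \<omega>) \<and> ends_I (X (Suc n) \<omega>)) \<le> r * (1 - escape) * P (\<lambda>\<omega>. ?H \<omega> \<and> ?T \<omega>)"
        using r ka by (intro mult_left_mono) auto
      with A[of ?h1 "Suc n"] show ?thesis by (rule order.trans)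
    qed
    finally have 1: "P (\<lambda>\<omega>. (?H \<omega> \<and> ?T \<omega>) \<and> N n \<omega>) \<le> r * (1 - escape) * P (\<lambda>\<omega>. ?H \<omega> \<and> ?T \<omega>)" .
    have "P (\<lambda>\<omega>. (?H \<omega> \<and> \<not> ?T \<omega>) \<and> N n \<omega>) \<le> P (\<lambda>\<omega>. ?h2 (traj (Suc n) \<omega>) \<and> N (Suc n) \<omega>)"
      unfolding P_def h2 using mono[of n] by (intro finite_measure_mono) auto
    also have "\<dots> \<le> r * P (\<lambda>\<omega>. ?h2 (traj (Suc n) \<omega>))" unfolding P_def by (rule IH)
    finally have 2: "P (\<lambda>\<omega>. (?H \<omega> \<and> \<not> ?T \<omega>) \<and> N n \<omega>) \<le> r * P (\<lambda>\<omega>. ?H \<omega> \<and> \<not> ?T \<omega>)" unfolding h2 .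
    have 3: "P (\<lambda>\<omega>. ?H \<omega> \<and> N n \<omega>) = P (\<lambda>\<omega>. (?H \<omega> \<and> ?T \<omega>) \<and> N n \<omega>) + P (\<lambda>\<omega>. (?H \<omega> \<and> \<not> ?T \<omega>) \<and> N n \<omega>)"
      using split[of "\<lambda>\<omega>. ?H \<omega> \<and> N n \<omega>" ?T] by (simp add: conj_ac)
    have 4: "P ?H = P (\<lambda>\<omega>. ?H \<omega> \<and> ?T \<omega>) + P (\<lambda>\<omega>. ?H \<omega> \<and> \<not> ?T \<omega>)"
      by (rule split) auto
    have 5: "P ?H * a \<le> P (\<lambda>\<omega>. ?H \<omega> \<and> ?T \<omega>)"
      using prob_append_I_ge[of h n] by (simp add: P_def)
    have "P (\<lambda>\<omega>. ?H \<omega> \<and> N n \<omega>) \<le> r * P ?H - r * escape * P (\<lambda>\<omega>. ?H \<omega> \<and> ?T \<omega>)"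
      using 1 2 unfolding 3 4 by (simp add: algebra_simps)
    also have "\<dots> \<le> r * P ?H - r * escape * (P ?H * a)"
      using 5 r escape_nonneg by (intro diff_left_mono mult_left_mono) auto
    finally show ?thesis by (simp add: algebra_simps)
  qed
  have split: "P (\<lambda>\<omega>. h (traj n \<omega>) \<and> R \<omega>) = P (\<lambda>\<omega>. (h (traj n \<omega>) \<and> ends_I (X n \<omega>)) \<and> R \<omega>) + P (\<lambda>\<omega>. (h (traj n \<omega>) \<and> \<not> ends_I (X n \<omega>)) \<and> R \<omega>)"
    if [measurable]: "Measurable.pred M R" for R
  proof -
    have "{\<omega> \<in> space M. h (traj n \<omega>) \<and> R \<omega>} = {\<omega> \<in> space M. (h (traj n \<omega>) \<and> ends_I (X n \<omega>)) \<and> R \<omega>}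
        \<union> {\<omega> \<in> space M. (h (traj n \<omega>) \<and> \<not> ends_I (X n \<omega>)) \<and> R \<omega>}" by auto
    then show ?thesis unfolding P_def by (simp only:) (rule finite_measure_Union; auto)
  qed
  have "r * (1 - escape) * P (\<lambda>\<omega>. h (traj n \<omega>) \<and> ends_I (X n \<omega>)) \<le> r * (1 - escape * a) * P (\<lambda>\<omega>. h (traj n \<omega>) \<and> ends_I (X n \<omega>))"
    using r ka by (intro mult_right_mono mult_left_mono) (auto simp: P_def)
  then have "P (\<lambda>\<omega>. h (traj n \<omega>) \<and> N n \<omega>) \<le> r * (1 - escape * a) * P (\<lambda>\<omega>. h (traj n \<omega>))"
    using A[of h n] B split[of "N n"] split[of "\<lambda>_. True"] by (simp add: distrib_left)
  then show ?case unfolding P_def N_def r_def by (simp add: mult_ac)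
qed

lemma AE_ex_stays: "AE \<omega> in M. \<exists>m. stays (xs \<omega>) m"
proof -
  let ?p = "\<P>(\<omega> in M. \<forall>m. \<not> stays (xs \<omega>) m)"
  have "?p \<le> (1 - escape * a) ^ k" for k
    using prob_no_stays_le[of "\<lambda>_. True" 0 k] by (simp add: prob_space)
  moreover have "(\<lambda>k. (1 - escape * a) ^ k) \<longlonglongrightarrow> 0"
    using escape_pos escape_le_1 a by (intro LIMSEQ_power_zero) (auto simp: mult_le_one abs_less_iff intro: le_less_trans[of _ 1])
  ultimately have "?p \<le> 0" by (intro LIMSEQ_le_const) auto
  then have "AE \<omega> in M. \<omega> \<notin> {\<omega> \<in> space M. \<forall>m. \<not> stays (xs \<omega>) m}"
    by (intro AE_not_in) (auto simp: null_sets_def emeasure_eq_measure measure_le_0_iff)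
  then show ?thesis using AE_space by eventually_elim auto
qed

end

context escaping_walk begin

subsection \<open>Independence of the blocks\<close>

lemma pred_chain [measurable]: "Measurable.pred M (\<lambda>\<omega>. chain (xs \<omega>) (es \<omega>) m k A)"
proof (induction k arbitrary: m A)
  case (Suc k)
  note Suc.IH [measurable]
  have "(\<lambda>\<omega>. chain (xs \<omega>) (es \<omega>) m (Suc k) A)
    = (\<lambda>\<omega>. \<exists>b\<in>A 0 \<inter> states. first_block (xs \<omega>) (es \<omega>) m b \<and> chain (xs \<omega>) (es \<omega>) (m + length b) k (\<lambda>j. A (Suc j)))"
    using irreducible_block_in_states by (auto simp: first_block_def fun_eq_iff)
  moreover have "countable (A 0 \<inter> states)" by simp
  ultimately show ?case by simp
qed simp

text \<open>
  Induction over the number of blocks: the end of the first block is again a time at which the walk stays, and the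
  event that the first block is \<open>b\<close> belongs to the past of that time.
\<close>

lemma emeasure_chain:
  "emeasure M {\<omega> \<in> space M. h (traj m \<omega>) \<and> stays (xs \<omega>) m \<and> chain (xs \<omega>) (es \<omega>) m k A}
    = emeasure M {\<omega> \<in> space M. h (traj m \<omega>) \<and> stays (xs \<omega>) m} * (\<Prod>j<k. emeasure block_law (A j))"
proof (induction k arbitrary: m h A)
  case (Suc k)
  let ?c = "\<Prod>j<k. emeasure block_law (A (Suc j))"
  let ?F = "\<lambda>b \<omega>. chain (xs \<omega>) (es \<omega>) (m + length b) k (\<lambda>j. A (Suc j))"
  have 1: "{\<omega> \<in> space M. h (traj m \<omega>) \<and> stays (xs \<omega>) m \<and> chain (xs \<omega>) (es \<omega>) m (Suc k) A}
    = {\<omega> \<in> space M. h (traj m \<omega>) \<and> (\<exists>b\<in>A 0. first_block (xs \<omega>) (es \<omega>) m b \<and> ?F b \<omega>)}"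
    using first_block_imp_stays by auto
  have 2: "emeasure M {\<omega> \<in> space M. h (traj m \<omega>) \<and> (\<exists>b\<in>A 0. first_block (xs \<omega>) (es \<omega>) m b \<and> ?F b \<omega>)}
    = emeasure M {\<omega> \<in> space M. h (traj m \<omega>) \<and> stays (xs \<omega>) m} * emeasure block_law (A 0) * ?c"
  proof (rule emeasure_ex_first_block)
    fix b assume "irreducible_block b"
    note H = first_block_as_block_event[OF this, of h m]
    let ?H = "block_event h m b"
    have "{\<omega> \<in> space M. h (traj m \<omega>) \<and> first_block (xs \<omega>) (es \<omega>) m b \<and> ?F b \<omega>}
        = {\<omega> \<in> space M. ?H (traj (m + length b) \<omega>) \<and> stays (xs \<omega>) (m + length b) \<and> ?F b \<omega>}"
    proof (rule Collect_cong)
      fix \<omega>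
      show "(\<omega> \<in> space M \<and> h (traj m \<omega>) \<and> first_block (xs \<omega>) (es \<omega>) m b \<and> ?F b \<omega>)
        \<longleftrightarrow> (\<omega> \<in> space M \<and> ?H (traj (m + length b) \<omega>) \<and> stays (xs \<omega>) (m + length b) \<and> ?F b \<omega>)"
        using H[of \<omega>] by argo
    qed
    then show "emeasure M {\<omega> \<in> space M. h (traj m \<omega>) \<and> first_block (xs \<omega>) (es \<omega>) m b \<and> ?F b \<omega>}
        = emeasure M {\<omega> \<in> space M. h (traj m \<omega>) \<and> first_block (xs \<omega>) (es \<omega>) m b} * ?c"
      using Suc.IH[of ?H "m + length b"] unfolding H by simp
  qed measurable
  show ?case
    unfolding 1 2 prod.lessThan_Suc_shift by (simp only: mult.assoc)
qed simp

lemma next_block_measurable [measurable]: "(\<lambda>\<omega>. next_block (xs \<omega>) (es \<omega>) m) \<in> measurable M (count_space UNIV)"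
proof -
  \<comment> \<open>The value of \<open>next_block\<close> where no next block exists.\<close>
  define d :: "('a list \<times> bool) list" where "d = (SOME b. False)"
  have eq: "next_block (xs \<omega>) (es \<omega>) m = b \<longleftrightarrow>
    first_block (xs \<omega>) (es \<omega>) m b \<or> b = d \<and> \<not> (\<exists>b. first_block (xs \<omega>) (es \<omega>) m b)" for \<omega> b
  proof (cases "\<exists>b. first_block (xs \<omega>) (es \<omega>) m b")
    case True
    then have "first_block (xs \<omega>) (es \<omega>) m (next_block (xs \<omega>) (es \<omega>) m)" unfolding next_block_def by (rule someI_ex)
    then show ?thesis using True first_block_unique by blast
  next
    case False
    then have "first_block (xs \<omega>) (es \<omega>) m = (\<lambda>b. False)" by auto
    then show ?thesis unfolding next_block_def d_def by auto
  qed
  have "(\<lambda>\<omega>. next_block (xs \<omega>) (es \<omega>) m) \<in> measurable M (count_space (insert d states))"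
  proof (subst measurable_count_space_eq_countable)
    show "countable (insert d states)" by simp
    show "(\<lambda>\<omega>. next_block (xs \<omega>) (es \<omega>) m) \<in> space M \<rightarrow> insert d states \<and>
      (\<forall>b\<in>insert d states. (\<lambda>\<omega>. next_block (xs \<omega>) (es \<omega>) m) -` {b} \<inter> space M \<in> sets M)"
    proof (intro conjI ballI)
      show "(\<lambda>\<omega>. next_block (xs \<omega>) (es \<omega>) m) \<in> space M \<rightarrow> insert d states"
        using eq irreducible_block_in_states unfolding first_block_def by blast
      fix b
      have "(\<lambda>\<omega>. next_block (xs \<omega>) (es \<omega>) m) -` {b} \<inter> space M
        = {\<omega> \<in> space M. first_block (xs \<omega>) (es \<omega>) m b \<or> b = d \<and> \<not> (\<exists>b. first_block (xs \<omega>) (es \<omega>) m b)}"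
        by (simp add: vimage_def Int_def eq conj_commute)
      also have "\<dots> \<in> sets M" by measurable
      finally show "(\<lambda>\<omega>. next_block (xs \<omega>) (es \<omega>) m) -` {b} \<inter> space M \<in> sets M" .
    qed
  qed
  then show ?thesis by (rule measurable_compose) simp
qed

lemma regen_time_measurable [measurable]: "(\<lambda>\<omega>. regen_time (xs \<omega>) (es \<omega>) m k) \<in> measurable M (count_space UNIV)"
  and block_at_measurable [measurable]: "(\<lambda>\<omega>. block_at (xs \<omega>) (es \<omega>) m k) \<in> measurable M (count_space UNIV)"
proof -
  have step: "(\<lambda>\<omega>. block_at (xs \<omega>) (es \<omega>) m k) \<in> measurable M (count_space UNIV)"
    if "(\<lambda>\<omega>. regen_time (xs \<omega>) (es \<omega>) m k) \<in> measurable M (count_space UNIV)" for k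
    by (rule measurable_compose_countable[OF next_block_measurable that])
  show 1: "(\<lambda>\<omega>. regen_time (xs \<omega>) (es \<omega>) m k) \<in> measurable M (count_space UNIV)" for k
  proof (induction k)
    case (Suc k)
    note Suc.IH [measurable]
    have [measurable]: "(\<lambda>\<omega>. length (block_at (xs \<omega>) (es \<omega>) m k)) \<in> measurable M (count_space UNIV)"
      by (rule measurable_compose[OF step[OF Suc.IH]]) simp
    show ?case by simp
  qed simp
  show "(\<lambda>\<omega>. block_at (xs \<omega>) (es \<omega>) m k) \<in> measurable M (count_space UNIV)" by (rule step[OF 1])
qed

text \<open>
  The bounds on \<open>block_tour\<close> hold for blocks that occur in a walk, hence for almost all blocks, since blocks
  after a regeneration have the law \<open>block_law\<close>.
\<close>

lemma AE_block_tour: "AE b in block_law. 1 \<le> block_tour b \<and> block_tour b \<le> length b"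
proof -
  \<comment> \<open>The blocks that violate the bounds; they do not occur after a regeneration.\<close>
  let ?S = "{b. \<not> (1 \<le> block_tour b \<and> block_tour b \<le> length b)}"
  obtain n where n: "0 < regen_prob n" using ex_regen_prob_pos by blast
  have "AE \<omega> in M. \<not> (fresh (xs \<omega>) 0 n \<and> (\<exists>b\<in>?S. first_block (xs \<omega>) (es \<omega>) n b))"
    using AE_admissible AE_stays_imp_first_block
  proof eventually_elim
    case (elim \<omega>)
    show ?case
    proof
      assume *: "fresh (xs \<omega>) 0 n \<and> (\<exists>b\<in>?S. first_block (xs \<omega>) (es \<omega>) n b)"
      then obtain b where b: "b \<in> ?S" "first_block (xs \<omega>) (es \<omega>) n b" by blast
      have st: "stays (xs \<omega>) n" using first_block_imp_stays[OF b(2)] .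
      then have "X n \<omega> \<noteq> []" by (simp add: stays_def ends_I_def)
      then have "n \<noteq> 0" using elim by (cases n) auto
      then have reg0: "regen (xs \<omega>) 0 n" using * st by (auto simp: regen_def)
      have ex: "\<And>n. stays (xs \<omega>) n \<Longrightarrow> \<exists>b. first_block (xs \<omega>) (es \<omega>) n b" using elim by blast
      note first_block = first_block_block_at[of "xs \<omega>" n "es \<omega>", OF st ex]
      have regen: "regen (xs \<omega>) 0 (regen_time (xs \<omega>) (es \<omega>) n k)" for k
      proof (induction k)
        case (Suc k)
        have "regen (xs \<omega>) (regen_time (xs \<omega>) (es \<omega>) n k) (regen_time (xs \<omega>) (es \<omega>) n (Suc k))"
          using first_block_imp_regen(1)[OF first_block[of k]] by simp
        then show ?case using regen_trans_iff[OF Suc.IH] unfolding regen_def by blast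
      qed (simp add: reg0)
      have pos: "\<And>k. 0 < q (X k \<omega>) (X (Suc k) \<omega>)" and x0: "X 0 \<omega> = []" using elim by auto
      have "block_at (xs \<omega>) (es \<omega>) n 0 = b" using first_block_unique[OF first_block[of 0]] b(2) by simp
      then show False
        using tour_decomposition(2,3)[of "xs \<omega>" "regen_time (xs \<omega>) (es \<omega>) n" "es \<omega>" "block_at (xs \<omega>) (es \<omega>) n" 0,
            OF x0 pos regen first_block] b(1) by simp
    qed
  qed
  moreover have "{\<omega> \<in> space M. fresh (xs \<omega>) 0 n \<and> (\<exists>b\<in>?S. first_block (xs \<omega>) (es \<omega>) n b)} \<in> sets M"
    by measurable
  ultimately have "\<P>(\<omega> in M. fresh (xs \<omega>) 0 n \<and> (\<exists>b\<in>?S. first_block (xs \<omega>) (es \<omega>) n b)) = 0"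
    by (subst prob_eq_0) (auto elim!: AE_mp)
  moreover have "\<P>(\<omega> in M. fresh (xs \<omega>) 0 n \<and> (\<exists>b\<in>?S. first_block (xs \<omega>) (es \<omega>) n b)) = regen_prob n * measure block_law ?S"
    using prob_ex_first_block[of "\<lambda>l. fresh (\<lambda>k. fst (l ! k)) 0 n" n ?S] unfolding fresh_traj regen_prob_def .
  ultimately have "measure block_law ?S = 0" using n by simp
  then have "?S \<in> null_sets block_law" by (auto simp: null_sets_def emeasure_block_law_eq)
  then have "AE b in block_law. b \<notin> ?S" by (rule AE_not_in)
  then show ?thesis by eventually_elim auto
qed

definition mean_length :: real where "mean_length = (\<integral>b. real (length b) \<partial>block_law)"
definition mean_tour :: real where "mean_tour = (\<integral>b. real (block_tour b) \<partial>block_law)"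

lemma integrable_block_tour: "integrable block_law (\<lambda>b. real (block_tour b))"
proof (rule Bochner_Integration.integrable_bound[OF integrable_length])
  show "AE b in block_law. norm (real (block_tour b)) \<le> norm (real (length b))"
    using AE_block_tour by eventually_elim auto
qed (auto simp: measurable_def)

lemma mean_tour_pos: "0 < mean_tour" and mean_length_pos: "0 < mean_length"
proof -
  have "(\<integral>b. 1 \<partial>block_law) \<le> mean_tour"
    unfolding mean_tour_def using AE_block_tour
    by (intro integral_mono_AE integrable_block_tour) (auto elim!: AE_mp)
  then show "0 < mean_tour" using block.prob_space by simp
  moreover have "mean_tour \<le> mean_length"
    unfolding mean_tour_def mean_length_def using AE_block_tour
    by (intro integral_mono_AE integrable_block_tour integrable_length) (auto elim!: AE_mp)
  ultimately show "0 < mean_length" by simp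
qed

text \<open>
  Condition on the event \<open>S\<close> that the walk stays at time \<open>m\<close>. Under the conditional measure the blocks after \<open>m\<close> are
  independent with law \<open>block_law\<close>, by \<open>emeasure_chain\<close>.
\<close>

lemma AE_block_average:
  assumes g: "\<And>b. 0 \<le> g b" "integrable block_law g"
  shows "AE \<omega> in M. stays (xs \<omega>) m \<longrightarrow>
    (\<lambda>n. (\<Sum>k<n. g (block_at (xs \<omega>) (es \<omega>) m k)) / real n) \<longlonglongrightarrow> (\<integral>b. g b \<partial>block_law)"
proof (cases "\<P>(\<omega> in M. stays (xs \<omega>) m) = 0")
  case True
  then have "AE \<omega> in M. \<not> stays (xs \<omega>) m" by (subst (asm) prob_eq_0) (auto elim!: AE_mp)
  then show ?thesis by eventually_elim simp
next
  case False
  define S where "S = {\<omega> \<in> space M. stays (xs \<omega>) m}"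
  have S [measurable]: "S \<in> sets M" unfolding S_def by measurable
  have S_pos: "emeasure M S \<noteq> 0" using False by (simp add: S_def emeasure_eq_measure)
  define Q where "Q = uniform_measure M S"
  interpret Q: prob_space Q
    unfolding Q_def using S_pos by (intro prob_space_uniform_measure) (auto simp: emeasure_eq_measure)
  have [measurable_cong, simp]: "sets Q = sets M" by (simp add: Q_def)
  have space_Q [simp]: "space Q = space M" by (simp add: Q_def)
  define Y where "Y k \<omega> = block_at (xs \<omega>) (es \<omega>) m k" for k \<omega>
  have Y_meas: "Y k \<in> measurable Q (count_space UNIV)" for k
    unfolding Y_def by measurable
  have Y_ev [measurable]: "Measurable.pred M (\<lambda>\<omega>. Y k \<omega> \<in> B)" for k B
    unfolding Y_def by (rule measurable_compose[OF block_at_measurable]) simp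
  have box: "Q.prob {\<omega> \<in> space M. \<forall>j<k. Y j \<omega> \<in> A j} = (\<Prod>j<k. measure block_law (A j))" for k A
  proof -
    have "emeasure M (S \<inter> {\<omega> \<in> space M. \<forall>j<k. Y j \<omega> \<in> A j})
      = emeasure M {\<omega> \<in> space M. True \<and> stays (xs \<omega>) m \<and> chain (xs \<omega>) (es \<omega>) m k A}"
    proof (rule emeasure_eq_AE)
      show "AE \<omega> in M. \<omega> \<in> S \<inter> {\<omega> \<in> space M. \<forall>j<k. Y j \<omega> \<in> A j}
        \<longleftrightarrow> \<omega> \<in> {\<omega> \<in> space M. True \<and> stays (xs \<omega>) m \<and> chain (xs \<omega>) (es \<omega>) m k A}"
        using AE_stays_imp_first_block
      proof eventually_elim
        case (elim \<omega>)
        then show ?case using chain_iff[of "xs \<omega>" m "es \<omega>" k A] unfolding S_def Y_def by blast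
      qed
    next
      show "S \<inter> {\<omega> \<in> space M. \<forall>j<k. Y j \<omega> \<in> A j} \<in> sets M" by measurable
      show "{\<omega> \<in> space M. True \<and> stays (xs \<omega>) m \<and> chain (xs \<omega>) (es \<omega>) m k A} \<in> sets M" by measurable
    qed
    also have "\<dots> = emeasure M S * (\<Prod>j<k. emeasure block_law (A j))"
      using emeasure_chain[of "\<lambda>_. True" m k A] by (simp add: S_def)
    finally have "prob (S \<inter> {\<omega> \<in> space M. \<forall>j<k. Y j \<omega> \<in> A j}) = prob S * (\<Prod>j<k. measure block_law (A j))"
      by (simp add: emeasure_eq_measure emeasure_block_law_eq prod_ennreal prod_nonneg flip: ennreal_mult)
    then show ?thesis
      unfolding Q_def using S_pos by (subst measure_uniform_measure) (auto simp: emeasure_eq_measure)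
  qed
  have finite_box: "Q.prob {\<omega> \<in> space M. \<forall>j\<in>J. Y j \<omega> \<in> A j} = (\<Prod>j\<in>J. measure block_law (A j))"
    if J: "finite J" for J A
  proof -
    \<comment> \<open>Fill up the index set to an initial segment; the new coordinates are unrestricted.\<close>
    define k where "k = Suc (Max (insert 0 J))"
    have Jk: "J \<subseteq> {..<k}" using J by (auto simp: k_def less_Suc_eq_le)
    have "{\<omega> \<in> space M. \<forall>j\<in>J. Y j \<omega> \<in> A j} = {\<omega> \<in> space M. \<forall>j<k. Y j \<omega> \<in> (if j \<in> J then A j else UNIV)}"
      using Jk by auto
    then have "Q.prob {\<omega> \<in> space M. \<forall>j\<in>J. Y j \<omega> \<in> A j} = (\<Prod>j<k. measure block_law (if j \<in> J then A j else UNIV))"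
      by (simp only: box)
    also have "\<dots> = (\<Prod>j\<in>J. measure block_law (if j \<in> J then A j else UNIV))"
      using Jk block.prob_space by (intro prod.mono_neutral_right) auto
    finally show ?thesis by simp
  qed
  have single: "Q.prob (Y j -` B \<inter> space Q) = measure block_law B" for j B
    using finite_box[of "{j}" "\<lambda>_. B"] by (simp add: vimage_def Int_def conj_commute)
  have ind: "Q.indep_vars (\<lambda>_. count_space UNIV) Y UNIV"
    unfolding Q.indep_vars_def2
  proof (intro conjI ballI Q.indep_setsI)
    fix A J assume J: "J \<noteq> {}" "finite J"
      and A: "\<forall>j\<in>J. A j \<in> {Y j -` A \<inter> space Q |A. A \<in> sets (count_space UNIV)}"
    then obtain B where B: "\<And>j. j \<in> J \<Longrightarrow> A j = Y j -` B j \<inter> space Q" by simp metis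
    have "(\<Inter>j\<in>J. A j) = {\<omega> \<in> space M. \<forall>j\<in>J. Y j \<omega> \<in> B j}" using B J by auto
    then have "Q.prob (\<Inter>j\<in>J. A j) = (\<Prod>j\<in>J. measure block_law (B j))"
      using finite_box[OF J(2), of B] by simp
    also have "\<dots> = (\<Prod>j\<in>J. Q.prob (A j))"
      by (intro prod.cong refl) (simp only: B single)
    finally show "Q.prob (\<Inter>j\<in>J. A j) = (\<Prod>j\<in>J. Q.prob (A j))" .
  qed (use Y_meas in auto)
  have law: "distr Q (count_space UNIV) (Y k) = block_law" for k
  proof (rule measure_eqI)
    fix B assume "B \<in> sets (distr Q (count_space UNIV) (Y k))"
    show "emeasure (distr Q (count_space UNIV) (Y k)) B = emeasure block_law B"
      using Y_meas[of k] single[of k B] by (simp add: emeasure_distr Q.emeasure_eq_measure emeasure_block_law_eq)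
  qed simp
  have gY: "distr Q borel (\<lambda>\<omega>. g (Y k \<omega>)) = distr block_law borel g" for k
    using distr_distr[of g "count_space UNIV" borel "Y k" Q] Y_meas[of k] by (simp add: law comp_def)
  have "AE \<omega> in Q. (\<lambda>n. (\<Sum>k<n. g (Y k \<omega>)) / real n) \<longlonglongrightarrow> Q.expectation (\<lambda>\<omega>. g (Y 0 \<omega>))"
  proof (rule Q.strong_law_nonneg)
    show "Q.indep_vars (\<lambda>_. borel) (\<lambda>k \<omega>. g (Y k \<omega>)) UNIV"
      using Q.indep_vars_compose2[OF ind, of "\<lambda>_. g" "\<lambda>_. borel"] by simp
    show "distr Q borel (\<lambda>\<omega>. g (Y k \<omega>)) = distr Q borel (\<lambda>\<omega>. g (Y 0 \<omega>))" for k
      by (simp only: gY)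
    show "integrable Q (\<lambda>\<omega>. g (Y 0 \<omega>))"
      using g(2) integrable_distr_eq[OF Y_meas[of 0], of g] by (simp add: law)
  qed (rule g(1))
  also have "Q.expectation (\<lambda>\<omega>. g (Y 0 \<omega>)) = (\<integral>b. g b \<partial>block_law)"
    using integral_distr[OF Y_meas[of 0], of g] by (simp add: law)
  finally have "AE \<omega> in M. \<omega> \<in> S \<longrightarrow> (\<lambda>n. (\<Sum>k<n. g (Y k \<omega>)) / real n) \<longlonglongrightarrow> (\<integral>b. g b \<partial>block_law)"
    unfolding Q_def using S_pos by (subst (asm) AE_uniform_measure) (auto simp: emeasure_eq_measure)
  then show ?thesis
    using AE_space by eventually_elim (auto simp: S_def Y_def)
qed

text \<open>
  Almost surely the walk stays from some time \<open>m\<close> on. Counting from a late enough block after \<open>m\<close>, the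
  tour length is given by \<open>tour_decomposition\<close>, and the strong law applies both to the lengths of the blocks and to
  their tours.
\<close>

theorem tour_speed:
  "AE \<omega> in M. (\<lambda>n. real (tour [] [] (X n \<omega>) (lit (xs \<omega>) (es \<omega>) n)) / real n) \<longlonglongrightarrow> mean_tour / mean_length"
proof -
  have "AE \<omega> in M. \<forall>m. stays (xs \<omega>) m \<longrightarrow>
    (\<lambda>n. (\<Sum>k<n. real (length (block_at (xs \<omega>) (es \<omega>) m k))) / real n) \<longlonglongrightarrow> mean_length"
    unfolding AE_all_countable mean_length_def using integrable_length by (intro allI AE_block_average) auto
  moreover have "AE \<omega> in M. \<forall>m. stays (xs \<omega>) m \<longrightarrow>
    (\<lambda>n. (\<Sum>k<n. real (block_tour (block_at (xs \<omega>) (es \<omega>) m k))) / real n) \<longlonglongrightarrow> mean_tour"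
    unfolding AE_all_countable mean_tour_def using integrable_block_tour by (intro allI AE_block_average) auto
  ultimately show ?thesis
    using AE_ex_stays AE_stays_imp_first_block AE_admissible
  proof eventually_elim
    case (elim \<omega>)
    let ?x = "xs \<omega>" and ?e = "es \<omega>"
    obtain m where m: "stays ?x m" using elim by blast
    have ex: "\<And>n. stays ?x n \<Longrightarrow> \<exists>b. first_block ?x ?e n b" using elim by blast
    obtain j where j: "\<And>k. k \<ge> j \<Longrightarrow> regen ?x 0 (regen_time ?x ?e m k)"
      using eventually_regen_from_0[OF m ex] by blast
    define r where "r k = regen_time ?x ?e m (j + k)" for k
    define b where "b k = block_at ?x ?e m (j + k)" for k
    have regen: "regen ?x 0 (r k)" for k using j by (simp add: r_def)
    have first_block: "first_block ?x ?e (r k) (b k)" for k unfolding r_def b_def by (rule first_block_block_at[OF m ex])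
    have r_Suc: "r (Suc k) = r k + length (b k)" for k by (simp add: r_def b_def)
    have r_sum: "r k = r 0 + (\<Sum>i<k. length (b i))" for k by (induction k) (auto simp: r_Suc)
    have "strict_mono r"
      using first_block by (intro strict_monoI_Suc) (auto simp: r_Suc first_block_def irreducible_block_def)
    have x0: "X 0 \<omega> = []" and pos: "\<And>k. 0 < q (X k \<omega>) (X (Suc k) \<omega>)" using elim by auto
    obtain A where A: "\<And>K n. r K \<le> n \<Longrightarrow>
        A + (\<Sum>k<K. block_tour (b k)) \<le> tour [] [] (X n \<omega>) (lit ?x ?e n) \<and>
        tour [] [] (X n \<omega>) (lit ?x ?e n) \<le> A + (\<Sum>k<K. block_tour (b k)) + (n - r K)"
      using tour_decomposition(1)[of ?x r ?e b, OF x0 pos regen first_block r_Suc] by blast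
    have "(\<lambda>K. real (r 0 + (\<Sum>k<K. length (b k))) / real K) \<longlonglongrightarrow> mean_length"
      unfolding b_def using average_shift[of "\<lambda>k. length (block_at ?x ?e m k)"] elim m by blast
    then have r_lim: "(\<lambda>K. real (r K) / real K) \<longlonglongrightarrow> mean_length" by (simp flip: r_sum)
    have "(\<lambda>K. real (0 + (\<Sum>k<K. block_tour (b k))) / real K) \<longlonglongrightarrow> mean_tour"
      unfolding b_def using average_shift[of "\<lambda>k. block_tour (block_at ?x ?e m k)"] elim m by blast
    then have S_lim: "(\<lambda>K. real (\<Sum>k<K. block_tour (b k)) / real K) \<longlonglongrightarrow> mean_tour" by simp
    show ?case
      by (rule regenerative_limit[OF \<open>strict_mono r\<close> mean_length_pos r_lim S_lim A])
  qed
qed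

end

section \<open>The free product\<close>

locale free_product_walk =
  fixes V :: "nat \<Rightarrow> 'a set" and rt :: "nat \<Rightarrow> 'a" and p :: "nat \<Rightarrow> 'a \<Rightarrow> 'a \<Rightarrow> real" and \<alpha> :: real
  assumes V_disjoint: "V 1 \<inter> V 2 = {}"
    and V_countable: "\<forall>i\<in>{1, 2}. countable (V i)"
    and rt_in_V: "\<forall>i\<in>{1, 2}. rt i \<in> V i"
    and p_stochastic: "\<forall>i\<in>{1, 2}. transition_matrix_on (V i) (p i)"
    and p_diagonal: "\<forall>i\<in>{1, 2}. \<forall>x\<in>V i. p i x x = 0"
    and \<alpha>: "0 < \<alpha>" "\<alpha> < 1"
begin

abbreviation FP :: "'a list set" where "FP \<equiv> free_product V rt"
abbreviation letters :: "nat \<Rightarrow> 'a set" where "letters \<equiv> nonroot V rt"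
abbreviation lift :: "nat \<Rightarrow> 'a list \<Rightarrow> 'a list \<Rightarrow> real" where "lift \<equiv> lift_matrix V rt p"
abbreviation Q :: "'a list \<Rightarrow> 'a list \<Rightarrow> real" where "Q \<equiv> walk_matrix V rt p \<alpha>"

definition coin :: "nat \<Rightarrow> real" where "coin i = (if i = 1 then \<alpha> else 1 - \<alpha>)"

lemma coin: "0 < coin i" "coin i \<le> 1"
  using \<alpha> by (auto simp: coin_def)

lemma letters_disjoint: "letters 1 \<inter> letters 2 = {}"
  using V_disjoint by (auto simp: nonroot_def)

lemma FP_append_iff:
  "u @ v \<in> FP \<longleftrightarrow> u \<in> FP \<and> v \<in> FP \<and>
    (u = [] \<or> v = [] \<or> \<not> (\<exists>i\<in>{1, 2}. last u \<in> letters i \<and> hd v \<in> letters i))"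
  by (auto simp: free_product_def successively_append_iff)

lemma Nil_in_FP: "[] \<in> FP" by (simp add: free_product_def)

lemma singleton_in_FP: "[v] \<in> FP \<longleftrightarrow> v \<in> letters 1 \<union> letters 2"
  by (simp add: free_product_def)

lemma letters_FP: "x \<in> FP \<Longrightarrow> set x \<subseteq> letters 1 \<union> letters 2"
  by (simp add: free_product_def)

lemma append_embed_in_FP:
  assumes "u \<in> FP" "\<not> has_type V rt u i" "v \<in> V i" "i \<in> {1, 2}"
  shows "u @ embed rt i v \<in> FP"
proof (cases "v = rt i")
  case False
  then have v: "v \<in> letters i" using assms by (simp add: nonroot_def)
  have "\<not> (last u \<in> letters k \<and> v \<in> letters k)" if "u \<noteq> []" "k \<in> {1, 2}" for k
    using that v assms(2,4) letters_disjoint by (auto simp: has_type_def)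
  then show ?thesis
    using False assms v by (auto simp: FP_append_iff singleton_in_FP embed_def)
qed (use assms in \<open>simp add: embed_def\<close>)

lemma lift_decompD:
  assumes "lift_decomp V rt i x y u v w"
  shows "lift i x y = p i v w"
  using assms lift_matrix_eq[of u V rt i v w p] by (auto simp: lift_decomp_def)

lemma lift_eq_0: "\<not> (\<exists>u v w. lift_decomp V rt i x y u v w) \<Longrightarrow> lift i x y = 0"
  by (simp add: lift_matrix_def)

lemma lift_nonneg: "i \<in> {1, 2} \<Longrightarrow> 0 \<le> lift i x y"
proof (cases "\<exists>u v w. lift_decomp V rt i x y u v w")
  case True
  assume i: "i \<in> {1, 2}"
  obtain u v w where d: "lift_decomp V rt i x y u v w" using True by blast
  then show ?thesis
    using lift_decompD[OF d] p_stochastic i by (auto simp: lift_decomp_def transition_matrix_on_def)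
qed (simp add: lift_eq_0)

lemma Q_nonneg: "0 \<le> Q x y"
  unfolding walk_matrix_def using lift_nonneg[of 1 x y] lift_nonneg[of 2 x y] \<alpha> by simp

lemma lift_diagonal: "i \<in> {1, 2} \<Longrightarrow> lift i x x = 0"
proof (cases "\<exists>u v w. lift_decomp V rt i x x u v w")
  case True
  assume i: "i \<in> {1, 2}"
  obtain u v w where d: "lift_decomp V rt i x x u v w" using True by blast
  then have "v = w" by (auto simp: lift_decomp_def embed_def split: if_splits)
  then show ?thesis using lift_decompD[OF d] p_diagonal i d by (auto simp: lift_decomp_def)
qed (simp add: lift_eq_0)

lemma embed_letters: "v \<in> V i \<Longrightarrow> set (embed rt i v) \<subseteq> letters i"
  by (auto simp: embed_def nonroot_def)

lemma length_embed: "length (embed rt i v) \<le> 1"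
  by (simp add: embed_def)

lemma Q_edge:
  assumes "0 < Q x y"
  shows "x \<in> FP \<and> y \<in> FP \<and> (\<exists>u s t. x = u @ s \<and> y = u @ t \<and> length s \<le> 1 \<and> length t \<le> 1 \<and>
    (set s \<union> set t \<subseteq> letters 1 \<or> set s \<union> set t \<subseteq> letters 2))"
proof -
  have "lift 1 x y \<noteq> 0 \<or> lift 2 x y \<noteq> 0" using assms by (auto simp: walk_matrix_def)
  then obtain i where i: "i \<in> {1, 2}" "lift i x y \<noteq> 0" by blast
  then obtain u v w where "lift_decomp V rt i x y u v w" using lift_eq_0 by blast
  then have d: "u \<in> FP" "\<not> has_type V rt u i" "v \<in> V i" "w \<in> V i" "x = u @ embed rt i v" "y = u @ embed rt i w"
    by (auto simp: lift_decomp_def)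
  have "set (embed rt i v) \<union> set (embed rt i w) \<subseteq> letters i"
    using embed_letters d by blast
  then show ?thesis
    using append_embed_in_FP[OF d(1,2) _ i(1)] d i(1) length_embed by blast
qed

context
  fixes i j :: nat
  assumes ij: "i \<in> {1, 2}" "j \<in> {1, 2}" "i \<noteq> j"
begin

lemma ij_disjoint: "letters i \<inter> letters j = {}"
  using ij letters_disjoint by auto

lemma FP_append_type_iff:
  assumes "w \<in> FP" "w \<noteq> []" "last w \<in> letters i" "x \<noteq> []"
  shows "w @ x \<in> FP \<longleftrightarrow> x \<in> FP \<and> hd x \<in> letters j"
proof -
  have "x \<in> FP \<Longrightarrow> hd x \<in> letters 1 \<union> letters 2" using letters_FP[of x] assms(4) hd_in_set by blast
  then show ?thesis using assms ij ij_disjoint by (auto simp: FP_append_iff)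
qed

text \<open>
  Translation carries decompositions of \<open>(x, y)\<close> to decompositions of \<open>(w @ x, w @ y)\<close>. Conversely a
  decomposition of the latter cannot cut into \<open>w\<close> unless \<open>x\<close> and \<open>y\<close> are both empty; equal words are treated
  separately, both sides being zero on the diagonal.
\<close>

lemma lift_translate:
  assumes w: "w \<in> FP" "w \<noteq> []" "last w \<in> letters i" and k: "k \<in> {1, 2}"
    and x: "x = [] \<or> x \<in> FP \<and> hd x \<in> letters j" and y: "y = [] \<or> y \<in> FP \<and> hd y \<in> letters j"
  shows "lift k (w @ x) (w @ y) = lift k x y"
proof (cases "x = y")
  case True
  then show ?thesis using lift_diagonal[OF k] by simp
next
  case False
  have up: "lift_decomp V rt k (w @ x) (w @ y) (w @ u) v v'" if d: "lift_decomp V rt k x y u v v'" for u v v'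
  proof -
    have d: "u \<in> FP" "\<not> has_type V rt u k" "v \<in> V k" "v' \<in> V k" "x = u @ embed rt k v" "y = u @ embed rt k v'"
      using d by (auto simp: lift_decomp_def)
    have "w @ u \<in> FP \<and> \<not> has_type V rt (w @ u) k"
    proof (cases "u = []")
      case True
      have "embed rt k v \<noteq> [] \<or> embed rt k v' \<noteq> []" using False d by auto
      then have "\<exists>l. l \<in> letters j \<and> l \<in> letters k"
      proof
        assume ne: "embed rt k v \<noteq> []"
        then have "x \<noteq> []" "hd x \<in> letters k"
          using True d embed_letters[OF d(3)] hd_in_set[OF ne] by auto
        then show ?thesis using x by blast
      next
        assume ne: "embed rt k v' \<noteq> []"
        then have "y \<noteq> []" "hd y \<in> letters k"
          using True d embed_letters[OF d(4)] hd_in_set[OF ne] by auto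
        then show ?thesis using y by blast
      qed
      then have "k \<noteq> i" using ij_disjoint by blast
      then have "last w \<notin> letters k" using w(3) ij_disjoint k ij by auto
      then show ?thesis using True w by (simp add: has_type_def)
    next
      case u: False
      then have "hd u \<in> letters j" using x d by auto
      then show ?thesis
        using FP_append_type_iff[OF w u] d u by (simp add: has_type_def)
    qed
    then show ?thesis using d by (simp add: lift_decomp_def)
  qed
  have down: "\<exists>u. lift_decomp V rt k x y u v v'" if d: "lift_decomp V rt k (w @ x) (w @ y) u' v v'" for u' v v'
  proof -
    have d: "u' \<in> FP" "\<not> has_type V rt u' k" "v \<in> V k" "v' \<in> V k" "w @ x = u' @ embed rt k v" "w @ y = u' @ embed rt k v'"
      using d by (auto simp: lift_decomp_def)
    have "length w \<le> length u'"
    proof (rule ccontr)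
      assume "\<not> ?thesis"
      moreover have "length w + length x \<le> length u' + 1" "length w + length y \<le> length u' + 1"
        using arg_cong[OF d(5), of length] arg_cong[OF d(6), of length] length_embed[of k v] length_embed[of k v'] by auto
      ultimately have "length x = 0" "length y = 0" by linarith+
      then show False using False by simp
    qed
    then obtain u where u: "u' = w @ u"
      using d(5) by (metis append_eq_append_conv_if append_take_drop_id)
    have "u \<in> FP \<and> \<not> has_type V rt u k"
      using d(1,2) FP_append_type_iff[OF w, of u] Nil_in_FP unfolding u by (cases "u = []") (auto simp: has_type_def)
    then show ?thesis using d u by (auto simp: lift_decomp_def)
  qed
  show ?thesis
  proof (cases "\<exists>u v v'. lift_decomp V rt k x y u v v'")
    case True
    then obtain u v v' where d: "lift_decomp V rt k x y u v v'" by blast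
    show ?thesis using lift_decompD[OF d] lift_decompD[OF up[OF d]] by simp
  next
    case no: False
    then have "\<not> (\<exists>u v v'. lift_decomp V rt k (w @ x) (w @ y) u v v')" using down by blast
    then show ?thesis using no by (simp add: lift_eq_0)
  qed
qed

lemma Q_append_letter:
  assumes x: "x \<in> FP" "x = [] \<or> last x \<notin> letters i" and v: "v \<in> letters i"
  shows "Q x (x @ [v]) = coin i * p i (rt i) v"
proof -
  have nt: "\<not> has_type V rt x i" using x by (auto simp: has_type_def)
  have rt: "rt i \<in> V i" "v \<in> V i" "v \<noteq> rt i" using rt_in_V ij v by (auto simp: nonroot_def)
  have "lift i x (x @ [v]) = p i (rt i) v"
    using lift_matrix_eq[OF x(1) nt rt(1,2), of p] rt by (simp add: embed_def)
  moreover have "lift j x (x @ [v]) = 0"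
  proof (rule lift_eq_0, rule notI, elim exE)
    fix u v0 w0 assume "lift_decomp V rt j x (x @ [v]) u v0 w0"
    then have d: "x = u @ embed rt j v0" "x @ [v] = u @ embed rt j w0" "w0 \<in> V j" by (auto simp: lift_decomp_def)
    have "embed rt j w0 \<noteq> []" using d by (auto dest: arg_cong[of _ _ length])
    then have "v \<in> set (embed rt j w0)"
      using arg_cong[OF d(2), of last] last_in_set by fastforce
    then show False using embed_letters[OF d(3)] v ij_disjoint by blast
  qed
  ultimately show "Q x (x @ [v]) = coin i * p i (rt i) v"
    using ij by (auto simp: walk_matrix_def coin_def)
qed

lemma Q_append_letter_sum:
  assumes x: "x \<in> FP" "x = [] \<or> last x \<notin> letters i"
  shows "((\<lambda>v. Q x (x @ [v])) has_sum coin i) (letters i)"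
proof -
  have "(p i (rt i) has_sum 1) (V i)"
    using p_stochastic rt_in_V ij(1) unfolding transition_matrix_on_def by blast
  then have "(p i (rt i) has_sum 1) (letters i)"
    by (rule has_sum_cong_neutral[THEN iffD1, rotated -1]) (use p_diagonal rt_in_V ij in \<open>auto simp: nonroot_def\<close>)
  then have "((\<lambda>v. coin i * p i (rt i) v) has_sum (coin i * 1)) (letters i)"
    by (rule has_sum_cmult_right)
  then show ?thesis
    by (subst has_sum_cong[where g = "\<lambda>v. coin i * p i (rt i) v"]) (auto simp: Q_append_letter[OF x])
qed

lemma cone_graph_FP: "cone_graph FP Q (letters i) (letters j)"
proof
  show "[] \<in> FP" by (rule Nil_in_FP)
  show "u \<in> FP" if "u @ v \<in> FP" for u v using that by (simp add: FP_append_iff)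
  show "set x \<subseteq> letters i \<union> letters j" if "x \<in> FP" for x using letters_FP[OF that] ij by auto
  show "letters i \<inter> letters j = {}" by (rule ij_disjoint)
  show "0 \<le> Q x y" for x y by (rule Q_nonneg)
  show "x \<in> FP \<and> y \<in> FP \<and> (\<exists>u s t. x = u @ s \<and> y = u @ t \<and> length s \<le> 1 \<and> length t \<le> 1 \<and>
      (set s \<union> set t \<subseteq> letters i \<or> set s \<union> set t \<subseteq> letters j))" if "0 < Q x y" for x y
    using Q_edge[OF that] ij by auto
  show "w @ x \<in> FP \<longleftrightarrow> x \<in> FP \<and> hd x \<in> letters j"
    if "w \<in> FP" "w \<noteq> []" "last w \<in> letters i" "x \<noteq> []" for w x
    using that by (rule FP_append_type_iff)
  show "Q (w @ x) (w @ y) = Q x y"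
    if "w \<in> FP" "w \<noteq> []" "last w \<in> letters i" "x = [] \<or> x \<in> FP \<and> hd x \<in> letters j"
      "y = [] \<or> y \<in> FP \<and> hd y \<in> letters j" for w x y
    using that unfolding walk_matrix_def by (simp add: lift_translate)
qed

end

lemma countable_FP: "countable FP"
proof -
  have "countable (letters 1 \<union> letters 2)"
    using V_countable by (auto simp: nonroot_def)
  then have "countable (lists (letters 1 \<union> letters 2))" by (rule countable_lists)
  moreover have "FP \<subseteq> lists (letters 1 \<union> letters 2)" using letters_FP by (auto simp: in_lists_conv_set)
  ultimately show ?thesis by (rule countable_subset[rotated])
qed

end

section \<open>The lamps as independent coin flips\<close>

lemma Conf_values: "\<phi> \<in> Conf S \<Longrightarrow> \<phi> x = 0 \<or> \<phi> x = 1"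
  using rangeI[of \<phi> x] unfolding Conf_def by blast

lemma countable_Conf:
  assumes "countable S" shows "countable (Conf S)"
proof (rule countable_image_inj_on)
  show "countable (supp ` Conf S)"
    by (rule countable_subset[OF _ countable_Collect_finite_subset[OF assms]]) (auto simp: Conf_def)
  show "inj_on supp (Conf S)"
  proof (rule inj_onI, rule ext)
    fix \<phi> \<psi> :: "'a \<Rightarrow> int" and x assume *: "\<phi> \<in> Conf S" "\<psi> \<in> Conf S" "supp \<phi> = supp \<psi>"
    have "\<phi> x = 0 \<or> \<phi> x = 1" "\<psi> x = 0 \<or> \<psi> x = 1"
      by (rule Conf_values[OF *(1)], rule Conf_values[OF *(2)])
    moreover have "\<phi> x = 0 \<longleftrightarrow> \<psi> x = 0" using *(3) by (auto simp: supp_def)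
    ultimately show "\<phi> x = \<psi> x" by auto
  qed
qed

definition switch :: "('s \<Rightarrow> int) \<Rightarrow> 's \<Rightarrow> 's \<Rightarrow> int" where
  "switch \<phi> x = \<phi>(x := 1 - \<phi> x)"

lemma switch_Conf: "\<phi> \<in> Conf S \<Longrightarrow> x \<in> S \<Longrightarrow> switch \<phi> x \<in> Conf S"
proof -
  assume *: "\<phi> \<in> Conf S" "x \<in> S"
  have "supp (switch \<phi> x) \<subseteq> insert x (supp \<phi>)" by (auto simp: supp_def switch_def)
  moreover have "switch \<phi> x y \<in> {0, 1}" for y
  proof -
    have "\<phi> y = 0 \<or> \<phi> y = 1" using *(1) by (rule Conf_values)
    then show ?thesis by (auto simp: switch_def)
  qed
  ultimately show ?thesis using * unfolding Conf_def by (auto intro: finite_subset)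
qed

lemma supp_switch: "\<phi> \<in> Conf S \<Longrightarrow> supp (\<lambda>y. switch \<phi> x y - \<phi> y) = {x}"
proof -
  assume "\<phi> \<in> Conf S"
  then have "\<phi> x = 0 \<or> \<phi> x = 1" by (rule Conf_values)
  then have "1 - \<phi> x \<noteq> \<phi> x" by auto
  then show ?thesis by (auto simp: supp_def switch_def)
qed

lemma eq_switch:
  assumes "\<phi> \<in> Conf S" "\<psi> \<in> Conf S" "supp (\<lambda>y. \<psi> y - \<phi> y) = {x}"
  shows "\<psi> = switch \<phi> x"
proof
  fix y
  have "\<phi> y = 0 \<or> \<phi> y = 1" "\<psi> y = 0 \<or> \<psi> y = 1" by (rule Conf_values[OF assms(1)], rule Conf_values[OF assms(2)])
  moreover have "\<psi> y \<noteq> \<phi> y \<longleftrightarrow> y = x" using assms(3) by (auto simp: supp_def set_eq_iff)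
  ultimately show "\<psi> y = switch \<phi> x y" by (auto simp: switch_def)
qed

text \<open>
  The lamp configuration is a function of the positions and the flags.
\<close>

primrec lamps :: "(nat \<Rightarrow> 's \<times> bool) \<Rightarrow> nat \<Rightarrow> 's \<Rightarrow> int" where
  "lamps s 0 = (\<lambda>_. 0)"
| "lamps s (Suc n) = (if snd (s (Suc n)) then switch (lamps s n) (fst (s (Suc n))) else lamps s n)"

lemma lamps_cong: "(\<And>k. k \<le> n \<Longrightarrow> s k = s' k) \<Longrightarrow> lamps s n = lamps s' n"
  by (induction n) auto

lemma lamps_Conf: "(\<And>k. k \<le> n \<Longrightarrow> fst (s k) \<in> S) \<Longrightarrow> lamps s n \<in> Conf S"
proof (induction n)
  case 0 show ?case by (auto simp: Conf_def supp_def)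
next
  case (Suc n) then show ?case by (auto simp: switch_Conf)
qed

lemma lamps_parity:
  "lamps s n v = (if odd (card {k \<in> {1..n}. fst (s k) = v \<and> snd (s k)}) then 1 else 0)"
proof (induction n)
  case (Suc n)
  let ?A = "{k \<in> {1..n}. fst (s k) = v \<and> snd (s k)}"
  let ?B = "{k \<in> {1..Suc n}. fst (s k) = v \<and> snd (s k)}"
  have fin: "finite ?A" "Suc n \<notin> ?A" by auto
  show ?case
  proof (cases "fst (s (Suc n)) = v \<and> snd (s (Suc n))")
    case True
    then have "?B = insert (Suc n) ?A" by (auto simp: le_Suc_eq)
    then have "card ?B = Suc (card ?A)" using fin by simp
    then show ?thesis using Suc True by (simp add: switch_def)
  next
    case False
    then have "?B = ?A" by (auto simp: le_Suc_eq)
    moreover have "lamps s (Suc n) v = lamps s n v" using False by (auto simp: switch_def)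
    ultimately show ?thesis using Suc by simp
  qed
qed simp

text \<open>
  Passing from lamp configurations to flags turns the lamplighter chain into a chain that is invariant
  under translations: the configuration remembers the past, while a flag is a coin flip.
\<close>

locale lamplighter_chain =
  fixes M :: "'w measure" and S :: "'s set" and q :: "'s \<Rightarrow> 's \<Rightarrow> real" and \<beta> :: real and o1 :: 's
    and X :: "nat \<Rightarrow> 'w \<Rightarrow> 's" and \<Phi> :: "nat \<Rightarrow> 'w \<Rightarrow> 's \<Rightarrow> int"
  assumes S: "countable S" and q_S: "\<And>x y. q x y \<noteq> 0 \<Longrightarrow> y \<in> S"
    and chain: "markov_chain M (S \<times> Conf S) (lamplighter_matrix q \<beta>) (o1, \<lambda>_. 0) (\<lambda>n \<omega>. (X n \<omega>, \<Phi> n \<omega>))"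
begin

definition flip :: "nat \<Rightarrow> 'w \<Rightarrow> bool" where
  "flip n \<omega> \<longleftrightarrow> n \<noteq> 0 \<and> \<Phi> n \<omega> \<noteq> \<Phi> (n - 1) \<omega>"

sublocale prob_space M
  using chain by (simp add: markov_chain_def)

lemma Z_measurable: "(\<lambda>\<omega>. (X n \<omega>, \<Phi> n \<omega>)) \<in> measurable M (count_space (S \<times> Conf S))"
  using chain by (simp add: markov_chain_def)

lemma countable_states: "countable (S \<times> Conf S)"
  using S countable_Conf[OF S] by auto

lemma X_in_S: "\<omega> \<in> space M \<Longrightarrow> X n \<omega> \<in> S" and \<Phi>_in_Conf: "\<omega> \<in> space M \<Longrightarrow> \<Phi> n \<omega> \<in> Conf S"
  using measurable_space[OF Z_measurable] by auto

lemma X_measurable [measurable]: "X n \<in> measurable M (count_space UNIV)"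
  using measurable_compose[OF Z_measurable, of fst "count_space UNIV" n] by simp

lemma flip_measurable [measurable]: "flip n \<in> measurable M (count_space UNIV)"
proof (cases n)
  case (Suc m)
  have "(\<lambda>\<omega>. snd (X n \<omega>, \<Phi> n \<omega>) \<noteq> snd (X m \<omega>, \<Phi> m \<omega>)) \<in> measurable M (count_space UNIV)"
  proof (rule measurable_compose_countable'[OF _ Z_measurable countable_states])
    fix z :: "'s \<times> ('s \<Rightarrow> int)"
    show "(\<lambda>\<omega>. snd (X n \<omega>, \<Phi> n \<omega>) \<noteq> snd z) \<in> measurable M (count_space UNIV)"
      by (rule measurable_compose[OF Z_measurable]) simp
  qed
  then show ?thesis by (simp add: flip_def[abs_def] Suc)
qed (simp add: flip_def[abs_def])

lemma Z_ev: "{\<omega> \<in> space M. \<forall>k\<le>n. (X k \<omega>, \<Phi> k \<omega>) = a k} \<in> sets M"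
proof -
  have "{\<omega> \<in> space M. (X k \<omega>, \<Phi> k \<omega>) = a k} \<in> sets M" for k
  proof -
    have "(\<lambda>\<omega>. (X k \<omega>, \<Phi> k \<omega>)) \<in> measurable M (count_space UNIV)"
      using measurable_compose[OF Z_measurable, of "\<lambda>z. z" "count_space UNIV" k] by simp
    then have "(\<lambda>\<omega>. (X k \<omega>, \<Phi> k \<omega>)) -` {a k} \<inter> space M \<in> sets M" by (rule measurable_sets) simp
    then show ?thesis by (simp add: vimage_def Int_def conj_commute)
  qed
  then have "(\<Inter>k\<in>{..n}. {\<omega> \<in> space M. (X k \<omega>, \<Phi> k \<omega>) = a k}) \<in> sets M" by (intro sets.finite_INT) auto
  also have "(\<Inter>k\<in>{..n}. {\<omega> \<in> space M. (X k \<omega>, \<Phi> k \<omega>) = a k}) = {\<omega> \<in> space M. \<forall>k\<le>n. (X k \<omega>, \<Phi> k \<omega>) = a k}" by auto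
  finally show ?thesis .
qed

lemma AE_transition: "AE \<omega> in M. lamplighter_matrix q \<beta> (X n \<omega>, \<Phi> n \<omega>) (X (Suc n) \<omega>, \<Phi> (Suc n) \<omega>) \<noteq> 0"
proof -
  let ?T = "lists (S \<times> Conf S)"
  have "AE \<omega> in M. \<forall>l\<in>?T. length l = Suc (Suc n) \<longrightarrow> lamplighter_matrix q \<beta> (l ! n) (l ! Suc n) = 0
      \<longrightarrow> \<not> (\<forall>k\<le>Suc n. (X k \<omega>, \<Phi> k \<omega>) = l ! k)"
  proof (subst AE_ball_countable)
    show "countable ?T" by (intro countable_lists countable_states)
    show "\<forall>l\<in>?T. AE \<omega> in M. length l = Suc (Suc n) \<longrightarrow> lamplighter_matrix q \<beta> (l ! n) (l ! Suc n) = 0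
      \<longrightarrow> \<not> (\<forall>k\<le>Suc n. (X k \<omega>, \<Phi> k \<omega>) = l ! k)"
    proof
      fix l assume l: "l \<in> ?T"
      show "AE \<omega> in M. length l = Suc (Suc n) \<longrightarrow> lamplighter_matrix q \<beta> (l ! n) (l ! Suc n) = 0
        \<longrightarrow> \<not> (\<forall>k\<le>Suc n. (X k \<omega>, \<Phi> k \<omega>) = l ! k)"
      proof (cases "length l = Suc (Suc n) \<and> lamplighter_matrix q \<beta> (l ! n) (l ! Suc n) = 0")
        case True
        then have "\<forall>k\<le>Suc n. l ! k \<in> S \<times> Conf S" using l by (auto simp: in_lists_conv_set)
        then have "\<P>(\<omega> in M. \<forall>k\<le>Suc n. (X k \<omega>, \<Phi> k \<omega>) = l ! k)
          = \<P>(\<omega> in M. \<forall>k\<le>n. (X k \<omega>, \<Phi> k \<omega>) = l ! k) * lamplighter_matrix q \<beta> (l ! n) (l ! Suc n)"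
          using chain unfolding markov_chain_def by blast
        also have "\<dots> = 0" using True by simp
        finally show ?thesis
          using prob_eq_0[OF Z_ev[of "Suc n" "\<lambda>k. l ! k"]] by auto
      qed auto
    qed
  qed
  then show ?thesis
    using AE_space
  proof eventually_elim
    case (elim \<omega>)
    let ?l = "map (\<lambda>k. (X k \<omega>, \<Phi> k \<omega>)) [0..<Suc (Suc n)]"
    have nth: "?l ! k = (X k \<omega>, \<Phi> k \<omega>)" if "k \<le> Suc n" for k
      using that by (subst nth_map) (auto simp del: upt_Suc)
    have "?l \<in> ?T" using X_in_S \<Phi>_in_Conf elim by auto
    then show ?case using elim(1)[rule_format, of ?l] nth by auto
  qed
qed

lemma AE_lamps: "AE \<omega> in M. X 0 \<omega> = o1 \<and> (\<forall>n. \<Phi> n \<omega> = lamps (\<lambda>k. (X k \<omega>, flip k \<omega>)) n)"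
proof -
  have "AE \<omega> in M. (X 0 \<omega>, \<Phi> 0 \<omega>) = (o1, \<lambda>_. 0)" using chain by (simp add: markov_chain_def)
  moreover have "AE \<omega> in M. \<forall>n. lamplighter_matrix q \<beta> (X n \<omega>, \<Phi> n \<omega>) (X (Suc n) \<omega>, \<Phi> (Suc n) \<omega>) \<noteq> 0"
    using AE_transition by (simp add: AE_all_countable)
  ultimately show ?thesis
    using AE_space
  proof eventually_elim
    case (elim \<omega>)
    have step: "\<Phi> (Suc n) \<omega> = (if flip (Suc n) \<omega> then switch (\<Phi> n \<omega>) (X (Suc n) \<omega>) else \<Phi> n \<omega>)" for n
    proof (cases "supp (\<lambda>x. \<Phi> (Suc n) \<omega> x - \<Phi> n \<omega> x) = {X (Suc n) \<omega>}")
      case True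
      then have eq: "\<Phi> (Suc n) \<omega> = switch (\<Phi> n \<omega>) (X (Suc n) \<omega>)"
        by (rule eq_switch[OF \<Phi>_in_Conf[OF elim(3)] \<Phi>_in_Conf[OF elim(3)]])
      have "\<Phi> (Suc n) \<omega> \<noteq> \<Phi> n \<omega>" using True by (auto simp: supp_def)
      then show ?thesis using eq by (simp add: flip_def)
    next
      case False
      then have "\<Phi> n \<omega> = \<Phi> (Suc n) \<omega>"
        using elim(2)[rule_format, of n] by (auto simp: lamplighter_matrix_def split: if_splits)
      then show ?thesis by (simp add: flip_def)
    qed
    have "\<Phi> n \<omega> = lamps (\<lambda>k. (X k \<omega>, flip k \<omega>)) n" for n
      using elim(1) by (induction n) (auto simp: step)
    then show ?case using elim(1) by simp
  qed
qed

text \<open>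
  Almost surely the configurations are those computed from the flags, so a trajectory with flags and the
  corresponding trajectory with configurations are the same event.
\<close>

lemma prob_flags:
  assumes "s 0 = (o1, False)"
  shows "\<P>(\<omega> in M. \<forall>k\<le>n. (X k \<omega>, flip k \<omega>) = s k) = \<P>(\<omega> in M. \<forall>k\<le>n. (X k \<omega>, \<Phi> k \<omega>) = (fst (s k), lamps s k))"
proof (rule finite_measure_eq_AE)
  show "AE \<omega> in M. \<omega> \<in> {\<omega> \<in> space M. \<forall>k\<le>n. (X k \<omega>, flip k \<omega>) = s k}
    \<longleftrightarrow> \<omega> \<in> {\<omega> \<in> space M. \<forall>k\<le>n. (X k \<omega>, \<Phi> k \<omega>) = (fst (s k), lamps s k)}"
    using AE_lamps AE_space
  proof eventually_elim
    case (elim \<omega>)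
    let ?s = "\<lambda>k. (X k \<omega>, flip k \<omega>)"
    have "(\<forall>k\<le>n. ?s k = s k) \<longleftrightarrow> (\<forall>k\<le>n. X k \<omega> = fst (s k) \<and> \<Phi> k \<omega> = lamps s k)"
    proof
      assume *: "\<forall>k\<le>n. ?s k = s k"
      have "lamps ?s k = lamps s k" if "k \<le> n" for k using * that by (intro lamps_cong) auto
      moreover have "X k \<omega> = fst (s k)" if "k \<le> n" for k using *[rule_format, OF that] by (simp add: prod_eq_iff)
      ultimately show "\<forall>k\<le>n. X k \<omega> = fst (s k) \<and> \<Phi> k \<omega> = lamps s k" using elim(1) by simp
    next
      assume *: "\<forall>k\<le>n. X k \<omega> = fst (s k) \<and> \<Phi> k \<omega> = lamps s k"
      show "\<forall>k\<le>n. ?s k = s k"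
      proof (intro allI impI)
        fix k assume k: "k \<le> n"
        show "?s k = s k"
        proof (cases k)
          case 0 then show ?thesis using conjunct1[OF elim(1)] assms by (simp add: flip_def)
        next
          case (Suc m)
          have conf: "lamps s m \<in> Conf S" using *[rule_format, of m] k Suc \<Phi>_in_Conf[OF elim(2), of m] by simp
          have "flip k \<omega> \<longleftrightarrow> lamps s (Suc m) \<noteq> lamps s m" using * k Suc by (simp add: flip_def)
          also have "\<dots> \<longleftrightarrow> snd (s k)"
            using supp_switch[OF conf, of "fst (s k)"] Suc by (auto simp: supp_def)
          finally show ?thesis using * k by (simp add: prod_eq_iff)
        qed
      qed
    qed
    then show ?case using elim by simp
  qed
  show "{\<omega> \<in> space M. \<forall>k\<le>n. (X k \<omega>, \<Phi> k \<omega>) = (fst (s k), lamps s k)} \<in> sets M" by (rule Z_ev)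
  have "{\<omega> \<in> space M. \<forall>k\<le>n. X k \<omega> = fst (s k) \<and> flip k \<omega> = snd (s k)} \<in> sets M" by measurable
  then show "{\<omega> \<in> space M. \<forall>k\<le>n. (X k \<omega>, flip k \<omega>) = s k} \<in> sets M" by (simp add: prod_eq_iff)
qed

lemma prob_flags_step:
  "\<P>(\<omega> in M. (\<forall>k\<le>n. (X k \<omega>, flip k \<omega>) = s k) \<and> (X (Suc n) \<omega>, flip (Suc n) \<omega>) = (y, f))
    = \<P>(\<omega> in M. \<forall>k\<le>n. (X k \<omega>, flip k \<omega>) = s k) * (q (fst (s n)) y * (if f then \<beta> else 1 - \<beta>))"
proof -
  define s' where "s' = s(Suc n := (y, f))"
  have s': "s' k = s k" if "k \<le> n" for k using that by (simp add: s'_def)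
  have lhs: "{\<omega> \<in> space M. (\<forall>k\<le>n. (X k \<omega>, flip k \<omega>) = s k) \<and> (X (Suc n) \<omega>, flip (Suc n) \<omega>) = (y, f)}
    = {\<omega> \<in> space M. \<forall>k\<le>Suc n. (X k \<omega>, flip k \<omega>) = s' k}"
    by (auto simp: le_Suc_eq s'_def)
  have rhs: "{\<omega> \<in> space M. \<forall>k\<le>n. (X k \<omega>, flip k \<omega>) = s k} = {\<omega> \<in> space M. \<forall>k\<le>n. (X k \<omega>, flip k \<omega>) = s' k}"
    using s' by auto
  let ?G = "\<P>(\<omega> in M. \<forall>k\<le>Suc n. (X k \<omega>, flip k \<omega>) = s' k)
      = \<P>(\<omega> in M. \<forall>k\<le>n. (X k \<omega>, flip k \<omega>) = s' k) * (q (fst (s n)) y * (if f then \<beta> else 1 - \<beta>))"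
  \<comment> \<open>Both sides vanish unless the trajectory starts at the right state and remains in the state space.\<close>
  have 1: ?G if 1: "s' 0 \<noteq> (o1, False)"
  proof -
    have "AE \<omega> in M. (X 0 \<omega>, flip 0 \<omega>) = (o1, False)" using AE_lamps
    proof eventually_elim
      case (elim \<omega>)
      then have "X 0 \<omega> = o1" by blast
      then show ?case by (simp add: flip_def)
    qed
    then have "AE \<omega> in M. \<not> (\<forall>k\<le>m. (X k \<omega>, flip k \<omega>) = s' k)" for m
    proof eventually_elim
      case (elim \<omega>)
      have "(X 0 \<omega>, flip 0 \<omega>) \<noteq> s' 0" using elim 1 by simp
      then show ?case by blast
    qed
    then have "\<P>(\<omega> in M. \<forall>k\<le>m. (X k \<omega>, flip k \<omega>) = s' k) = 0" for m
      by (intro prob_eq_0_AE) auto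
    then show ?G by simp
  qed
  have 2: ?G if 2: "\<exists>k\<le>n. fst (s' k) \<notin> S"
  proof -
    from 2 obtain k where k: "k \<le> n" "fst (s' k) \<notin> S" by blast
    have e: "{\<omega> \<in> space M. \<forall>k\<le>m. (X k \<omega>, flip k \<omega>) = s' k} = {}" if "n \<le> m" for m
    proof -
      have "(X k \<omega>, flip k \<omega>) \<noteq> s' k" if "\<omega> \<in> space M" for \<omega>
        using k(2) X_in_S[OF that, of k] by (cases "s' k") auto
      moreover have "k \<le> m" using k(1) that by simp
      ultimately show ?thesis by blast
    qed
    show ?G
      unfolding e[OF le_SucI[OF order_refl]] e[OF order_refl] by simp
  qed
  have 3: ?G if 3: "y \<notin> S"
  proof -
    have e: "{\<omega> \<in> space M. \<forall>k\<le>Suc n. (X k \<omega>, flip k \<omega>) = s' k} = {}"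
    proof -
      have "(X (Suc n) \<omega>, flip (Suc n) \<omega>) \<noteq> s' (Suc n)" if "\<omega> \<in> space M" for \<omega>
        using 3 X_in_S[OF that, of "Suc n"] by (auto simp: s'_def)
      then show ?thesis by blast
    qed
    have "q (fst (s n)) y = 0" using q_S 3 by blast
    then show ?G
      unfolding e by simp
  qed
  have 4: ?G if 4: "s' 0 = (o1, False)" "\<forall>k\<le>Suc n. fst (s' k) \<in> S"
  proof -
    define a where "a k = (fst (s' k), lamps s' k)" for k
    have conf: "lamps s' k \<in> Conf S" if "k \<le> Suc n" for k using 4(2) that by (intro lamps_Conf) auto
    then have "\<forall>k\<le>Suc n. a k \<in> S \<times> Conf S" using 4(2) by (auto simp: a_def)
    then have "\<P>(\<omega> in M. \<forall>k\<le>Suc n. (X k \<omega>, \<Phi> k \<omega>) = a k)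
        = \<P>(\<omega> in M. \<forall>k\<le>n. (X k \<omega>, \<Phi> k \<omega>) = a k) * lamplighter_matrix q \<beta> (a n) (a (Suc n))"
      using chain unfolding markov_chain_def by blast
    also have "lamplighter_matrix q \<beta> (a n) (a (Suc n)) = q (fst (s n)) y * (if f then \<beta> else 1 - \<beta>)"
    proof -
      define \<phi> where "\<phi> = lamps s' n"
      have "s' (Suc n) = (y, f)" "s' n = s n" by (simp_all add: s'_def)
      then have "a n = (fst (s n), \<phi>)" "a (Suc n) = (y, if f then switch \<phi> y else \<phi>)"
        by (simp_all add: a_def \<phi>_def)
      moreover have "supp (\<lambda>x. switch \<phi> y x - \<phi> x) = {y}"
        unfolding \<phi>_def by (rule supp_switch[OF conf]) simp
      moreover have "supp (\<lambda>x. \<phi> x - \<phi> x) \<noteq> {y}" by (simp add: supp_def)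
      ultimately show ?thesis by (cases f) (simp_all add: lamplighter_matrix_def)
    qed
    finally show ?G
      unfolding prob_flags[of s', OF 4(1)] a_def .
  qed
  show ?thesis
    unfolding lhs rhs
  proof (cases "s' 0 = (o1, False) \<and> (\<forall>k\<le>Suc n. fst (s' k) \<in> S)")
    case True then show ?G using 4 by blast
  next
    case no: False
    show ?G
    proof (cases "s' 0 = (o1, False)")
      case True
      then obtain k where k: "k \<le> Suc n" "fst (s' k) \<notin> S" using no by blast
      show ?G
      proof (cases "k = Suc n")
        case True then show ?G using k(2) by (intro 3) (simp add: s'_def)
      next
        case False
        then have "k \<le> n" using k(1) by simp
        then show ?G using k(2) by (intro 2) blast
      qed
    qed (rule 1)
  qed
qed

lemma AE_supp: "AE \<omega> in M. \<forall>n. supp (\<Phi> n \<omega>) = {v. odd (card {k \<in> {1..n}. X k \<omega> = v \<and> flip k \<omega>})}"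
  using AE_lamps by eventually_elim (auto simp: supp_def lamps_parity)

end

section \<open>The speed of the lamplighter walk\<close>

lemma lamplighter_length_eq_tour:
  assumes "cone_graph W q I J" "x 0 = []"
  shows "lamplighter_length W q (map x [0..<Suc n]) \<phi> = cone_graph.tour W q [] [] (x n) (supp \<phi>)"
proof -
  interpret cone_graph W q I J by (rule assms(1))
  have "hd (map x [0..<Suc n]) = []" "last (map x [0..<Suc n]) = x n"
    using assms(2) by (simp_all add: hd_map del: upt_Suc) simp
  then show ?thesis
    unfolding lamplighter_length_def tour_def tour_lengths_def Inf_nat_def
    by (intro arg_cong[where f = Least] ext) auto
qed

lemma flagged_walk_FP:
  assumes fp: "free_product_walk V rt p \<alpha>" and \<beta>: "0 < \<beta>" "\<beta> < 1"
    and lc: "lamplighter_chain M (free_product V rt) (walk_matrix V rt p \<alpha>) \<beta> [] X \<Phi>"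
    and ij: "i \<in> {1, 2}" "j \<in> {1, 2}" "i \<noteq> j"
  shows "flagged_walk (free_product V rt) (walk_matrix V rt p \<alpha>) (nonroot V rt i) (nonroot V rt j) M X
    (lamplighter_chain.flip \<Phi>) \<beta> (free_product_walk.coin \<alpha> i)"
proof -
  interpret F: free_product_walk V rt p \<alpha> by (rule fp)
  interpret L: lamplighter_chain M F.FP F.Q \<beta> "[]" X \<Phi> by (rule lc)
  interpret cone_graph F.FP F.Q "nonroot V rt i" "nonroot V rt j" by (rule F.cone_graph_FP[OF ij])
  show ?thesis
  proof
    show "countable F.FP" by (rule F.countable_FP)
    show "AE \<omega> in M. X 0 \<omega> = []" using L.AE_lamps by auto
    show "0 < F.coin i" "F.coin i \<le> 1" by (rule F.coin)+
    show "((\<lambda>v. F.Q x (x @ [v])) has_sum F.coin i) (nonroot V rt i)"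
      if "x \<in> F.FP" "x = [] \<or> last x \<notin> nonroot V rt i" for x
      using that by (rule F.Q_append_letter_sum[OF ij])
    show "X n \<in> measurable M (count_space UNIV)" for n by (rule L.X_measurable)
    show "L.flip n \<in> measurable M (count_space UNIV)" for n by (rule L.flip_measurable)
    show "X n \<omega> \<in> F.FP" if "\<omega> \<in> space M" for \<omega> n using that by (rule L.X_in_S)
    show "L.prob {\<omega> \<in> space M. (\<forall>k\<le>n. (X k \<omega>, L.flip k \<omega>) = s k) \<and> (X (Suc n) \<omega>, L.flip (Suc n) \<omega>) = (y, f)}
       = L.prob {\<omega> \<in> space M. \<forall>k\<le>n. (X k \<omega>, L.flip k \<omega>) = s k} * (F.Q (fst (s n)) y * (if f then \<beta> else 1 - \<beta>))"
      for n s y f by (rule L.prob_flags_step)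
  qed (use \<beta> in auto)
qed

lemma AE_lamplighter_length_eq_tour:
  assumes cg: "cone_graph S q I J" and lc: "lamplighter_chain M S q \<beta> [] X \<Phi>"
  shows "AE \<omega> in M. \<forall>n. lamplighter_length S q (map (\<lambda>k. X k \<omega>) [0..<Suc n]) (\<Phi> n \<omega>)
    = cone_graph.tour S q [] [] (X n \<omega>) (cone_graph.lit (\<lambda>k. X k \<omega>) (\<lambda>k. lamplighter_chain.flip \<Phi> k \<omega>) n)"
proof -
  interpret cone_graph S q I J by (rule cg)
  interpret L: lamplighter_chain M S q \<beta> "[]" X \<Phi> by (rule lc)
  show ?thesis
    using L.AE_supp L.AE_lamps
  proof eventually_elim
    case (elim \<omega>)
    have x0: "X 0 \<omega> = []" using elim(2) by blast
    have "supp (\<Phi> n \<omega>) = lit (\<lambda>k. X k \<omega>) (\<lambda>k. L.flip k \<omega>) n" for n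
      using elim(1) unfolding lit_def by blast
    then show ?case
      using lamplighter_length_eq_tour[of S q I J "\<lambda>k. X k \<omega>", OF cg x0] by (simp del: upt_Suc)
  qed
qed

lemma speed_of_escaping_walk:
  assumes ew: "escaping_walk S q I J M X (lamplighter_chain.flip \<Phi>) \<beta> a"
    and lc: "lamplighter_chain M S q \<beta> [] X \<Phi>"
  shows "\<exists>c :: real. c > 0 \<and> (AE \<omega> in M. (\<lambda>n. 1 / real n *
    real (lamplighter_length S q (map (\<lambda>k. X k \<omega>) [0..<Suc n]) (\<Phi> n \<omega>))) \<longlonglongrightarrow> c)"
proof -
  interpret escaping_walk S q I J M X "lamplighter_chain.flip \<Phi>" \<beta> a by (rule ew)
  have "AE \<omega> in M. (\<lambda>n. 1 / real n * real (lamplighter_length S q (map (\<lambda>k. X k \<omega>) [0..<Suc n]) (\<Phi> n \<omega>)))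
      \<longlonglongrightarrow> mean_tour / mean_length"
    using tour_speed AE_lamplighter_length_eq_tour[OF cone_graph_axioms lc]
    by eventually_elim (simp del: upt_Suc)
  moreover have "0 < mean_tour / mean_length"
    using mean_tour_pos mean_length_pos by (rule divide_pos_pos)
  ultimately show ?thesis by blast
qed

theorem theorem4p14:
  fixes V :: "nat \<Rightarrow> 'a set" and rt :: "nat \<Rightarrow> 'a"
    and p :: "nat \<Rightarrow> 'a \<Rightarrow> 'a \<Rightarrow> real" and \<alpha> \<beta> :: real
    and M :: "'w measure"
    and X :: "nat \<Rightarrow> 'w \<Rightarrow> 'a list" and \<Phi> :: "nat \<Rightarrow> 'w \<Rightarrow> 'a list \<Rightarrow> int"
  assumes "V 1 \<inter> V 2 = {}"
    and "\<forall>i\<in>{1, 2}. countable (V i)"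
    and "\<forall>i\<in>{1, 2}. infinite (V i) \<or> card (V i) \<ge> 2"
    and "\<not> (card (V 1) = 2 \<and> card (V 2) = 2)"
    and "\<forall>i\<in>{1, 2}. rt i \<in> V i"
    and "\<forall>i\<in>{1, 2}. transition_matrix_on (V i) (p i)"
    and "\<forall>i\<in>{1, 2}. \<forall>x\<in>V i. p i x x = 0"
    and "\<forall>i\<in>{1, 2}. \<forall>x\<in>V i. \<exists>n\<ge>1. nstep (V i) (p i) n (rt i) x > 0"
    and "0 < \<alpha>" and "\<alpha> < 1"
    and "0 < \<beta>" and "\<beta> < 1"
    and "markov_chain M (free_product V rt \<times> Conf (free_product V rt))
           (lamplighter_matrix (walk_matrix V rt p \<alpha>) \<beta>) ([], \<lambda>_. 0)
           (\<lambda>n \<omega>. (X n \<omega>, \<Phi> n \<omega>))"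
    and "conv_radius (\<lambda>n. measure M {\<omega> \<in> space M. X n \<omega> = []}) > 1"
  shows "\<exists>c_LL :: real. c_LL > 0 \<and>
    (AE \<omega> in M.
      (\<lambda>n. 1 / real n *
         real (lamplighter_length (free_product V rt) (walk_matrix V rt p \<alpha>)
                 (map (\<lambda>k. X k \<omega>) [0..<Suc n]) (\<Phi> n \<omega>)))
      \<longlonglongrightarrow> c_LL)"
proof -
  let ?W = "free_product V rt" and ?q = "walk_matrix V rt p \<alpha>" and ?E = "lamplighter_chain.flip \<Phi>"
  have fp: "free_product_walk V rt p \<alpha>"
    using assms by unfold_locales auto
  interpret F: free_product_walk V rt p \<alpha> by (rule fp)
  have lc: "lamplighter_chain M ?W ?q \<beta> [] X \<Phi>"
  proof
    show "countable ?W" by (rule F.countable_FP)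
    show "y \<in> ?W" if "?q x y \<noteq> 0" for x y
      using F.Q_edge[of x y] F.Q_nonneg[of x y] that by (simp add: less_le)
  qed (use assms in blast)
  interpret L: lamplighter_chain M ?W ?q \<beta> "[]" X \<Phi> by (rule lc)
  have fw: "flagged_walk ?W ?q (nonroot V rt i) (nonroot V rt j) M X ?E \<beta> (F.coin i)"
    if "i \<in> {1, 2}" "j \<in> {1, 2}" "i \<noteq> j" for i j
    using flagged_walk_FP[OF fp _ _ lc that] assms by blast
  interpret F12: flagged_walk ?W ?q "nonroot V rt 1" "nonroot V rt 2" M X ?E \<beta> "F.coin 1"
    by (rule fw) auto
  interpret F21: flagged_walk ?W ?q "nonroot V rt 2" "nonroot V rt 1" M X ?E \<beta> "F.coin 2"
    by (rule fw) auto
  have "summable (\<lambda>n. L.prob {\<omega> \<in> space M. X n \<omega> = []} * 1 ^ n)"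
    using assms(14) by (intro summable_in_conv_radius) (simp add: one_ereal_def)
  then have "0 < F12.escape \<or> 0 < F21.escape"
    using F12.prob_branch_pos unfolding F21.escape_def F21.starts_J_def by simp
  then show ?thesis
  proof
    assume "0 < F12.escape"
    then have "escaping_walk ?W ?q (nonroot V rt 1) (nonroot V rt 2) M X ?E \<beta> (F.coin 1)"
      by unfold_locales
    then show ?thesis using lc by (rule speed_of_escaping_walk)
  next
    assume "0 < F21.escape"
    then have "escaping_walk ?W ?q (nonroot V rt 2) (nonroot V rt 1) M X ?E \<beta> (F.coin 2)"
      by unfold_locales
    then show ?thesis using lc by (rule speed_of_escaping_walk)
  qed
qed

end
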